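(* Let $\mathcal{V}$ be a locally presentable symmetric monoidal closed category. Then the functor $$P\colon \mathbf{Mon}(\mathcal{V})^{\mathrm{op}}\times\mathbf{Mon}(\mathcal{V})\longrightarrow\mathbf{Comon}(\mathcal{V}),\qquad (A,B)\mapsto P(A,B),$$ is a braided monoidal functor.
   Context: "Monoidal functor" means lax monoidal functor (structure maps $F(X)\otimes F(Y)\to F(X\otimes Y)$ and $I\to F(I)$, not necessarily invertible); it is braided if it is compatible with the braidings. $\mathbf{Mon}(\mathcal{V})$ and $\mathbf{Comon}(\mathcal{V})$, the categories of monoids and comonoids in $\mathcal{V}$, are symmetric monoidal under $\otimes$ with the symmetry of $\mathcal{V}$. For a comonoid $C$ and a monoid $B$, the internal hom $[C,B]$ has the convolution monoid structure. $P(A,B)$, the universal measuring comonoid, is the comonoid with natural bijections $\mathbf{Mon}(\mathcal{V})(A,[C,B])\cong\mathbf{Comon}(\mathcal{V})(C,P(A,B))$; it exists for all monoids $A,B$ under the stated hypotheses, and is functorial in $A$ (contravariantly) and $B$. The monoidal structure meant on $P$ is the one corresponding, under this parametrised adjunction, to the canonical lax monoidal structure $[C,B]\otimes[C',B']\to[C\otimes C',B\otimes B']$, $I\cong[I,I]$ of the internal hom. *)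

theory Defs
  imports Main
begin

unbundle cardinal_syntax

section \<open>Categories\<close>

text \<open>Objects and arrows live in two types; every arrow knows its domain and codomain.
  Composition is written in the usual order (\<open>g \<cdot> f\<close> is \<open>g\<close> after \<open>f\<close>) and is only meaningful on
  composable arrows.\<close>

record ('o, 'a) cat =
  Obj :: "'o set"
  Arr :: "'a set"
  Dom :: "'a \<Rightarrow> 'o"
  Cod :: "'a \<Rightarrow> 'o"
  Ident :: "'o \<Rightarrow> 'a"  (\<open>\<one>\<index>\<close>)
  Comp :: "'a \<Rightarrow> 'a \<Rightarrow> 'a"  (infixl \<open>\<cdot>\<index>\<close> 70)

definition hom :: "('o, 'a, 'z) cat_scheme \<Rightarrow> 'o \<Rightarrow> 'o \<Rightarrow> 'a set"
  where "hom C X Y = {f \<in> Arr C. Dom C f = X \<and> Cod C f = Y}"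

locale category =
  fixes C :: "('o, 'a, 'z) cat_scheme" (structure)
  assumes Dom_in_Obj: "f \<in> Arr C \<Longrightarrow> Dom C f \<in> Obj C"
    and Cod_in_Obj: "f \<in> Arr C \<Longrightarrow> Cod C f \<in> Obj C"
    and Ident_in_hom: "X \<in> Obj C \<Longrightarrow> \<one> X \<in> hom C X X"
    and Comp_in_hom: "\<lbrakk>f \<in> hom C X Y; g \<in> hom C Y Z\<rbrakk> \<Longrightarrow> g \<cdot> f \<in> hom C X Z"
    and Comp_Ident_left: "f \<in> hom C X Y \<Longrightarrow> \<one> Y \<cdot> f = f"
    and Comp_Ident_right: "f \<in> hom C X Y \<Longrightarrow> f \<cdot> \<one> X = f"
    and Comp_assoc: "\<lbrakk>f \<in> hom C W X; g \<in> hom C X Y; h \<in> hom C Y Z\<rbrakk>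
           \<Longrightarrow> (h \<cdot> g) \<cdot> f = h \<cdot> (g \<cdot> f)"

definition is_inverse :: "('o, 'a, 'z) cat_scheme \<Rightarrow> 'a \<Rightarrow> 'a \<Rightarrow> bool"
  where "is_inverse C f g \<longleftrightarrow> g \<in> hom C (Cod C f) (Dom C f)
           \<and> Comp C g f = Ident C (Dom C f) \<and> Comp C f g = Ident C (Cod C f)"

definition is_iso :: "('o, 'a, 'z) cat_scheme \<Rightarrow> 'a \<Rightarrow> bool"
  where "is_iso C f \<longleftrightarrow> f \<in> Arr C \<and> (\<exists>g. is_inverse C f g)"

definition inv_arr :: "('o, 'a, 'z) cat_scheme \<Rightarrow> 'a \<Rightarrow> 'a"
  where "inv_arr C f = (THE g. is_inverse C f g)"

record ('o, 'a, 'p, 'b) func =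
  Fun0 :: "'o \<Rightarrow> 'p"
  Fun1 :: "'a \<Rightarrow> 'b"

locale cat_functor = source: category C + target: category D
  for C :: "('o, 'a, 'y) cat_scheme" and D :: "('p, 'b, 'z) cat_scheme" +
  fixes F :: "('o, 'a, 'p, 'b, 'w) func_scheme"
  assumes Fun0_in_Obj: "X \<in> Obj C \<Longrightarrow> Fun0 F X \<in> Obj D"
    and Fun1_in_hom: "f \<in> hom C X Y \<Longrightarrow> Fun1 F f \<in> hom D (Fun0 F X) (Fun0 F Y)"
    and Fun1_Ident: "X \<in> Obj C \<Longrightarrow> Fun1 F (Ident C X) = Ident D (Fun0 F X)"
    and Fun1_Comp: "\<lbrakk>f \<in> hom C X Y; g \<in> hom C Y Z\<rbrakk>
           \<Longrightarrow> Fun1 F (Comp C g f) = Comp D (Fun1 F g) (Fun1 F f)"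


section \<open>Locally presentable categories\<close>

text \<open>Smallness is relative to a Grothendieck universe, given by an uncountable strongly inaccessible
  cardinal \<open>\<kappa>\<close>: a set is small iff its cardinality is below \<open>\<kappa>\<close>. A small category, poset or set is
  isomorphic to one whose elements are taken from the underlying type of \<open>\<kappa>\<close>, so
  it is enough to let indexing categories and test sets range over that type.\<close>

definition inaccessible :: "'k rel \<Rightarrow> bool"
  where "inaccessible \<kappa> \<longleftrightarrow> Card_order \<kappa> \<and> natLeq <o \<kappa> \<and> regularCard \<kappa>
           \<and> (\<forall>S :: 'k set. |S| <o \<kappa> \<longrightarrow> |Pow S| <o \<kappa>)"

definition cocone :: "('i, 'j, 'x) cat_scheme \<Rightarrow> ('o, 'a, 'y) cat_scheme
    \<Rightarrow> ('i, 'j, 'o, 'a, 'w) func_scheme \<Rightarrow> 'o \<Rightarrow> ('i \<Rightarrow> 'a) \<Rightarrow> bool"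
  where "cocone J C D L \<iota> \<longleftrightarrow> L \<in> Obj C \<and> (\<forall>i\<in>Obj J. \<iota> i \<in> hom C (Fun0 D i) L)
           \<and> (\<forall>u\<in>Arr J. Comp C (\<iota> (Cod J u)) (Fun1 D u) = \<iota> (Dom J u))"

definition colimit_cocone :: "('i, 'j, 'x) cat_scheme \<Rightarrow> ('o, 'a, 'y) cat_scheme
    \<Rightarrow> ('i, 'j, 'o, 'a, 'w) func_scheme \<Rightarrow> 'o \<Rightarrow> ('i \<Rightarrow> 'a) \<Rightarrow> bool"
  where "colimit_cocone J C D L \<iota> \<longleftrightarrow> cocone J C D L \<iota>
           \<and> (\<forall>M \<mu>. cocone J C D M \<mu> \<longrightarrow>
                (\<exists>!m. m \<in> hom C L M \<and> (\<forall>i\<in>Obj J. Comp C m (\<iota> i) = \<mu> i)))"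

definition cocomplete :: "'k rel \<Rightarrow> ('o, 'a, 'z) cat_scheme \<Rightarrow> bool"
  where "cocomplete \<kappa> C \<longleftrightarrow>
    (\<forall>(J :: ('k, 'k) cat) (D :: ('k, 'k, 'o, 'a) func).
        cat_functor J C D \<and> |Obj J| <o \<kappa> \<and> |Arr J| <o \<kappa> \<longrightarrow> (\<exists>L \<iota>. colimit_cocone J C D L \<iota>))"

definition poset_cat :: "'k set \<Rightarrow> 'k rel \<Rightarrow> ('k, 'k \<times> 'k) cat"
  where "poset_cat S r = \<lparr>Obj = S, Arr = r, Dom = fst, Cod = snd, Ident = (\<lambda>x. (x, x)),
           Comp = (\<lambda>v u. (fst u, snd v))\<rparr>"

definition directed_poset :: "'k rel \<Rightarrow> 'k set \<Rightarrow> 'k rel \<Rightarrow> bool"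
  where "directed_poset \<theta> S r \<longleftrightarrow> r \<subseteq> S \<times> S \<and> partial_order_on S r
           \<and> (\<forall>T \<subseteq> S. |T| <o \<theta> \<longrightarrow> (\<exists>u\<in>S. \<forall>t\<in>T. (t, u) \<in> r))"

text \<open>The functor \<open>hom(X, -)\<close> to small sets sends the cocone \<open>\<iota>\<close> with vertex \<open>L\<close> to a colimit cocone:
  \<open>h\<close> is a cocone of functions \<open>hom(X, D i) \<rightarrow> S\<close>, and \<open>m\<close> the induced function
  \<open>hom(X, L) \<rightarrow> S\<close>, which is required to be unique on \<open>hom(X, L)\<close>.\<close>

definition hom_preserves_colimit :: "'k rel \<Rightarrow> ('o, 'a, 'z) cat_scheme \<Rightarrow> 'o
    \<Rightarrow> ('i, 'j, 'x) cat_scheme \<Rightarrow> ('i, 'j, 'o, 'a, 'w) func_scheme \<Rightarrow> 'o \<Rightarrow> ('i \<Rightarrow> 'a) \<Rightarrow> bool"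
  where "hom_preserves_colimit \<kappa> C X J D L \<iota> \<longleftrightarrow>
    (\<forall>(S :: 'k set) (h :: 'i \<Rightarrow> 'a \<Rightarrow> 'k).
        |S| <o \<kappa>
        \<and> (\<forall>i\<in>Obj J. \<forall>f\<in>hom C X (Fun0 D i). h i f \<in> S)
        \<and> (\<forall>u\<in>Arr J. \<forall>f\<in>hom C X (Fun0 D (Dom J u)).
              h (Cod J u) (Comp C (Fun1 D u) f) = h (Dom J u) f)
      \<longrightarrow> (\<exists>m. (\<forall>f\<in>hom C X L. m f \<in> S)
              \<and> (\<forall>i\<in>Obj J. \<forall>f\<in>hom C X (Fun0 D i). m (Comp C (\<iota> i) f) = h i f)
              \<and> (\<forall>m'. (\<forall>f\<in>hom C X L. m' f \<in> S)
                    \<and> (\<forall>i\<in>Obj J. \<forall>f\<in>hom C X (Fun0 D i). m' (Comp C (\<iota> i) f) = h i f)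
                    \<longrightarrow> (\<forall>f\<in>hom C X L. m' f = m f))))"

definition presentable :: "'k rel \<Rightarrow> 'k rel \<Rightarrow> ('o, 'a, 'z) cat_scheme \<Rightarrow> 'o \<Rightarrow> bool"
  where "presentable \<kappa> \<theta> C X \<longleftrightarrow> X \<in> Obj C
    \<and> (\<forall>(S :: 'k set) r (D :: ('k, 'k \<times> 'k, 'o, 'a) func) L \<iota>.
          directed_poset \<theta> S r \<and> |S| <o \<kappa> \<and> cat_functor (poset_cat S r) C D
          \<and> colimit_cocone (poset_cat S r) C D L \<iota>
        \<longrightarrow> hom_preserves_colimit \<kappa> C X (poset_cat S r) D L \<iota>)"

definition locally_presentable :: "'k rel \<Rightarrow> ('o, 'a, 'z) cat_scheme \<Rightarrow> bool"
  where "locally_presentable \<kappa> C \<longleftrightarrow>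
    category C
    \<and> (\<forall>X\<in>Obj C. \<forall>Y\<in>Obj C. |hom C X Y| <o \<kappa>)
    \<and> cocomplete \<kappa> C
    \<and> (\<exists>\<theta> :: 'k rel. Card_order \<theta> \<and> infinite (Field \<theta>) \<and> regularCard \<theta> \<and> \<theta> <o \<kappa>
        \<and> (\<exists>G \<subseteq> Obj C. |G| <o \<kappa> \<and> (\<forall>X\<in>G. presentable \<kappa> \<theta> C X)
            \<and> (\<forall>X\<in>Obj C. \<exists>(S :: 'k set) r (D :: ('k, 'k \<times> 'k, 'o, 'a) func) \<iota>.
                  directed_poset \<theta> S r \<and> |S| <o \<kappa> \<and> cat_functor (poset_cat S r) C D
                  \<and> Fun0 D ` S \<subseteq> G \<and> colimit_cocone (poset_cat S r) C D X \<iota>)))"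


section \<open>Symmetric monoidal closed categories\<close>

text \<open>One record carries all the structure of a symmetric monoidal category; the field \<open>Braid\<close> is
  ignored by \<open>monoidal_category\<close>.\<close>

record ('o, 'a) moncat = "('o, 'a) cat" +
  Tens0 :: "'o \<Rightarrow> 'o \<Rightarrow> 'o"  (infixl \<open>\<odot>\<index>\<close> 75)
  Tens1 :: "'a \<Rightarrow> 'a \<Rightarrow> 'a"  (infixl \<open>\<otimes>\<index>\<close> 75)
  TUnit :: "'o"  (\<open>\<I>\<index>\<close>)
  Assoc :: "'o \<Rightarrow> 'o \<Rightarrow> 'o \<Rightarrow> 'a"
  LUnit :: "'o \<Rightarrow> 'a"
  RUnit :: "'o \<Rightarrow> 'a"
  Braid :: "'o \<Rightarrow> 'o \<Rightarrow> 'a"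

locale monoidal_category = category V
  for V :: "('o, 'a, 'z) moncat_scheme" (structure) +
  assumes TUnit_in_Obj: "\<I> \<in> Obj V"
    and Tens0_in_Obj: "\<lbrakk>X \<in> Obj V; Y \<in> Obj V\<rbrakk> \<Longrightarrow> X \<odot> Y \<in> Obj V"
    and Tens1_in_hom: "\<lbrakk>f \<in> hom V X Y; g \<in> hom V X' Y'\<rbrakk> \<Longrightarrow> f \<otimes> g \<in> hom V (X \<odot> X') (Y \<odot> Y')"
    and Tens1_Ident: "\<lbrakk>X \<in> Obj V; Y \<in> Obj V\<rbrakk> \<Longrightarrow> \<one> X \<otimes> \<one> Y = \<one> (X \<odot> Y)"
    and Tens1_Comp: "\<lbrakk>f \<in> hom V X Y; g \<in> hom V Y Z; f' \<in> hom V X' Y'; g' \<in> hom V Y' Z'\<rbrakk>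
           \<Longrightarrow> (g \<cdot> f) \<otimes> (g' \<cdot> f') = (g \<otimes> g') \<cdot> (f \<otimes> f')"
    and Assoc_in_hom: "\<lbrakk>X \<in> Obj V; Y \<in> Obj V; Z \<in> Obj V\<rbrakk>
           \<Longrightarrow> Assoc V X Y Z \<in> hom V ((X \<odot> Y) \<odot> Z) (X \<odot> (Y \<odot> Z))"
    and Assoc_iso: "\<lbrakk>X \<in> Obj V; Y \<in> Obj V; Z \<in> Obj V\<rbrakk> \<Longrightarrow> is_iso V (Assoc V X Y Z)"
    and Assoc_natural: "\<lbrakk>f \<in> hom V X X'; g \<in> hom V Y Y'; h \<in> hom V Z Z'\<rbrakk>
           \<Longrightarrow> Assoc V X' Y' Z' \<cdot> ((f \<otimes> g) \<otimes> h) = (f \<otimes> (g \<otimes> h)) \<cdot> Assoc V X Y Z"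
    and LUnit_in_hom: "X \<in> Obj V \<Longrightarrow> LUnit V X \<in> hom V (\<I> \<odot> X) X"
    and LUnit_iso: "X \<in> Obj V \<Longrightarrow> is_iso V (LUnit V X)"
    and LUnit_natural: "f \<in> hom V X Y \<Longrightarrow> LUnit V Y \<cdot> (\<one> \<I> \<otimes> f) = f \<cdot> LUnit V X"
    and RUnit_in_hom: "X \<in> Obj V \<Longrightarrow> RUnit V X \<in> hom V (X \<odot> \<I>) X"
    and RUnit_iso: "X \<in> Obj V \<Longrightarrow> is_iso V (RUnit V X)"
    and RUnit_natural: "f \<in> hom V X Y \<Longrightarrow> RUnit V Y \<cdot> (f \<otimes> \<one> \<I>) = f \<cdot> RUnit V X"
    and pentagon: "\<lbrakk>W \<in> Obj V; X \<in> Obj V; Y \<in> Obj V; Z \<in> Obj V\<rbrakk>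
           \<Longrightarrow> Assoc V W X (Y \<odot> Z) \<cdot> Assoc V (W \<odot> X) Y Z
             = (\<one> W \<otimes> Assoc V X Y Z) \<cdot> (Assoc V W (X \<odot> Y) Z \<cdot> (Assoc V W X Y \<otimes> \<one> Z))"
    and triangle: "\<lbrakk>X \<in> Obj V; Y \<in> Obj V\<rbrakk>
           \<Longrightarrow> (\<one> X \<otimes> LUnit V Y) \<cdot> Assoc V X \<I> Y = RUnit V X \<otimes> \<one> Y"

locale braided_monoidal_category = monoidal_category +
  assumes Braid_in_hom: "\<lbrakk>X \<in> Obj V; Y \<in> Obj V\<rbrakk> \<Longrightarrow> Braid V X Y \<in> hom V (X \<odot> Y) (Y \<odot> X)"
    and Braid_iso: "\<lbrakk>X \<in> Obj V; Y \<in> Obj V\<rbrakk> \<Longrightarrow> is_iso V (Braid V X Y)"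
    and Braid_natural: "\<lbrakk>f \<in> hom V X X'; g \<in> hom V Y Y'\<rbrakk>
           \<Longrightarrow> Braid V X' Y' \<cdot> (f \<otimes> g) = (g \<otimes> f) \<cdot> Braid V X Y"
    and hexagon1: "\<lbrakk>X \<in> Obj V; Y \<in> Obj V; Z \<in> Obj V\<rbrakk>
           \<Longrightarrow> Assoc V Y Z X \<cdot> (Braid V X (Y \<odot> Z) \<cdot> Assoc V X Y Z)
             = (\<one> Y \<otimes> Braid V X Z) \<cdot> (Assoc V Y X Z \<cdot> (Braid V X Y \<otimes> \<one> Z))"
    and hexagon2: "\<lbrakk>X \<in> Obj V; Y \<in> Obj V; Z \<in> Obj V\<rbrakk>
           \<Longrightarrow> inv_arr V (Assoc V Z X Y) \<cdot> (Braid V (X \<odot> Y) Z \<cdot> inv_arr V (Assoc V X Y Z))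
             = (Braid V X Z \<otimes> \<one> Y) \<cdot> (inv_arr V (Assoc V X Z Y) \<cdot> (\<one> X \<otimes> Braid V Y Z))"

locale symmetric_monoidal_category = braided_monoidal_category +
  assumes Braid_symmetric: "\<lbrakk>X \<in> Obj V; Y \<in> Obj V\<rbrakk> \<Longrightarrow> Braid V Y X \<cdot> Braid V X Y = \<one> (X \<odot> Y)"

text \<open>A closed structure is a choice, for each \<open>X\<close>, of a right adjoint \<open>[X, -]\<close> of \<open>- \<otimes> X\<close>, given by its
  values and by the counit \<open>Ev V X Y : [X, Y] \<otimes> X \<rightarrow> Y\<close>.\<close>

record ('o, 'a) closed_moncat = "('o, 'a) moncat" +
  IHom :: "'o \<Rightarrow> 'o \<Rightarrow> 'o"
  Ev :: "'o \<Rightarrow> 'o \<Rightarrow> 'a"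

locale symmetric_monoidal_closed_category = symmetric_monoidal_category V
  for V :: "('o, 'a, 'z) closed_moncat_scheme" (structure) +
  assumes IHom_in_Obj: "\<lbrakk>X \<in> Obj V; Y \<in> Obj V\<rbrakk> \<Longrightarrow> IHom V X Y \<in> Obj V"
    and Ev_in_hom: "\<lbrakk>X \<in> Obj V; Y \<in> Obj V\<rbrakk> \<Longrightarrow> Ev V X Y \<in> hom V (IHom V X Y \<odot> X) Y"
    and Ev_universal: "\<lbrakk>X \<in> Obj V; Y \<in> Obj V; Z \<in> Obj V; f \<in> hom V (Z \<odot> X) Y\<rbrakk>
           \<Longrightarrow> \<exists>!g. g \<in> hom V Z (IHom V X Y) \<and> Ev V X Y \<cdot> (g \<otimes> \<one> X) = f"

text \<open>The opposite, with the inverse structure isomorphisms, and the product.\<close>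

definition opp :: "('o, 'a, 'z) moncat_scheme \<Rightarrow> ('o, 'a) moncat"
  where "opp V = \<lparr>Obj = Obj V, Arr = Arr V, Dom = Cod V, Cod = Dom V, Ident = Ident V,
           Comp = (\<lambda>g f. Comp V f g),
           Tens0 = Tens0 V, Tens1 = Tens1 V, TUnit = TUnit V,
           Assoc = (\<lambda>X Y Z. inv_arr V (Assoc V X Y Z)),
           LUnit = (\<lambda>X. inv_arr V (LUnit V X)),
           RUnit = (\<lambda>X. inv_arr V (RUnit V X)),
           Braid = (\<lambda>X Y. inv_arr V (Braid V X Y))\<rparr>"

definition prod_cat :: "('o, 'a, 'y) moncat_scheme \<Rightarrow> ('p, 'b, 'z) moncat_scheme
    \<Rightarrow> ('o \<times> 'p, 'a \<times> 'b) moncat"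
  where "prod_cat V W = \<lparr>Obj = Obj V \<times> Obj W, Arr = Arr V \<times> Arr W,
           Dom = map_prod (Dom V) (Dom W), Cod = map_prod (Cod V) (Cod W),
           Ident = map_prod (Ident V) (Ident W),
           Comp = (\<lambda>(g, g') (f, f'). (Comp V g f, Comp W g' f')),
           Tens0 = (\<lambda>(X, X') (Y, Y'). (Tens0 V X Y, Tens0 W X' Y')),
           Tens1 = (\<lambda>(f, f') (g, g'). (Tens1 V f g, Tens1 W f' g')),
           TUnit = (TUnit V, TUnit W),
           Assoc = (\<lambda>(X, X') (Y, Y') (Z, Z'). (Assoc V X Y Z, Assoc W X' Y' Z')),
           LUnit = (\<lambda>(X, X'). (LUnit V X, LUnit W X')),
           RUnit = (\<lambda>(X, X'). (RUnit V X, RUnit W X')),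
           Braid = (\<lambda>(X, X') (Y, Y'). (Braid V X Y, Braid W X' Y'))\<rparr>"


section \<open>Lax monoidal functors\<close>

record ('o, 'a, 'p, 'b) lax_func = "('o, 'a, 'p, 'b) func" +
  FMult :: "'o \<Rightarrow> 'o \<Rightarrow> 'b"
  FUnit :: "'b"

locale lax_monoidal_functor =
  source: monoidal_category V + target: monoidal_category W + cat_functor V W F
  for V :: "('o, 'a, 'y) moncat_scheme" and W :: "('p, 'b, 'z) moncat_scheme"
    and F :: "('o, 'a, 'p, 'b, 'w) lax_func_scheme" +
  assumes FMult_in_hom: "\<lbrakk>X \<in> Obj V; Y \<in> Obj V\<rbrakk>
           \<Longrightarrow> FMult F X Y \<in> hom W (Fun0 F X \<odot>\<^bsub>W\<^esub> Fun0 F Y) (Fun0 F (X \<odot>\<^bsub>V\<^esub> Y))"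
    and FMult_natural: "\<lbrakk>f \<in> hom V X X'; g \<in> hom V Y Y'\<rbrakk>
           \<Longrightarrow> FMult F X' Y' \<cdot>\<^bsub>W\<^esub> (Fun1 F f \<otimes>\<^bsub>W\<^esub> Fun1 F g) = Fun1 F (f \<otimes>\<^bsub>V\<^esub> g) \<cdot>\<^bsub>W\<^esub> FMult F X Y"
    and FUnit_in_hom: "FUnit F \<in> hom W \<I>\<^bsub>W\<^esub> (Fun0 F \<I>\<^bsub>V\<^esub>)"
    and FMult_assoc: "\<lbrakk>X \<in> Obj V; Y \<in> Obj V; Z \<in> Obj V\<rbrakk>
           \<Longrightarrow> Fun1 F (Assoc V X Y Z)
                 \<cdot>\<^bsub>W\<^esub> (FMult F (X \<odot>\<^bsub>V\<^esub> Y) Z \<cdot>\<^bsub>W\<^esub> (FMult F X Y \<otimes>\<^bsub>W\<^esub> \<one>\<^bsub>W\<^esub> (Fun0 F Z)))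
             = FMult F X (Y \<odot>\<^bsub>V\<^esub> Z)
                 \<cdot>\<^bsub>W\<^esub> ((\<one>\<^bsub>W\<^esub> (Fun0 F X) \<otimes>\<^bsub>W\<^esub> FMult F Y Z)
                        \<cdot>\<^bsub>W\<^esub> Assoc W (Fun0 F X) (Fun0 F Y) (Fun0 F Z))"
    and FMult_left_unit: "X \<in> Obj V
           \<Longrightarrow> Fun1 F (LUnit V X) \<cdot>\<^bsub>W\<^esub> (FMult F \<I>\<^bsub>V\<^esub> X \<cdot>\<^bsub>W\<^esub> (FUnit F \<otimes>\<^bsub>W\<^esub> \<one>\<^bsub>W\<^esub> (Fun0 F X)))
             = LUnit W (Fun0 F X)"
    and FMult_right_unit: "X \<in> Obj V
           \<Longrightarrow> Fun1 F (RUnit V X) \<cdot>\<^bsub>W\<^esub> (FMult F X \<I>\<^bsub>V\<^esub> \<cdot>\<^bsub>W\<^esub> (\<one>\<^bsub>W\<^esub> (Fun0 F X) \<otimes>\<^bsub>W\<^esub> FUnit F))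
             = RUnit W (Fun0 F X)"

locale braided_lax_monoidal_functor =
  source: braided_monoidal_category V + target: braided_monoidal_category W
    + lax_monoidal_functor V W F
  for V :: "('o, 'a, 'y) moncat_scheme" and W :: "('p, 'b, 'z) moncat_scheme"
    and F :: "('o, 'a, 'p, 'b, 'w) lax_func_scheme" +
  assumes FMult_braided: "\<lbrakk>X \<in> Obj V; Y \<in> Obj V\<rbrakk>
           \<Longrightarrow> Fun1 F (Braid V X Y) \<cdot>\<^bsub>W\<^esub> FMult F X Y
             = FMult F Y X \<cdot>\<^bsub>W\<^esub> Braid W (Fun0 F X) (Fun0 F Y)"


section \<open>Monoids and comonoids\<close>

record ('o, 'a) mon_obj =
  Car :: "'o"
  Mult :: "'a"
  Unt :: "'a"

definition monoid_in :: "('o, 'a, 'z) moncat_scheme \<Rightarrow> ('o, 'a) mon_obj \<Rightarrow> bool"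
  where "monoid_in V A \<longleftrightarrow>
    Car A \<in> Obj V
    \<and> Mult A \<in> hom V (Car A \<odot>\<^bsub>V\<^esub> Car A) (Car A)
    \<and> Unt A \<in> hom V \<I>\<^bsub>V\<^esub> (Car A)
    \<and> Mult A \<cdot>\<^bsub>V\<^esub> (Mult A \<otimes>\<^bsub>V\<^esub> \<one>\<^bsub>V\<^esub> (Car A))
        = Mult A \<cdot>\<^bsub>V\<^esub> ((\<one>\<^bsub>V\<^esub> (Car A) \<otimes>\<^bsub>V\<^esub> Mult A) \<cdot>\<^bsub>V\<^esub> Assoc V (Car A) (Car A) (Car A))
    \<and> Mult A \<cdot>\<^bsub>V\<^esub> (Unt A \<otimes>\<^bsub>V\<^esub> \<one>\<^bsub>V\<^esub> (Car A)) = LUnit V (Car A)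
    \<and> Mult A \<cdot>\<^bsub>V\<^esub> (\<one>\<^bsub>V\<^esub> (Car A) \<otimes>\<^bsub>V\<^esub> Unt A) = RUnit V (Car A)"

definition monoid_morphism ::
    "('o, 'a, 'z) moncat_scheme \<Rightarrow> ('o, 'a) mon_obj \<Rightarrow> 'a \<Rightarrow> ('o, 'a) mon_obj \<Rightarrow> bool"
  where "monoid_morphism V A f B \<longleftrightarrow>
    f \<in> hom V (Car A) (Car B)
    \<and> f \<cdot>\<^bsub>V\<^esub> Mult A = Mult B \<cdot>\<^bsub>V\<^esub> (f \<otimes>\<^bsub>V\<^esub> f)
    \<and> f \<cdot>\<^bsub>V\<^esub> Unt A = Unt B"

text \<open>The middle-four interchange \<open>(W \<otimes> X) \<otimes> (Y \<otimes> Z) \<rightarrow> (W \<otimes> Y) \<otimes> (X \<otimes> Z)\<close>.\<close>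

definition interchange :: "('o, 'a, 'z) moncat_scheme \<Rightarrow> 'o \<Rightarrow> 'o \<Rightarrow> 'o \<Rightarrow> 'o \<Rightarrow> 'a"
  where "interchange V W X Y Z =
    inv_arr V (Assoc V W Y (X \<odot>\<^bsub>V\<^esub> Z))
      \<cdot>\<^bsub>V\<^esub> ((\<one>\<^bsub>V\<^esub> W \<otimes>\<^bsub>V\<^esub> (Assoc V Y X Z
                \<cdot>\<^bsub>V\<^esub> ((Braid V X Y \<otimes>\<^bsub>V\<^esub> \<one>\<^bsub>V\<^esub> Z) \<cdot>\<^bsub>V\<^esub> inv_arr V (Assoc V X Y Z))))
      \<cdot>\<^bsub>V\<^esub> Assoc V W X (Y \<odot>\<^bsub>V\<^esub> Z))"

text \<open>Arrows of \<open>Mon V\<close> are tagged with their source and target monoids, so that they determine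
  these.\<close>

type_synonym ('o, 'a) mon_arr = "('o, 'a) mon_obj \<times> 'a \<times> ('o, 'a) mon_obj"

abbreviation underlying :: "('o, 'a) mon_arr \<Rightarrow> 'a"
  where "underlying f \<equiv> fst (snd f)"

definition tensor_mon :: "('o, 'a, 'z) moncat_scheme
    \<Rightarrow> ('o, 'a) mon_obj \<Rightarrow> ('o, 'a) mon_obj \<Rightarrow> ('o, 'a) mon_obj"
  where "tensor_mon V A B =
    \<lparr>Car = Car A \<odot>\<^bsub>V\<^esub> Car B,
     Mult = (Mult A \<otimes>\<^bsub>V\<^esub> Mult B) \<cdot>\<^bsub>V\<^esub> interchange V (Car A) (Car B) (Car A) (Car B),
     Unt = (Unt A \<otimes>\<^bsub>V\<^esub> Unt B) \<cdot>\<^bsub>V\<^esub> inv_arr V (LUnit V \<I>\<^bsub>V\<^esub>)\<rparr>"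

definition unit_mon :: "('o, 'a, 'z) moncat_scheme \<Rightarrow> ('o, 'a) mon_obj"
  where "unit_mon V = \<lparr>Car = \<I>\<^bsub>V\<^esub>, Mult = LUnit V \<I>\<^bsub>V\<^esub>, Unt = \<one>\<^bsub>V\<^esub> \<I>\<^bsub>V\<^esub>\<rparr>"

definition Mon :: "('o, 'a, 'z) moncat_scheme \<Rightarrow> (('o, 'a) mon_obj, ('o, 'a) mon_arr) moncat"
  where "Mon V =
    \<lparr>Obj = {A. monoid_in V A},
     Arr = {(A, f, B). monoid_in V A \<and> monoid_in V B \<and> monoid_morphism V A f B},
     Dom = (\<lambda>(A, f, B). A),
     Cod = (\<lambda>(A, f, B). B),
     Ident = (\<lambda>A. (A, \<one>\<^bsub>V\<^esub> (Car A), A)),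
     Comp = (\<lambda>(B, g, C) (A, f, B'). (A, g \<cdot>\<^bsub>V\<^esub> f, C)),
     Tens0 = tensor_mon V,
     Tens1 = (\<lambda>(A, f, B) (A', f', B'). (tensor_mon V A A', f \<otimes>\<^bsub>V\<^esub> f', tensor_mon V B B')),
     TUnit = unit_mon V,
     Assoc = (\<lambda>A B C. (tensor_mon V (tensor_mon V A B) C, Assoc V (Car A) (Car B) (Car C),
                       tensor_mon V A (tensor_mon V B C))),
     LUnit = (\<lambda>A. (tensor_mon V (unit_mon V) A, LUnit V (Car A), A)),
     RUnit = (\<lambda>A. (tensor_mon V A (unit_mon V), RUnit V (Car A), A)),
     Braid = (\<lambda>A B. (tensor_mon V A B, Braid V (Car A) (Car B), tensor_mon V B A))\<rparr>"

text \<open>\<open>Comon(V) = Mon(V\<^sup>o\<^sup>p)\<^sup>o\<^sup>p\<close>. So the fields \<open>Mult C\<close> and \<open>Unt C\<close> of a comonoid \<open>C\<close> are its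
  comultiplication \<open>C \<rightarrow> C \<otimes> C\<close> and counit \<open>C \<rightarrow> I\<close> in \<open>V\<close>, and a comonoid morphism \<open>f : C \<rightarrow> D\<close> is
  stored as the triple \<open>(D, f, C)\<close>.\<close>

definition Comon :: "('o, 'a, 'z) moncat_scheme \<Rightarrow> (('o, 'a) mon_obj, ('o, 'a) mon_arr) moncat"
  where "Comon V = opp (Mon (opp V))"

abbreviation (input) Comult :: "('o, 'a) mon_obj \<Rightarrow> 'a"
  where "Comult \<equiv> Mult"

abbreviation (input) Counit :: "('o, 'a) mon_obj \<Rightarrow> 'a"
  where "Counit \<equiv> Unt"


section \<open>The internal hom and convolution\<close>

definition transpose ::
    "('o, 'a, 'z) closed_moncat_scheme \<Rightarrow> 'o \<Rightarrow> 'o \<Rightarrow> 'o \<Rightarrow> 'a \<Rightarrow> 'a"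
  where "transpose V Z X Y f =
    (THE g. g \<in> hom V Z (IHom V X Y) \<and> Ev V X Y \<cdot>\<^bsub>V\<^esub> (g \<otimes>\<^bsub>V\<^esub> \<one>\<^bsub>V\<^esub> X) = f)"

text \<open>\<open>[f, g] : [X, Y] \<rightarrow> [X', Y']\<close> for \<open>f : X' \<rightarrow> X\<close> and \<open>g : Y \<rightarrow> Y'\<close>.\<close>

definition ihom_map :: "('o, 'a, 'z) closed_moncat_scheme \<Rightarrow> 'a \<Rightarrow> 'a \<Rightarrow> 'a"
  where "ihom_map V f g =
    (let X' = Dom V f; X = Cod V f; Y = Dom V g; Y' = Cod V g
     in transpose V (IHom V X Y) X' Y'
          (g \<cdot>\<^bsub>V\<^esub> (Ev V X Y \<cdot>\<^bsub>V\<^esub> (\<one>\<^bsub>V\<^esub> (IHom V X Y) \<otimes>\<^bsub>V\<^esub> f))))"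

text \<open>The lax monoidal structure \<open>[X, Y] \<otimes> [X', Y'] \<rightarrow> [X \<otimes> X', Y \<otimes> Y']\<close> and \<open>I \<rightarrow> [I, I]\<close> of the
  internal hom.\<close>

definition ihom_mult :: "('o, 'a, 'z) closed_moncat_scheme \<Rightarrow> 'o \<Rightarrow> 'o \<Rightarrow> 'o \<Rightarrow> 'o \<Rightarrow> 'a"
  where "ihom_mult V X Y X' Y' =
    transpose V (IHom V X Y \<odot>\<^bsub>V\<^esub> IHom V X' Y') (X \<odot>\<^bsub>V\<^esub> X') (Y \<odot>\<^bsub>V\<^esub> Y')
      ((Ev V X Y \<otimes>\<^bsub>V\<^esub> Ev V X' Y') \<cdot>\<^bsub>V\<^esub> interchange V (IHom V X Y) (IHom V X' Y') X X')"

definition ihom_unit :: "('o, 'a, 'z) closed_moncat_scheme \<Rightarrow> 'a"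
  where "ihom_unit V = transpose V \<I>\<^bsub>V\<^esub> \<I>\<^bsub>V\<^esub> \<I>\<^bsub>V\<^esub> (LUnit V \<I>\<^bsub>V\<^esub>)"

text \<open>The convolution monoid \<open>[C, B]\<close> of a comonoid \<open>C\<close> and a monoid \<open>B\<close>, and its functoriality.\<close>

definition conv :: "('o, 'a, 'z) closed_moncat_scheme
    \<Rightarrow> ('o, 'a) mon_obj \<Rightarrow> ('o, 'a) mon_obj \<Rightarrow> ('o, 'a) mon_obj"
  where "conv V C B =
    \<lparr>Car = IHom V (Car C) (Car B),
     Mult = ihom_map V (Comult C) (Mult B) \<cdot>\<^bsub>V\<^esub> ihom_mult V (Car C) (Car B) (Car C) (Car B),
     Unt = ihom_map V (Counit C) (Unt B) \<cdot>\<^bsub>V\<^esub> ihom_unit V\<rparr>"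

definition conv_map :: "('o, 'a, 'z) closed_moncat_scheme
    \<Rightarrow> ('o, 'a) mon_arr \<Rightarrow> ('o, 'a) mon_arr \<Rightarrow> ('o, 'a) mon_arr"
  where "conv_map V h g =
    (conv V (Cod (Comon V) h) (Dom (Mon V) g),
     ihom_map V (underlying h) (underlying g),
     conv V (Dom (Comon V) h) (Cod (Mon V) g))"

text \<open>The lax structure of the internal hom as arrows of \<open>Mon V\<close>.\<close>

definition conv_mult :: "('o, 'a, 'z) closed_moncat_scheme \<Rightarrow> ('o, 'a) mon_obj \<Rightarrow> ('o, 'a) mon_obj
    \<Rightarrow> ('o, 'a) mon_obj \<Rightarrow> ('o, 'a) mon_obj \<Rightarrow> ('o, 'a) mon_arr"
  where "conv_mult V C B C' B' =
    (conv V C B \<odot>\<^bsub>Mon V\<^esub> conv V C' B',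
     ihom_mult V (Car C) (Car B) (Car C') (Car B'),
     conv V (C \<odot>\<^bsub>Comon V\<^esub> C') (B \<odot>\<^bsub>Mon V\<^esub> B'))"

definition conv_unit :: "('o, 'a, 'z) closed_moncat_scheme \<Rightarrow> ('o, 'a) mon_arr"
  where "conv_unit V = (\<I>\<^bsub>Mon V\<^esub>, ihom_unit V, conv V \<I>\<^bsub>Comon V\<^esub> \<I>\<^bsub>Mon V\<^esub>)"


section \<open>Universal measuring comonoids\<close>

text \<open>\<open>Q\<close>, together with the bijections \<open>\<phi> C : Mon(V)(A, [C, B]) \<cong> Comon(V)(C, Q)\<close> natural in the
  comonoid \<open>C\<close>, is a universal measuring comonoid of \<open>A\<close> and \<open>B\<close>. Naturality in \<open>A\<close> and \<open>B\<close> is not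
  a condition on the comonoids: it is what defines the action of \<open>P\<close> on arrows below.\<close>

definition universal_measuring_comonoid :: "('o, 'a, 'z) closed_moncat_scheme
    \<Rightarrow> ('o, 'a) mon_obj \<Rightarrow> ('o, 'a) mon_obj \<Rightarrow> ('o, 'a) mon_obj
    \<Rightarrow> (('o, 'a) mon_obj \<Rightarrow> ('o, 'a) mon_arr \<Rightarrow> ('o, 'a) mon_arr) \<Rightarrow> bool"
  where "universal_measuring_comonoid V A B Q \<phi> \<longleftrightarrow>
    Q \<in> Obj (Comon V)
    \<and> (\<forall>C\<in>Obj (Comon V). bij_betw (\<phi> C) (hom (Mon V) A (conv V C B)) (hom (Comon V) C Q))
    \<and> (\<forall>C\<in>Obj (Comon V). \<forall>C'\<in>Obj (Comon V).
         \<forall>h\<in>hom (Comon V) C' C. \<forall>f\<in>hom (Mon V) A (conv V C B).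
           \<phi> C' (conv_map V h (\<one>\<^bsub>Mon V\<^esub> B) \<cdot>\<^bsub>Mon V\<^esub> f) = \<phi> C f \<cdot>\<^bsub>Comon V\<^esub> h)"

text \<open>The universal measuring \<open>A \<rightarrow> [P(A, B), B]\<close>, corresponding to the identity of \<open>P(A, B)\<close>.\<close>

definition universal_measuring :: "('o, 'a, 'z) closed_moncat_scheme
    \<Rightarrow> (('o, 'a) mon_obj \<Rightarrow> ('o, 'a) mon_obj \<Rightarrow> ('o, 'a) mon_obj)
    \<Rightarrow> (('o, 'a) mon_obj \<Rightarrow> ('o, 'a) mon_obj \<Rightarrow> ('o, 'a) mon_obj
        \<Rightarrow> ('o, 'a) mon_arr \<Rightarrow> ('o, 'a) mon_arr)
    \<Rightarrow> ('o, 'a) mon_obj \<Rightarrow> ('o, 'a) mon_obj \<Rightarrow> ('o, 'a) mon_arr"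
  where "universal_measuring V P \<phi> A B =
    inv_into (hom (Mon V) A (conv V (P A B) B)) (\<phi> A B (P A B)) (\<one>\<^bsub>Comon V\<^esub> (P A B))"

text \<open>The functor \<open>P\<close> with its lax monoidal structure. For \<open>f : A' \<rightarrow> A\<close> and \<open>g : B \<rightarrow> B'\<close> in \<open>Mon V\<close>,
  the arrow \<open>P(f, g)\<close> corresponds to \<open>A' \<rightarrow> A \<rightarrow> [P(A, B), B] \<rightarrow> [P(A, B), B']\<close>; this is the only
  action making \<open>\<phi>\<close> natural in \<open>A\<close> and \<open>B\<close>. The structure maps
  \<open>P(A, B) \<otimes> P(A', B') \<rightarrow> P(A \<otimes> A', B \<otimes> B')\<close> and \<open>I \<rightarrow> P(I, I)\<close> correspond to
  \<open>A \<otimes> A' \<rightarrow> [P(A, B), B] \<otimes> [P(A', B'), B'] \<rightarrow> [P(A, B) \<otimes> P(A', B'), B \<otimes> B']\<close> and \<open>I \<rightarrow> [I, I]\<close>.\<close>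

definition measuring_functor :: "('o, 'a, 'z) closed_moncat_scheme
    \<Rightarrow> (('o, 'a) mon_obj \<Rightarrow> ('o, 'a) mon_obj \<Rightarrow> ('o, 'a) mon_obj)
    \<Rightarrow> (('o, 'a) mon_obj \<Rightarrow> ('o, 'a) mon_obj \<Rightarrow> ('o, 'a) mon_obj
        \<Rightarrow> ('o, 'a) mon_arr \<Rightarrow> ('o, 'a) mon_arr)
    \<Rightarrow> (('o, 'a) mon_obj \<times> ('o, 'a) mon_obj, ('o, 'a) mon_arr \<times> ('o, 'a) mon_arr,
        ('o, 'a) mon_obj, ('o, 'a) mon_arr) lax_func"
  where "measuring_functor V P \<phi> =
    \<lparr>Fun0 = (\<lambda>(A, B). P A B),
     Fun1 = (\<lambda>(f, g).
       let A' = Dom (Mon V) f; A = Cod (Mon V) f; B = Dom (Mon V) g; B' = Cod (Mon V) g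
       in \<phi> A' B' (P A B)
            (conv_map V (\<one>\<^bsub>Comon V\<^esub> (P A B)) g
               \<cdot>\<^bsub>Mon V\<^esub> (universal_measuring V P \<phi> A B \<cdot>\<^bsub>Mon V\<^esub> f))),
     FMult = (\<lambda>(A, B) (A', B').
       \<phi> (A \<odot>\<^bsub>Mon V\<^esub> A') (B \<odot>\<^bsub>Mon V\<^esub> B') (P A B \<odot>\<^bsub>Comon V\<^esub> P A' B')
         (conv_mult V (P A B) B (P A' B') B'
            \<cdot>\<^bsub>Mon V\<^esub> (universal_measuring V P \<phi> A B \<otimes>\<^bsub>Mon V\<^esub> universal_measuring V P \<phi> A' B'))),
     FUnit = \<phi> \<I>\<^bsub>Mon V\<^esub> \<I>\<^bsub>Mon V\<^esub> \<I>\<^bsub>Comon V\<^esub> (conv_unit V)\<rparr>"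

end

theory Submission
  imports Defs
begin

text \<open>The proof is a doctrinal adjunction with parameters. The internal hom is a braided lax monoidal
  functor \<open>V\<^sup>o\<^sup>p \<times> V \<rightarrow> V\<close>. A lax monoidal functor sends monoids to monoids, and if it is
  braided then its structure maps at monoids are monoid morphisms; so convolution is a braided lax
  monoidal functor \<open>K : Comon(V)\<^sup>o\<^sup>p \<times> Mon(V) \<rightarrow> Mon(V)\<close>. Now \<open>P(A, B)\<close> represents
  \<open>C \<mapsto> Mon(V)(A, K(C, B))\<close>, so an arrow \<open>h\<close> into \<open>P(A, B)\<close> is determined by \<open>K(h, 1) \<cdot> \<eta>\<close>, where
  \<open>\<eta>\<close> is the universal measuring. Under this correspondence every law for \<open>P\<close> becomes the same law
  for \<open>K\<close>.\<close>

section \<open>Categories and monoidal categories\<close>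

text \<open>The work is coherence, and it is concentrated in the middle-four interchange. The tensor
  product is itself a lax monoidal functor on \<open>V x V\<close> whose structure map is the
  interchange, and the laws of the internal hom, once evaluated, become equations between
  interchanges. So the same few facts, namely compatibility of the interchange with associator,
  unitors and braiding, yield both the symmetric monoidal structure on monoids and the lax structure
  on \<open>[-, -]\<close>. Symmetry makes the interchange invertible by an interchange with the
  middle factors exchanged. Inverses are the recurring nuisance: opposites carry inverse structure
  maps, and the interchange contains an inverse associator. Equations are therefore proved after
  composing with an isomorphism that cancels these inverses, and arrows into \<open>[X, Y]\<close>
  are compared by evaluating on an isomorphism onto \<open>X\<close>, not only on its identity. The
  passage from the bijections to the universal measuring is a Yoneda argument in the comonoid
  variable.\<close>

lemma in_hom_iff: "f \<in> hom C X Y \<longleftrightarrow> f \<in> Arr C \<and> Dom C f = X \<and> Cod C f = Y"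
  by (simp add: hom_def)

context category
begin

text \<open>The axioms speak of \<open>hom\<close>, whose two objects the simplifier would have to
  guess. Restated with \<open>Arr\<close>, \<open>Dom\<close> and \<open>Cod\<close>, typing becomes
  a set of conditional rewrite rules that discharge the side conditions of all later
  computations.\<close>

lemma Dom_Obj [simp]: "f \<in> Arr C \<Longrightarrow> Dom C f \<in> Obj C"
  and Cod_Obj [simp]: "f \<in> Arr C \<Longrightarrow> Cod C f \<in> Obj C"
  by (simp_all add: Dom_in_Obj Cod_in_Obj)

lemma Ident_typing [simp]:
  assumes "X \<in> Obj C"
  shows "\<one> X \<in> Arr C" "Dom C (\<one> X) = X" "Cod C (\<one> X) = X"
  using Ident_in_hom[OF assms] by (simp_all add: in_hom_iff)

lemma Comp_typing [simp]:
  assumes "f \<in> Arr C" "g \<in> Arr C" "Cod C f = Dom C g"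
  shows "g \<cdot> f \<in> Arr C" "Dom C (g \<cdot> f) = Dom C f" "Cod C (g \<cdot> f) = Cod C g"
  using Comp_in_hom[of f "Dom C f" "Cod C f" g "Cod C g"] assms by (simp_all add: in_hom_iff)

lemma Ident_Comp [simp]: "f \<in> Arr C \<Longrightarrow> Cod C f = Y \<Longrightarrow> \<one> Y \<cdot> f = f"
  using Comp_Ident_left[of f "Dom C f" Y] by (simp add: in_hom_iff)

lemma Comp_Ident [simp]: "f \<in> Arr C \<Longrightarrow> Dom C f = X \<Longrightarrow> f \<cdot> \<one> X = f"
  using Comp_Ident_right[of f X "Cod C f"] by (simp add: in_hom_iff)

lemma Comp_assoc_arr: "f \<in> Arr C \<Longrightarrow> g \<in> Arr C \<Longrightarrow> h \<in> Arr C \<Longrightarrow> Cod C f = Dom C g \<Longrightarrow> Cod C g = Dom C h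
    \<Longrightarrow> (h \<cdot> g) \<cdot> f = h \<cdot> (g \<cdot> f)"
  by (rule Comp_assoc[of f "Dom C f" "Cod C f" g "Cod C g" h "Cod C h"]) (simp_all add: in_hom_iff)

text \<open>Composites are kept bracketed to the right, where a two-arrow redex
  \<open>g \<cdot> f\<close> occurs only as \<open>g \<cdot> (f \<cdot> t)\<close>. This lifts any
  equation to that shape; the lemmas named \<open>_tail\<close> are instances of the same
  device.\<close>

lemma Comp_eq_tail:
  assumes "g \<cdot> f = k" "f \<in> Arr C" "g \<in> Arr C" "Cod C f = Dom C g" "t \<in> Arr C" "Cod C t = Dom C f"
  shows "g \<cdot> (f \<cdot> t) = k \<cdot> t"
  using assms Comp_assoc_arr[of t f g] by simp

lemma inverse_unique:
  assumes "f \<in> Arr C" "is_inverse C f g" "is_inverse C f h"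
  shows "g = h"
proof -
  have "g = g \<cdot> (f \<cdot> h)" "(g \<cdot> f) \<cdot> h = h"
    using assms by (simp_all add: is_inverse_def in_hom_iff)
  moreover have "(g \<cdot> f) \<cdot> h = g \<cdot> (f \<cdot> h)"
    using assms by (intro Comp_assoc_arr) (simp_all add: is_inverse_def in_hom_iff)
  ultimately show ?thesis by simp
qed

text \<open>Since \<open>inv_arr\<close> is a definite description, inverses are always computed by
  exhibiting one.\<close>

lemma inv_arr_eqI: "f \<in> Arr C \<Longrightarrow> is_inverse C f g \<Longrightarrow> inv_arr C f = g"
  unfolding inv_arr_def using inverse_unique by blast

lemma is_isoI: "f \<in> Arr C \<Longrightarrow> is_inverse C f g \<Longrightarrow> is_iso C f"
  unfolding is_iso_def by blast

lemma is_inverse_inv_arr: "is_iso C f \<Longrightarrow> is_inverse C f (inv_arr C f)"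
  unfolding is_iso_def using inv_arr_eqI by blast

lemma iso_Arr: "is_iso C f \<Longrightarrow> f \<in> Arr C"
  by (simp add: is_iso_def)

lemma inv_arr_typing [simp]:
  assumes "is_iso C f"
  shows "inv_arr C f \<in> Arr C" "Dom C (inv_arr C f) = Cod C f" "Cod C (inv_arr C f) = Dom C f"
  using is_inverse_inv_arr[OF assms] by (simp_all add: is_inverse_def in_hom_iff)

lemma inv_arr_Comp [simp]:
  assumes "is_iso C f"
  shows "inv_arr C f \<cdot> f = \<one> (Dom C f)" "f \<cdot> inv_arr C f = \<one> (Cod C f)"
  using is_inverse_inv_arr[OF assms] by (simp_all add: is_inverse_def in_hom_iff)

lemma inv_arr_Comp_tail [simp]:
  assumes "is_iso C f" "t \<in> Arr C"
  shows "Cod C t = Dom C f \<Longrightarrow> inv_arr C f \<cdot> (f \<cdot> t) = t"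
    and "Cod C t = Cod C f \<Longrightarrow> f \<cdot> (inv_arr C f \<cdot> t) = t"
  using assms iso_Arr[of f] by (simp_all add: Comp_eq_tail[of _ _ "\<one> _"])

lemma is_inverse_sym: "is_iso C f \<Longrightarrow> is_inverse C (inv_arr C f) f"
  by (simp add: is_inverse_def in_hom_iff iso_Arr)

lemma is_iso_inv_arr [simp]: "is_iso C f \<Longrightarrow> is_iso C (inv_arr C f)"
  by (rule is_isoI[OF _ is_inverse_sym]) auto

lemma inv_arr_inv_arr [simp]: "is_iso C f \<Longrightarrow> inv_arr C (inv_arr C f) = f"
  by (rule inv_arr_eqI[OF _ is_inverse_sym]) auto

lemma is_inverse_Ident: "X \<in> Obj C \<Longrightarrow> is_inverse C (\<one> X) (\<one> X)"
  by (simp add: is_inverse_def in_hom_iff)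

lemma inv_arr_Ident [simp]: "X \<in> Obj C \<Longrightarrow> inv_arr C (\<one> X) = \<one> X"
  and is_iso_Ident [simp]: "X \<in> Obj C \<Longrightarrow> is_iso C (\<one> X)"
  using inv_arr_eqI[OF _ is_inverse_Ident] is_isoI[OF _ is_inverse_Ident] by auto

lemma is_inverse_Comp:
  assumes "is_iso C f" "is_iso C g" "Cod C f = Dom C g"
  shows "is_inverse C (g \<cdot> f) (inv_arr C f \<cdot> inv_arr C g)"
  using assms iso_Arr[of f] iso_Arr[of g] by (simp add: is_inverse_def in_hom_iff Comp_assoc_arr)

lemma inv_arr_of_Comp:
  assumes "is_iso C f" "is_iso C g" "Cod C f = Dom C g"
  shows "inv_arr C (g \<cdot> f) = inv_arr C f \<cdot> inv_arr C g"
  using assms iso_Arr is_inverse_Comp by (intro inv_arr_eqI) auto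

lemma is_iso_Comp [simp]:
  assumes "is_iso C f" "is_iso C g" "Cod C f = Dom C g"
  shows "is_iso C (g \<cdot> f)"
  using assms iso_Arr is_inverse_Comp by (intro is_isoI) auto

lemma iso_cancel_left:
  assumes "is_iso C f" "f \<cdot> g = f \<cdot> h" "g \<in> Arr C" "h \<in> Arr C" "Cod C g = Dom C f" "Cod C h = Dom C f"
  shows "g = h"
proof -
  have "g = inv_arr C f \<cdot> (f \<cdot> g)" using assms(1,3,5) by simp
  also have "\<dots> = h" unfolding assms(2) using assms(1,4,6) by simp
  finally show ?thesis .
qed

lemma iso_cancel_right:
  assumes "is_iso C f" "g \<cdot> f = h \<cdot> f" "g \<in> Arr C" "h \<in> Arr C" "Dom C g = Cod C f" "Dom C h = Cod C f"
  shows "g = h"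
proof -
  have "g = (g \<cdot> f) \<cdot> inv_arr C f" using assms(1,3,5) iso_Arr[of f] by (simp add: Comp_assoc_arr)
  also have "\<dots> = h" unfolding assms(2) using assms(1,4,6) iso_Arr[of f] by (simp add: Comp_assoc_arr)
  finally show ?thesis .
qed

end

section \<open>Calculus of tensor products and unit coherence\<close>

context monoidal_category
begin

lemma TUnit_Obj [simp]: "\<I> \<in> Obj V"
  by (rule TUnit_in_Obj)

lemma Tens0_Obj [simp]: "X \<in> Obj V \<Longrightarrow> Y \<in> Obj V \<Longrightarrow> X \<odot> Y \<in> Obj V"
  by (rule Tens0_in_Obj)

lemma Tens1_typing [simp]:
  assumes "f \<in> Arr V" "g \<in> Arr V"
  shows "f \<otimes> g \<in> Arr V" "Dom V (f \<otimes> g) = Dom V f \<odot> Dom V g" "Cod V (f \<otimes> g) = Cod V f \<odot> Cod V g"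
  using Tens1_in_hom[of f "Dom V f" "Cod V f" g "Dom V g" "Cod V g"] assms
  by (simp_all add: in_hom_iff)

declare Tens1_Ident [simp]

text \<open>Oriented against the axiom: successive tensors are merged, so that a computation can
  continue inside each factor.\<close>

lemma Comp_Tens1:
  assumes "f \<in> Arr V" "g \<in> Arr V" "Cod V f = Dom V g" "f' \<in> Arr V" "g' \<in> Arr V" "Cod V f' = Dom V g'"
  shows "(g \<otimes> g') \<cdot> (f \<otimes> f') = (g \<cdot> f) \<otimes> (g' \<cdot> f')"
  using assms by (intro Tens1_Comp[symmetric]) (auto simp: in_hom_iff)

lemma Comp_Tens1_tail:
  assumes "f \<in> Arr V" "g \<in> Arr V" "Cod V f = Dom V g" "f' \<in> Arr V" "g' \<in> Arr V" "Cod V f' = Dom V g'"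
    "t \<in> Arr V" "Cod V t = Dom V f \<odot> Dom V f'"
  shows "(g \<otimes> g') \<cdot> ((f \<otimes> f') \<cdot> t) = ((g \<cdot> f) \<otimes> (g' \<cdot> f')) \<cdot> t"
  using assms by (intro Comp_eq_tail Comp_Tens1) auto

lemma is_inverse_Tens1:
  assumes "is_iso V f" "is_iso V g"
  shows "is_inverse V (f \<otimes> g) (inv_arr V f \<otimes> inv_arr V g)"
  using assms iso_Arr by (simp add: is_inverse_def in_hom_iff Comp_Tens1)

lemma inv_arr_Tens1 [simp]:
  assumes "is_iso V f" "is_iso V g"
  shows "inv_arr V (f \<otimes> g) = inv_arr V f \<otimes> inv_arr V g"
  using assms iso_Arr is_inverse_Tens1 by (intro inv_arr_eqI) auto

lemma is_iso_Tens1 [simp]: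
  assumes "is_iso V f" "is_iso V g"
  shows "is_iso V (f \<otimes> g)"
  using assms iso_Arr is_inverse_Tens1 by (intro is_isoI) auto

declare Assoc_iso [simp] LUnit_iso [simp] RUnit_iso [simp]

lemma Assoc_typing [simp]:
  assumes "X \<in> Obj V" "Y \<in> Obj V" "Z \<in> Obj V"
  shows "Assoc V X Y Z \<in> Arr V" "Dom V (Assoc V X Y Z) = (X \<odot> Y) \<odot> Z"
    "Cod V (Assoc V X Y Z) = X \<odot> (Y \<odot> Z)"
  using Assoc_in_hom[OF assms] by (simp_all add: in_hom_iff)

lemma LUnit_typing [simp]:
  assumes "X \<in> Obj V"
  shows "LUnit V X \<in> Arr V" "Dom V (LUnit V X) = \<I> \<odot> X" "Cod V (LUnit V X) = X"
  using LUnit_in_hom[OF assms] by (simp_all add: in_hom_iff)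

lemma RUnit_typing [simp]:
  assumes "X \<in> Obj V"
  shows "RUnit V X \<in> Arr V" "Dom V (RUnit V X) = X \<odot> \<I>" "Cod V (RUnit V X) = X"
  using RUnit_in_hom[OF assms] by (simp_all add: in_hom_iff)

lemma Assoc_nat:
  assumes "f \<in> Arr V" "g \<in> Arr V" "h \<in> Arr V" "Cod V f = X" "Cod V g = Y" "Cod V h = Z"
  shows "Assoc V X Y Z \<cdot> ((f \<otimes> g) \<otimes> h) = (f \<otimes> (g \<otimes> h)) \<cdot> Assoc V (Dom V f) (Dom V g) (Dom V h)"
  using assms by (intro Assoc_natural) (auto simp: in_hom_iff)

lemma Assoc_nat_tail:
  assumes "f \<in> Arr V" "g \<in> Arr V" "h \<in> Arr V" "Cod V f = X" "Cod V g = Y" "Cod V h = Z"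
    "t \<in> Arr V" "Cod V t = (Dom V f \<odot> Dom V g) \<odot> Dom V h"
  shows "Assoc V X Y Z \<cdot> (((f \<otimes> g) \<otimes> h) \<cdot> t)
    = (f \<otimes> (g \<otimes> h)) \<cdot> (Assoc V (Dom V f) (Dom V g) (Dom V h) \<cdot> t)"
  using assms Comp_eq_tail[OF Assoc_nat, of f g h X Y Z t] by (auto simp: Comp_assoc_arr)

lemma LUnit_nat: "f \<in> Arr V \<Longrightarrow> Cod V f = Y \<Longrightarrow> LUnit V Y \<cdot> (\<one> \<I> \<otimes> f) = f \<cdot> LUnit V (Dom V f)"
  by (rule LUnit_natural) (auto simp: in_hom_iff)

lemma RUnit_nat: "f \<in> Arr V \<Longrightarrow> Cod V f = Y \<Longrightarrow> RUnit V Y \<cdot> (f \<otimes> \<one> \<I>) = f \<cdot> RUnit V (Dom V f)"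
  by (rule RUnit_natural) (auto simp: in_hom_iff)

lemma pentagon_tail:
  assumes "W \<in> Obj V" "X \<in> Obj V" "Y \<in> Obj V" "Z \<in> Obj V" "t \<in> Arr V" "Cod V t = ((W \<odot> X) \<odot> Y) \<odot> Z"
  shows "Assoc V W X (Y \<odot> Z) \<cdot> (Assoc V (W \<odot> X) Y Z \<cdot> t)
    = (\<one> W \<otimes> Assoc V X Y Z) \<cdot> (Assoc V W (X \<odot> Y) Z \<cdot> ((Assoc V W X Y \<otimes> \<one> Z) \<cdot> t))"
  using assms Comp_eq_tail[OF pentagon, of W X Y Z t] by (simp add: Comp_assoc_arr)

text \<open>By naturality of the left unitor, tensoring with the unit is isomorphic to the identity
  functor, hence faithful. The same holds on the right.\<close>

lemma LUnit_faithful: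
  assumes "\<one> \<I> \<otimes> f = \<one> \<I> \<otimes> g" "f \<in> Arr V" "g \<in> Arr V" "Dom V f = Dom V g" "Cod V f = Cod V g"
  shows "f = g"
  by (rule iso_cancel_right[of "LUnit V (Dom V f)"])
    (use assms LUnit_nat[of f "Cod V f"] LUnit_nat[of g "Cod V f"] in auto)

lemma RUnit_faithful:
  assumes "f \<otimes> \<one> \<I> = g \<otimes> \<one> \<I>" "f \<in> Arr V" "g \<in> Arr V" "Dom V f = Dom V g" "Cod V f = Cod V g"
  shows "f = g"
  by (rule iso_cancel_right[of "RUnit V (Dom V f)"])
    (use assms RUnit_nat[of f "Cod V f"] RUnit_nat[of g "Cod V f"] in auto)

text \<open>Kelly's deductions of the remaining unit coherences from the pentagon and the triangle.\<close>

lemma LUnit_Tens0: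
  assumes [simp]: "X \<in> Obj V" "Y \<in> Obj V"
  shows "LUnit V (X \<odot> Y) \<cdot> Assoc V \<I> X Y = LUnit V X \<otimes> \<one> Y"
proof (rule LUnit_faithful)
  \<comment> \<open>\<open>?t\<close> consists of two of the three edges on the long side of the
    pentagon for \<open>\<I>\<close>, \<open>\<I>\<close>, \<open>X\<close>, \<open>Y\<close>.
    Precomposing with it brings in the pentagon, and two triangles remove the unitors.\<close>
  let ?t = "Assoc V \<I> (\<I> \<odot> X) Y \<cdot> (Assoc V \<I> \<I> X \<otimes> \<one> Y)"
  have "(\<one> \<I> \<otimes> (LUnit V (X \<odot> Y) \<cdot> Assoc V \<I> X Y)) \<cdot> ?t
      = (\<one> \<I> \<otimes> LUnit V (X \<odot> Y)) \<cdot> ((\<one> \<I> \<otimes> Assoc V \<I> X Y) \<cdot> ?t)"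
    by (simp add: Comp_Tens1_tail)
  also have "\<dots> = (\<one> \<I> \<otimes> LUnit V (X \<odot> Y)) \<cdot> (Assoc V \<I> \<I> (X \<odot> Y) \<cdot> Assoc V (\<I> \<odot> \<I>) X Y)"
    by (simp add: pentagon)
  also have "\<dots> = (RUnit V \<I> \<otimes> \<one> (X \<odot> Y)) \<cdot> Assoc V (\<I> \<odot> \<I>) X Y"
    by (simp add: Comp_eq_tail[OF triangle])
  also have "\<dots> = Assoc V \<I> X Y \<cdot> ((RUnit V \<I> \<otimes> \<one> X) \<otimes> \<one> Y)"
    by (simp add: Assoc_nat)
  also have "\<dots> = Assoc V \<I> X Y \<cdot> (((\<one> \<I> \<otimes> LUnit V X) \<otimes> \<one> Y) \<cdot> (Assoc V \<I> \<I> X \<otimes> \<one> Y))"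
    by (simp add: Comp_Tens1 triangle)
  also have "\<dots> = (\<one> \<I> \<otimes> (LUnit V X \<otimes> \<one> Y)) \<cdot> ?t"
    by (simp add: Assoc_nat_tail)
  finally show "\<one> \<I> \<otimes> (LUnit V (X \<odot> Y) \<cdot> Assoc V \<I> X Y) = \<one> \<I> \<otimes> (LUnit V X \<otimes> \<one> Y)"
    by (rule iso_cancel_right[rotated]) auto
qed auto

lemma RUnit_Tens0:
  assumes [simp]: "X \<in> Obj V" "Y \<in> Obj V"
  shows "(\<one> X \<otimes> RUnit V Y) \<cdot> Assoc V X Y \<I> = RUnit V (X \<odot> Y)"
proof (rule RUnit_faithful)
  \<comment> \<open>This time the pentagon is the one for \<open>X\<close>, \<open>Y\<close>,
    \<open>\<I>\<close>, \<open>\<I>\<close>, and the invertible arrow is put on the left.\<close>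
  have "Assoc V X Y \<I> \<cdot> (((\<one> X \<otimes> RUnit V Y) \<cdot> Assoc V X Y \<I>) \<otimes> \<one> \<I>)
      = Assoc V X Y \<I> \<cdot> (((\<one> X \<otimes> RUnit V Y) \<otimes> \<one> \<I>) \<cdot> (Assoc V X Y \<I> \<otimes> \<one> \<I>))"
    by (simp add: Comp_Tens1)
  also have "\<dots> = (\<one> X \<otimes> (RUnit V Y \<otimes> \<one> \<I>)) \<cdot> (Assoc V X (Y \<odot> \<I>) \<I> \<cdot> (Assoc V X Y \<I> \<otimes> \<one> \<I>))"
    by (simp add: Assoc_nat_tail)
  also have "\<dots> = (\<one> X \<otimes> (\<one> Y \<otimes> LUnit V \<I>)) \<cdot> ((\<one> X \<otimes> Assoc V Y \<I> \<I>)
      \<cdot> (Assoc V X (Y \<odot> \<I>) \<I> \<cdot> (Assoc V X Y \<I> \<otimes> \<one> \<I>)))"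
    by (simp add: triangle[symmetric] Comp_Tens1_tail)
  also have "\<dots> = (\<one> X \<otimes> (\<one> Y \<otimes> LUnit V \<I>)) \<cdot> (Assoc V X Y (\<I> \<odot> \<I>) \<cdot> Assoc V (X \<odot> Y) \<I> \<I>)"
    by (simp add: pentagon)
  \<comment> \<open>The naturality rule is instantiated by hand because \<open>Tens1_Ident\<close>
    has collapsed \<open>\<one> X \<otimes> \<one> Y\<close> to one identity, which hides the
    threefold tensor from the simplifier. The same happens in later proofs.\<close>
  also have "\<dots> = Assoc V X Y \<I> \<cdot> ((\<one> (X \<odot> Y) \<otimes> LUnit V \<I>) \<cdot> Assoc V (X \<odot> Y) \<I> \<I>)"
    using Assoc_nat_tail[of "\<one> X" "\<one> Y" "LUnit V \<I>" X Y \<I> "Assoc V (X \<odot> Y) \<I> \<I>"] by simp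
  also have "\<dots> = Assoc V X Y \<I> \<cdot> (RUnit V (X \<odot> Y) \<otimes> \<one> \<I>)"
    by (simp add: triangle)
  finally show "((\<one> X \<otimes> RUnit V Y) \<cdot> Assoc V X Y \<I>) \<otimes> \<one> \<I> = RUnit V (X \<odot> Y) \<otimes> \<one> \<I>"
    by (rule iso_cancel_left[rotated]) auto
qed auto

lemma LUnit_TUnit: "LUnit V \<I> = RUnit V \<I>"
proof (rule RUnit_faithful)
  \<comment> \<open>Naturality of the left unitor at the arrow \<open>LUnit V \<I>\<close> itself,
    which can then be cancelled.\<close>
  have "LUnit V (\<I> \<odot> \<I>) = \<one> \<I> \<otimes> LUnit V \<I>"
    by (rule iso_cancel_left[of "LUnit V \<I>"]) (use LUnit_nat[of "LUnit V \<I>" \<I>] in auto)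
  then show "LUnit V \<I> \<otimes> \<one> \<I> = RUnit V \<I> \<otimes> \<one> \<I>"
    using LUnit_Tens0[of \<I> \<I>] triangle[of \<I> \<I>] by simp
qed auto

end

section \<open>Coherence of the middle-four interchange\<close>

text \<open>In terms of \<open>shuffle V X Y Z : X \<otimes> (Y \<otimes> Z) \<rightarrow> Y \<otimes> (X \<otimes> Z)\<close>, the part of the interchange between
  associators, coherence can be computed on tensor products bracketed to the right.\<close>

definition shuffle :: "('o, 'a, 'z) moncat_scheme \<Rightarrow> 'o \<Rightarrow> 'o \<Rightarrow> 'o \<Rightarrow> 'a"
  where "shuffle V X Y Z =
    Assoc V Y X Z \<cdot>\<^bsub>V\<^esub> ((Braid V X Y \<otimes>\<^bsub>V\<^esub> \<one>\<^bsub>V\<^esub> Z) \<cdot>\<^bsub>V\<^esub> inv_arr V (Assoc V X Y Z))"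

context braided_monoidal_category
begin

declare Braid_iso [simp]

lemma Braid_typing [simp]:
  assumes "X \<in> Obj V" "Y \<in> Obj V"
  shows "Braid V X Y \<in> Arr V" "Dom V (Braid V X Y) = X \<odot> Y" "Cod V (Braid V X Y) = Y \<odot> X"
  using Braid_in_hom[OF assms] by (simp_all add: in_hom_iff)

lemma Braid_nat:
  assumes "f \<in> Arr V" "g \<in> Arr V" "Cod V f = X" "Cod V g = Y"
  shows "Braid V X Y \<cdot> (f \<otimes> g) = (g \<otimes> f) \<cdot> Braid V (Dom V f) (Dom V g)"
  using assms by (intro Braid_natural) (auto simp: in_hom_iff)

text \<open>Compatibility of braiding and units is not an axiom. It follows from the first hexagon
  for \<open>X\<close>, \<open>\<I>\<close>, \<open>\<I>\<close>, read after tensoring with the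
  unit, which is faithful, and composing with the invertible \<open>Braid V X \<I>\<close>.\<close>

lemma LUnit_Braid:
  assumes [simp]: "X \<in> Obj V"
  shows "LUnit V X \<cdot> Braid V X \<I> = RUnit V X"
proof (rule RUnit_faithful)
  have "Braid V X \<I> \<cdot> ((LUnit V X \<cdot> Braid V X \<I>) \<otimes> \<one> \<I>)
      = Braid V X \<I> \<cdot> ((LUnit V X \<otimes> \<one> \<I>) \<cdot> (Braid V X \<I> \<otimes> \<one> \<I>))"
    by (simp add: Comp_Tens1)
  also have "\<dots> = Braid V X \<I> \<cdot> (LUnit V (X \<odot> \<I>) \<cdot> (Assoc V \<I> X \<I> \<cdot> (Braid V X \<I> \<otimes> \<one> \<I>)))"
    by (simp add: LUnit_Tens0[symmetric] Comp_assoc_arr)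
  also have "\<dots> = LUnit V (\<I> \<odot> X) \<cdot> ((\<one> \<I> \<otimes> Braid V X \<I>) \<cdot> (Assoc V \<I> X \<I> \<cdot> (Braid V X \<I> \<otimes> \<one> \<I>)))"
    by (simp add: Comp_eq_tail[OF LUnit_nat] Comp_assoc_arr)
  also have "\<dots> = LUnit V (\<I> \<odot> X) \<cdot> (Assoc V \<I> \<I> X \<cdot> (Braid V X (\<I> \<odot> \<I>) \<cdot> Assoc V X \<I> \<I>))"
    by (simp add: hexagon1)
  also have "\<dots> = (LUnit V \<I> \<otimes> \<one> X) \<cdot> (Braid V X (\<I> \<odot> \<I>) \<cdot> Assoc V X \<I> \<I>)"
    by (simp add: Comp_eq_tail[OF LUnit_Tens0])
  also have "\<dots> = Braid V X \<I> \<cdot> ((\<one> X \<otimes> LUnit V \<I>) \<cdot> Assoc V X \<I> \<I>)"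
    by (simp add: Comp_eq_tail[OF Braid_nat] Comp_assoc_arr)
  also have "\<dots> = Braid V X \<I> \<cdot> (RUnit V X \<otimes> \<one> \<I>)"
    by (simp add: triangle)
  finally show "(LUnit V X \<cdot> Braid V X \<I>) \<otimes> \<one> \<I> = RUnit V X \<otimes> \<one> \<I>"
    by (rule iso_cancel_left[rotated]) auto
qed auto

lemma shuffle_typing [simp]:
  assumes "X \<in> Obj V" "Y \<in> Obj V" "Z \<in> Obj V"
  shows "shuffle V X Y Z \<in> Arr V" "Dom V (shuffle V X Y Z) = X \<odot> (Y \<odot> Z)"
    "Cod V (shuffle V X Y Z) = Y \<odot> (X \<odot> Z)"
  using assms by (simp_all add: shuffle_def)

text \<open>The inverse-free description of the shuffle. Proofs precompose with the associator and
  use this instead of unfolding.\<close>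

lemma shuffle_Assoc:
  assumes [simp]: "X \<in> Obj V" "Y \<in> Obj V" "Z \<in> Obj V"
  shows "shuffle V X Y Z \<cdot> Assoc V X Y Z = Assoc V Y X Z \<cdot> (Braid V X Y \<otimes> \<one> Z)"
  by (simp add: shuffle_def Comp_assoc_arr)

lemma shuffle_nat:
  assumes [simp]: "f \<in> Arr V" "g \<in> Arr V" "h \<in> Arr V"
    and "Cod V f = X" "Cod V g = Y" "Cod V h = Z"
  shows "shuffle V X Y Z \<cdot> (f \<otimes> (g \<otimes> h)) = (g \<otimes> (f \<otimes> h)) \<cdot> shuffle V (Dom V f) (Dom V g) (Dom V h)"
proof (rule iso_cancel_right[of "Assoc V (Dom V f) (Dom V g) (Dom V h)"])
  have [simp]: "X \<in> Obj V" "Y \<in> Obj V" "Z \<in> Obj V" using assms by auto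
  let ?a = "Assoc V (Dom V f) (Dom V g) (Dom V h)"
  have "(shuffle V X Y Z \<cdot> (f \<otimes> (g \<otimes> h))) \<cdot> ?a = shuffle V X Y Z \<cdot> (Assoc V X Y Z \<cdot> ((f \<otimes> g) \<otimes> h))"
    by (simp add: Comp_assoc_arr Assoc_nat assms)
  also have "\<dots> = Assoc V Y X Z \<cdot> (((g \<otimes> f) \<otimes> h) \<cdot> (Braid V (Dom V f) (Dom V g) \<otimes> \<one> (Dom V h)))"
    by (simp add: Comp_eq_tail[OF shuffle_Assoc] Comp_assoc_arr Comp_Tens1 assms Braid_nat)
  also have "\<dots> = ((g \<otimes> (f \<otimes> h)) \<cdot> shuffle V (Dom V f) (Dom V g) (Dom V h)) \<cdot> ?a"
    by (simp add: Assoc_nat_tail Comp_assoc_arr assms shuffle_Assoc)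
  finally show "(shuffle V X Y Z \<cdot> (f \<otimes> (g \<otimes> h))) \<cdot> ?a
     = ((g \<otimes> (f \<otimes> h)) \<cdot> shuffle V (Dom V f) (Dom V g) (Dom V h)) \<cdot> ?a" .
qed (use assms in auto)

text \<open>The shuffle does not see how its last factor is composed. Two pentagons are joined by
  naturality of the associator along the braiding of \<open>X\<close> and \<open>Y\<close>.\<close>

lemma shuffle_Assoc_last:
  assumes [simp]: "X \<in> Obj V" "Y \<in> Obj V" "Z \<in> Obj V" "Z' \<in> Obj V"
  shows "(\<one> Y \<otimes> Assoc V X Z Z') \<cdot> (Assoc V Y (X \<odot> Z) Z' \<cdot> (shuffle V X Y Z \<otimes> \<one> Z'))
    = shuffle V X Y (Z \<odot> Z') \<cdot> ((\<one> X \<otimes> Assoc V Y Z Z') \<cdot> Assoc V X (Y \<odot> Z) Z')"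
    (is "?l = ?r")
proof (rule iso_cancel_right[of "Assoc V X Y Z \<otimes> \<one> Z'"])
  have "?l \<cdot> (Assoc V X Y Z \<otimes> \<one> Z') = (\<one> Y \<otimes> Assoc V X Z Z') \<cdot> (Assoc V Y (X \<odot> Z) Z'
      \<cdot> ((Assoc V Y X Z \<otimes> \<one> Z') \<cdot> ((Braid V X Y \<otimes> \<one> Z) \<otimes> \<one> Z')))"
    by (simp add: Comp_assoc_arr Comp_Tens1 shuffle_Assoc)
  also have "\<dots> = Assoc V Y X (Z \<odot> Z') \<cdot> (Assoc V (Y \<odot> X) Z Z' \<cdot> ((Braid V X Y \<otimes> \<one> Z) \<otimes> \<one> Z'))"
    by (simp add: pentagon_tail)
  also have "\<dots> = Assoc V Y X (Z \<odot> Z') \<cdot> ((Braid V X Y \<otimes> \<one> (Z \<odot> Z')) \<cdot> Assoc V (X \<odot> Y) Z Z')"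
    by (simp add: Assoc_nat)
  also have "\<dots> = shuffle V X Y (Z \<odot> Z') \<cdot> (Assoc V X Y (Z \<odot> Z') \<cdot> Assoc V (X \<odot> Y) Z Z')"
    by (simp add: Comp_eq_tail[OF shuffle_Assoc] Comp_assoc_arr)
  also have "\<dots> = ?r \<cdot> (Assoc V X Y Z \<otimes> \<one> Z')"
    by (simp add: pentagon Comp_assoc_arr)
  finally show "?l \<cdot> (Assoc V X Y Z \<otimes> \<one> Z') = ?r \<cdot> (Assoc V X Y Z \<otimes> \<one> Z')" .
qed auto

text \<open>This is the first hexagon with its associators absorbed into the shuffle; the next lemma
  is the second hexagon in the same form.\<close>

lemma Braid_Tens0_right:
  assumes [simp]: "X \<in> Obj V" "Y \<in> Obj V" "Z \<in> Obj V"
  shows "Assoc V Y Z X \<cdot> Braid V X (Y \<odot> Z) = (\<one> Y \<otimes> Braid V X Z) \<cdot> shuffle V X Y Z"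
  by (rule iso_cancel_right[of "Assoc V X Y Z"]) (auto simp: Comp_assoc_arr shuffle_Assoc hexagon1)

lemma Braid_Tens0_left:
  assumes [simp]: "X \<in> Obj V" "Y \<in> Obj V" "Z \<in> Obj V"
  shows "Braid V (X \<odot> Y) Z = shuffle V X Z Y \<cdot> ((\<one> X \<otimes> Braid V Y Z) \<cdot> Assoc V X Y Z)"
proof -
  have "Braid V (X \<odot> Y) Z = Assoc V Z X Y \<cdot> ((inv_arr V (Assoc V Z X Y)
      \<cdot> (Braid V (X \<odot> Y) Z \<cdot> inv_arr V (Assoc V X Y Z))) \<cdot> Assoc V X Y Z)"
    by (simp add: Comp_assoc_arr)
  then show ?thesis
    unfolding hexagon2[OF assms] by (simp add: shuffle_def Comp_assoc_arr)
qed

text \<open>The first hexagon tensored with \<open>Z\<close>: crossing a product means crossing its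
  factors one after the other.\<close>

lemma shuffle_Tens0_second:
  assumes [simp]: "X \<in> Obj V" "Y \<in> Obj V" "Y' \<in> Obj V" "Z \<in> Obj V"
  shows "Assoc V Y Y' (X \<odot> Z) \<cdot> shuffle V X (Y \<odot> Y') Z
    = (\<one> Y \<otimes> shuffle V X Y' Z) \<cdot> (shuffle V X Y (Y' \<odot> Z) \<cdot> (\<one> X \<otimes> Assoc V Y Y' Z))"
    (is "?l = ?r")
proof (rule iso_cancel_right[of "Assoc V X (Y \<odot> Y') Z"])
  have "?l \<cdot> Assoc V X (Y \<odot> Y') Z
      = Assoc V Y Y' (X \<odot> Z) \<cdot> (Assoc V (Y \<odot> Y') X Z \<cdot> (Braid V X (Y \<odot> Y') \<otimes> \<one> Z))"
    by (simp add: Comp_assoc_arr shuffle_Assoc)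
  also have "\<dots> = (\<one> Y \<otimes> Assoc V Y' X Z) \<cdot> (Assoc V Y (Y' \<odot> X) Z
      \<cdot> (((\<one> Y \<otimes> Braid V X Y') \<otimes> \<one> Z) \<cdot> (shuffle V X Y Y' \<otimes> \<one> Z)))"
    by (simp add: pentagon_tail Comp_Tens1 Braid_Tens0_right)
  also have "\<dots> = (\<one> Y \<otimes> (Assoc V Y' X Z \<cdot> (Braid V X Y' \<otimes> \<one> Z)))
      \<cdot> (Assoc V Y (X \<odot> Y') Z \<cdot> (shuffle V X Y Y' \<otimes> \<one> Z))"
    by (simp add: Assoc_nat_tail Comp_Tens1_tail)
  also have "\<dots> = (\<one> Y \<otimes> shuffle V X Y' Z) \<cdot> ((\<one> Y \<otimes> Assoc V X Y' Z)
      \<cdot> (Assoc V Y (X \<odot> Y') Z \<cdot> (shuffle V X Y Y' \<otimes> \<one> Z)))"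
    by (simp add: Comp_Tens1_tail shuffle_Assoc)
  also have "\<dots> = ?r \<cdot> Assoc V X (Y \<odot> Y') Z"
    by (simp add: shuffle_Assoc_last Comp_assoc_arr)
  finally show "?l \<cdot> Assoc V X (Y \<odot> Y') Z = ?r \<cdot> Assoc V X (Y \<odot> Y') Z" .
qed auto

lemma interchange_shuffle:
  "interchange V W X Y Z
    = inv_arr V (Assoc V W Y (X \<odot> Z)) \<cdot> ((\<one> W \<otimes> shuffle V X Y Z) \<cdot> Assoc V W X (Y \<odot> Z))"
  by (simp add: interchange_def shuffle_def)

lemma interchange_typing [simp]:
  assumes "W \<in> Obj V" "X \<in> Obj V" "Y \<in> Obj V" "Z \<in> Obj V"
  shows "interchange V W X Y Z \<in> Arr V"
    "Dom V (interchange V W X Y Z) = (W \<odot> X) \<odot> (Y \<odot> Z)"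
    "Cod V (interchange V W X Y Z) = (W \<odot> Y) \<odot> (X \<odot> Z)"
  using assms by (simp_all add: interchange_shuffle)

text \<open>Cancels the inverse associator in the interchange, so that only shuffles and forward
  associators remain.\<close>

lemma Assoc_interchange:
  assumes [simp]: "W \<in> Obj V" "X \<in> Obj V" "Y \<in> Obj V" "Z \<in> Obj V"
  shows "Assoc V W Y (X \<odot> Z) \<cdot> interchange V W X Y Z
    = (\<one> W \<otimes> shuffle V X Y Z) \<cdot> Assoc V W X (Y \<odot> Z)"
  by (simp add: interchange_shuffle)

lemma interchange_nat:
  assumes [simp]: "f \<in> Arr V" "g \<in> Arr V" "h \<in> Arr V" "k \<in> Arr V"
    and "Cod V f = W" "Cod V g = X" "Cod V h = Y" "Cod V k = Z"
  shows "interchange V W X Y Z \<cdot> ((f \<otimes> g) \<otimes> (h \<otimes> k))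
    = ((f \<otimes> h) \<otimes> (g \<otimes> k)) \<cdot> interchange V (Dom V f) (Dom V g) (Dom V h) (Dom V k)"
    (is "?l = ?r")
proof (rule iso_cancel_left[of "Assoc V W Y (X \<odot> Z)"])
  have [simp]: "W \<in> Obj V" "X \<in> Obj V" "Y \<in> Obj V" "Z \<in> Obj V" using assms by auto
  have "Assoc V W Y (X \<odot> Z) \<cdot> ?l
      = (\<one> W \<otimes> shuffle V X Y Z) \<cdot> (Assoc V W X (Y \<odot> Z) \<cdot> ((f \<otimes> g) \<otimes> (h \<otimes> k)))"
    by (simp add: Comp_eq_tail[OF Assoc_interchange] Comp_assoc_arr assms)
  also have "\<dots> = (f \<otimes> (h \<otimes> (g \<otimes> k))) \<cdot> ((\<one> (Dom V f) \<otimes> shuffle V (Dom V g) (Dom V h) (Dom V k))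
      \<cdot> Assoc V (Dom V f) (Dom V g) (Dom V h \<odot> Dom V k))"
    by (simp add: Assoc_nat Comp_Tens1_tail assms shuffle_nat)
  also have "\<dots> = Assoc V W Y (X \<odot> Z) \<cdot> ?r"
    by (simp add: Assoc_nat_tail assms Assoc_interchange)
  finally show "Assoc V W Y (X \<odot> Z) \<cdot> ?l = Assoc V W Y (X \<odot> Z) \<cdot> ?r" .
qed (use assms in auto)

end

context symmetric_monoidal_category
begin

declare Braid_symmetric [simp]

lemma inv_arr_Braid [simp]: "X \<in> Obj V \<Longrightarrow> Y \<in> Obj V \<Longrightarrow> inv_arr V (Braid V X Y) = Braid V Y X"
  by (rule inv_arr_eqI) (auto simp: is_inverse_def in_hom_iff)

lemma RUnit_Braid:
  assumes [simp]: "X \<in> Obj V"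
  shows "RUnit V X \<cdot> Braid V \<I> X = LUnit V X"
  by (simp add: LUnit_Braid[symmetric] Comp_assoc_arr)

text \<open>Here symmetry enters: the crossing of \<open>X\<close> over \<open>Y\<close> followed by
  that of \<open>Y\<close> over \<open>X\<close> is trivial. Invertibility of the interchange, with
  an explicit inverse, rests on it.\<close>

lemma shuffle_involution [simp]:
  assumes [simp]: "X \<in> Obj V" "Y \<in> Obj V" "Z \<in> Obj V"
  shows "shuffle V Y X Z \<cdot> shuffle V X Y Z = \<one> (X \<odot> (Y \<odot> Z))"
  by (simp add: shuffle_def Comp_assoc_arr Comp_Tens1_tail)

lemma is_iso_shuffle [simp]:
  assumes [simp]: "X \<in> Obj V" "Y \<in> Obj V" "Z \<in> Obj V"
  shows "is_iso V (shuffle V X Y Z)"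
  by (rule is_isoI[of _ "shuffle V Y X Z"]) (auto simp: is_inverse_def in_hom_iff)

lemma interchange_involution [simp]:
  assumes [simp]: "W \<in> Obj V" "X \<in> Obj V" "Y \<in> Obj V" "Z \<in> Obj V"
  shows "interchange V W Y X Z \<cdot> interchange V W X Y Z = \<one> ((W \<odot> X) \<odot> (Y \<odot> Z))"
  by (simp add: interchange_shuffle Comp_assoc_arr Comp_Tens1_tail)

lemma is_inverse_interchange:
  assumes "W \<in> Obj V" "X \<in> Obj V" "Y \<in> Obj V" "Z \<in> Obj V"
  shows "is_inverse V (interchange V W X Y Z) (interchange V W Y X Z)"
  using assms by (simp add: is_inverse_def in_hom_iff)

lemma is_iso_interchange [simp]:
  assumes "W \<in> Obj V" "X \<in> Obj V" "Y \<in> Obj V" "Z \<in> Obj V"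
  shows "is_iso V (interchange V W X Y Z)"
  using assms by (intro is_isoI[OF _ is_inverse_interchange]) auto

text \<open>By symmetry this is \<open>shuffle_Tens0_second\<close> read backwards: after
  precomposing with the inverse shuffle, both sides reduce to
  \<open>\<one> Y \<otimes> Assoc V X X' Z\<close>.\<close>

lemma shuffle_Tens0_first:
  assumes [simp]: "X \<in> Obj V" "X' \<in> Obj V" "Y \<in> Obj V" "Z \<in> Obj V"
  shows "(\<one> Y \<otimes> Assoc V X X' Z) \<cdot> shuffle V (X \<odot> X') Y Z
    = shuffle V X Y (X' \<odot> Z) \<cdot> ((\<one> X \<otimes> shuffle V X' Y Z) \<cdot> Assoc V X X' (Y \<odot> Z))"
    (is "?l = ?r")
proof (rule iso_cancel_right[of "shuffle V Y (X \<odot> X') Z"])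
  have "?r \<cdot> shuffle V Y (X \<odot> X') Z = shuffle V X Y (X' \<odot> Z) \<cdot> ((\<one> X \<otimes> shuffle V X' Y Z)
     \<cdot> ((\<one> X \<otimes> shuffle V Y X' Z) \<cdot> (shuffle V Y X (X' \<odot> Z) \<cdot> (\<one> Y \<otimes> Assoc V X X' Z))))"
    by (simp add: Comp_assoc_arr shuffle_Tens0_second)
  also have "\<dots> = \<one> Y \<otimes> Assoc V X X' Z"
    by (simp add: Comp_Tens1_tail Comp_eq_tail[OF shuffle_involution])
  also have "\<dots> = ?l \<cdot> shuffle V Y (X \<odot> X') Z"
    by (simp add: Comp_assoc_arr)
  finally show "?l \<cdot> shuffle V Y (X \<odot> X') Z = ?r \<cdot> shuffle V Y (X \<odot> X') Z" ..
qed auto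

text \<open>The associativity law of a lax monoidal functor, for the functor
  \<open>\<otimes>\<close> with the interchange as structure map. Both sides effect the same
  permutation of six factors, so both can be reduced to one sequence of elementary shuffles.\<close>

lemma interchange_Assoc:
  assumes [simp]: "a \<in> Obj V" "b \<in> Obj V" "c \<in> Obj V" "x \<in> Obj V" "y \<in> Obj V" "z \<in> Obj V"
  shows "(Assoc V a b c \<otimes> Assoc V x y z)
      \<cdot> (interchange V (a \<odot> b) (x \<odot> y) c z \<cdot> (interchange V a x b y \<otimes> \<one> (c \<odot> z)))
    = interchange V a x (b \<odot> c) (y \<odot> z)
      \<cdot> ((\<one> (a \<odot> x) \<otimes> interchange V b y c z) \<cdot> Assoc V (a \<odot> x) (b \<odot> y) (c \<odot> z))"
    (is "?l = ?r")
proof -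
  \<comment> \<open>\<open>?k\<close> rebrackets the target to the right; \<open>?n\<close> is the common normal form.\<close>
  let ?k = "(\<one> a \<otimes> Assoc V b c (x \<odot> (y \<odot> z))) \<cdot> Assoc V a (b \<odot> c) (x \<odot> (y \<odot> z))"
  \<comment> \<open>\<open>?s\<close> sorts
    \<open>x \<odot> ((b \<odot> y) \<odot> (c \<odot> z))\<close> into
    \<open>b \<odot> (c \<odot> (x \<odot> (y \<odot> z)))\<close>: \<open>b\<close> crosses
    \<open>x\<close>, then \<open>c\<close> crosses \<open>y\<close> and \<open>x\<close>.\<close>
  let ?s = "(\<one> b \<otimes> shuffle V x c (y \<odot> z)) \<cdot> ((\<one> b \<otimes> (\<one> x \<otimes> shuffle V y c z))
      \<cdot> (shuffle V x b (y \<odot> (c \<odot> z)) \<cdot> (\<one> x \<otimes> Assoc V b y (c \<odot> z))))"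
  let ?n = "(\<one> a \<otimes> ?s) \<cdot> (Assoc V a x ((b \<odot> y) \<odot> (c \<odot> z)) \<cdot> Assoc V (a \<odot> x) (b \<odot> y) (c \<odot> z))"
  have "?k \<cdot> ?r = (\<one> a \<otimes> (Assoc V b c (x \<odot> (y \<odot> z)) \<cdot> shuffle V x (b \<odot> c) (y \<odot> z)))
      \<cdot> (Assoc V a x ((b \<odot> c) \<odot> (y \<odot> z)) \<cdot> ((\<one> (a \<odot> x) \<otimes> interchange V b y c z)
      \<cdot> Assoc V (a \<odot> x) (b \<odot> y) (c \<odot> z)))"
    by (simp add: Comp_assoc_arr Comp_eq_tail[OF Assoc_interchange] Comp_Tens1_tail)
  also have "\<dots> = (\<one> a \<otimes> (Assoc V b c (x \<odot> (y \<odot> z)) \<cdot> shuffle V x (b \<odot> c) (y \<odot> z)))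
      \<cdot> ((\<one> a \<otimes> (\<one> x \<otimes> interchange V b y c z))
      \<cdot> (Assoc V a x ((b \<odot> y) \<odot> (c \<odot> z)) \<cdot> Assoc V (a \<odot> x) (b \<odot> y) (c \<odot> z)))"
    using Assoc_nat_tail[of "\<one> a" "\<one> x" "interchange V b y c z" a x "(b \<odot> c) \<odot> (y \<odot> z)"
        "Assoc V (a \<odot> x) (b \<odot> y) (c \<odot> z)"] by simp
  also have "\<dots> = (\<one> a \<otimes> ((\<one> b \<otimes> shuffle V x c (y \<odot> z)) \<cdot> (shuffle V x b (c \<odot> (y \<odot> z))
        \<cdot> (\<one> x \<otimes> ((\<one> b \<otimes> shuffle V y c z) \<cdot> Assoc V b y (c \<odot> z))))))
      \<cdot> (Assoc V a x ((b \<odot> y) \<odot> (c \<odot> z)) \<cdot> Assoc V (a \<odot> x) (b \<odot> y) (c \<odot> z))"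
    by (simp add: shuffle_Tens0_second Comp_Tens1_tail Comp_Tens1 Comp_assoc_arr Assoc_interchange)
  also have "shuffle V x b (c \<odot> (y \<odot> z)) \<cdot> (\<one> x \<otimes> ((\<one> b \<otimes> shuffle V y c z) \<cdot> Assoc V b y (c \<odot> z)))
      = shuffle V x b (c \<odot> (y \<odot> z)) \<cdot> ((\<one> x \<otimes> (\<one> b \<otimes> shuffle V y c z)) \<cdot> (\<one> x \<otimes> Assoc V b y (c \<odot> z)))"
    by (simp add: Comp_Tens1)
  also have "\<dots> = (\<one> b \<otimes> (\<one> x \<otimes> shuffle V y c z))
      \<cdot> (shuffle V x b (y \<odot> (c \<odot> z)) \<cdot> (\<one> x \<otimes> Assoc V b y (c \<odot> z)))"
    by (simp add: Comp_eq_tail[OF shuffle_nat] Comp_assoc_arr)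
  finally have r: "?k \<cdot> ?r = ?n" .
  let ?t = "interchange V a x b y"
  \<comment> \<open>\<open>?u\<close> is the part of this sorting that takes \<open>c\<close> across
    \<open>y\<close> and then across \<open>x\<close>; the crossing of \<open>x\<close> and
    \<open>b\<close> is still inside \<open>?t\<close>.\<close>
  let ?u = "shuffle V x c (y \<odot> z) \<cdot> ((\<one> x \<otimes> shuffle V y c z) \<cdot> Assoc V x y (c \<odot> z))"
  have "?k \<cdot> ?l = Assoc V a b (c \<odot> (x \<odot> (y \<odot> z))) \<cdot> (Assoc V (a \<odot> b) c (x \<odot> (y \<odot> z))
      \<cdot> ((\<one> ((a \<odot> b) \<odot> c) \<otimes> Assoc V x y z)
      \<cdot> (interchange V (a \<odot> b) (x \<odot> y) c z \<cdot> (?t \<otimes> \<one> (c \<odot> z)))))"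
    by (simp add: Comp_assoc_arr pentagon_tail Comp_Tens1_tail)
  also have "\<dots> = Assoc V a b (c \<odot> (x \<odot> (y \<odot> z))) \<cdot> ((\<one> (a \<odot> b) \<otimes> (\<one> c \<otimes> Assoc V x y z))
      \<cdot> (Assoc V (a \<odot> b) c ((x \<odot> y) \<odot> z)
      \<cdot> (interchange V (a \<odot> b) (x \<odot> y) c z \<cdot> (?t \<otimes> \<one> (c \<odot> z)))))"
    using Assoc_nat_tail[of "\<one> (a \<odot> b)" "\<one> c" "Assoc V x y z" "a \<odot> b" c "x \<odot> (y \<odot> z)"
        "interchange V (a \<odot> b) (x \<odot> y) c z \<cdot> (?t \<otimes> \<one> (c \<odot> z))"] by simp
  also have "\<dots> = Assoc V a b (c \<odot> (x \<odot> (y \<odot> z)))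
      \<cdot> ((\<one> (a \<odot> b) \<otimes> ?u) \<cdot> (Assoc V (a \<odot> b) (x \<odot> y) (c \<odot> z) \<cdot> (?t \<otimes> \<one> (c \<odot> z))))"
    by (simp add: Comp_eq_tail[OF Assoc_interchange] Comp_assoc_arr Comp_Tens1_tail shuffle_Tens0_first)
  also have "\<dots> = (\<one> a \<otimes> (\<one> b \<otimes> ?u)) \<cdot> (Assoc V a b ((x \<odot> y) \<odot> (c \<odot> z))
      \<cdot> (Assoc V (a \<odot> b) (x \<odot> y) (c \<odot> z) \<cdot> (?t \<otimes> \<one> (c \<odot> z))))"
    using Assoc_nat_tail[of "\<one> a" "\<one> b" ?u a b _
        "Assoc V (a \<odot> b) (x \<odot> y) (c \<odot> z) \<cdot> (?t \<otimes> \<one> (c \<odot> z))"] by simp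
  also have "\<dots> = (\<one> a \<otimes> ((\<one> b \<otimes> ?u) \<cdot> Assoc V b (x \<odot> y) (c \<odot> z)))
      \<cdot> (Assoc V a (b \<odot> (x \<odot> y)) (c \<odot> z)
      \<cdot> (((\<one> a \<otimes> shuffle V x b y) \<otimes> \<one> (c \<odot> z)) \<cdot> (Assoc V a x (b \<odot> y) \<otimes> \<one> (c \<odot> z))))"
    by (simp add: pentagon_tail Comp_Tens1 Comp_Tens1_tail Assoc_interchange)
  also have "\<dots> = (\<one> a \<otimes> ((\<one> b \<otimes> ?u) \<cdot> (Assoc V b (x \<odot> y) (c \<odot> z) \<cdot> (shuffle V x b y \<otimes> \<one> (c \<odot> z)))))
      \<cdot> (Assoc V a (x \<odot> (b \<odot> y)) (c \<odot> z) \<cdot> (Assoc V a x (b \<odot> y) \<otimes> \<one> (c \<odot> z)))"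
    by (simp add: Assoc_nat_tail Comp_Tens1_tail Comp_assoc_arr)
  also have "(\<one> b \<otimes> ?u) \<cdot> (Assoc V b (x \<odot> y) (c \<odot> z) \<cdot> (shuffle V x b y \<otimes> \<one> (c \<odot> z)))
      = (\<one> b \<otimes> (shuffle V x c (y \<odot> z) \<cdot> (\<one> x \<otimes> shuffle V y c z))) \<cdot> ((\<one> b \<otimes> Assoc V x y (c \<odot> z))
        \<cdot> (Assoc V b (x \<odot> y) (c \<odot> z) \<cdot> (shuffle V x b y \<otimes> \<one> (c \<odot> z))))"
    by (simp add: Comp_Tens1_tail Comp_assoc_arr)
  also have "\<dots> = ?s \<cdot> Assoc V x (b \<odot> y) (c \<odot> z)"
    by (simp add: shuffle_Assoc_last Comp_Tens1_tail Comp_assoc_arr)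
  also have "(\<one> a \<otimes> (?s \<cdot> Assoc V x (b \<odot> y) (c \<odot> z)))
      \<cdot> (Assoc V a (x \<odot> (b \<odot> y)) (c \<odot> z) \<cdot> (Assoc V a x (b \<odot> y) \<otimes> \<one> (c \<odot> z))) = ?n"
    by (simp add: pentagon Comp_Tens1_tail Comp_assoc_arr)
  finally have "?k \<cdot> ?l = ?k \<cdot> ?r" unfolding r .
  then show ?thesis
    by (rule iso_cancel_left[rotated]) auto
qed

text \<open>The two hexagons break the crossing of the blocks \<open>a \<odot> x\<close> and
  \<open>b \<odot> y\<close> into crossings of single factors. This is what makes the braiding a
  monoid morphism and the internal hom a braided functor.\<close>

lemma interchange_Braid:
  assumes [simp]: "a \<in> Obj V" "b \<in> Obj V" "x \<in> Obj V" "y \<in> Obj V"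
  shows "interchange V b a y x \<cdot> (Braid V a b \<otimes> Braid V x y)
    = Braid V (a \<odot> x) (b \<odot> y) \<cdot> interchange V a b x y"
    (is "?l = ?r")
proof (rule iso_cancel_left[of "Assoc V b y (a \<odot> x)"])
  have "Assoc V b y (a \<odot> x) \<cdot> ?r
      = (\<one> b \<otimes> Braid V (a \<odot> x) y) \<cdot> (shuffle V (a \<odot> x) b y \<cdot> interchange V a b x y)"
    by (simp add: Comp_eq_tail[OF Braid_Tens0_right] Comp_assoc_arr)
  also have "\<dots> = (\<one> b \<otimes> (shuffle V a y x \<cdot> (\<one> a \<otimes> Braid V x y)))
      \<cdot> ((\<one> b \<otimes> Assoc V a x y) \<cdot> (shuffle V (a \<odot> x) b y \<cdot> interchange V a b x y))"
    by (simp add: Braid_Tens0_left Comp_Tens1_tail Comp_assoc_arr)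
  also have "\<dots> = (\<one> b \<otimes> (shuffle V a y x \<cdot> (\<one> a \<otimes> Braid V x y))) \<cdot> (shuffle V a b (x \<odot> y)
      \<cdot> ((\<one> a \<otimes> shuffle V x b y) \<cdot> (Assoc V a x (b \<odot> y) \<cdot> interchange V a b x y)))"
    by (simp add: Comp_eq_tail[OF shuffle_Tens0_first] Comp_assoc_arr)
  \<comment> \<open>The crossing \<open>shuffle V x b y\<close> coming from the braiding undoes the
    \<open>shuffle V b x y\<close> contained in the interchange.\<close>
  also have "\<dots> = (\<one> b \<otimes> (shuffle V a y x \<cdot> (\<one> a \<otimes> Braid V x y)))
      \<cdot> (shuffle V a b (x \<odot> y) \<cdot> Assoc V a b (x \<odot> y))"
    by (simp add: Assoc_interchange Comp_Tens1_tail)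
  also have "\<dots> = (\<one> b \<otimes> shuffle V a y x) \<cdot> ((\<one> b \<otimes> (\<one> a \<otimes> Braid V x y))
      \<cdot> (Assoc V b a (x \<odot> y) \<cdot> (Braid V a b \<otimes> \<one> (x \<odot> y))))"
    by (simp add: Comp_Tens1_tail shuffle_Assoc)
  also have "\<dots> = (\<one> b \<otimes> shuffle V a y x) \<cdot> (Assoc V b a (y \<odot> x)
      \<cdot> ((\<one> (b \<odot> a) \<otimes> Braid V x y) \<cdot> (Braid V a b \<otimes> \<one> (x \<odot> y))))"
    using Assoc_nat_tail[of "\<one> b" "\<one> a" "Braid V x y" b a "y \<odot> x" "Braid V a b \<otimes> \<one> (x \<odot> y)"] by simp
  also have "\<dots> = Assoc V b y (a \<odot> x) \<cdot> ?l"
    by (simp add: Comp_eq_tail[OF Assoc_interchange] Comp_Tens1 Comp_assoc_arr)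
  finally show "Assoc V b y (a \<odot> x) \<cdot> ?l = Assoc V b y (a \<odot> x) \<cdot> ?r" ..
qed auto

text \<open>The left unit law of \<open>\<otimes>\<close> as a lax monoidal functor, whose unit map
  \<open>\<I> \<rightarrow> \<I> \<odot> \<I>\<close> is the inverse unitor. The right unit law
  follows below in the same way.\<close>

lemma interchange_LUnit:
  assumes [simp]: "X \<in> Obj V" "Y \<in> Obj V"
  shows "(LUnit V X \<otimes> LUnit V Y)
      \<cdot> (interchange V \<I> \<I> X Y \<cdot> (inv_arr V (LUnit V \<I>) \<otimes> \<one> (X \<odot> Y))) = LUnit V (X \<odot> Y)"
proof -
  let ?i = "inv_arr V (LUnit V \<I>) \<otimes> \<one> (X \<odot> Y)"
  \<comment> \<open>The second unit must first cross \<open>X\<close>; \<open>s\<close> says that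
    absorbing it after the crossing amounts to a left unitor.\<close>
  have s: "(\<one> X \<otimes> LUnit V Y) \<cdot> shuffle V \<I> X Y = LUnit V (X \<odot> Y)"
    by (rule iso_cancel_right[of "Assoc V \<I> X Y"])
      (auto simp: Comp_assoc_arr shuffle_Assoc Comp_eq_tail[OF triangle] Comp_Tens1 RUnit_Braid LUnit_Tens0)
  have "(LUnit V X \<otimes> LUnit V Y) \<cdot> (interchange V \<I> \<I> X Y \<cdot> ?i)
      = LUnit V (X \<odot> Y) \<cdot> (Assoc V \<I> X Y \<cdot> ((\<one> (\<I> \<odot> X) \<otimes> LUnit V Y) \<cdot> (interchange V \<I> \<I> X Y \<cdot> ?i)))"
    by (simp add: Comp_eq_tail[OF LUnit_Tens0] Comp_Tens1_tail)
  also have "\<dots> = LUnit V (X \<odot> Y) \<cdot> ((\<one> \<I> \<otimes> (\<one> X \<otimes> LUnit V Y))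
      \<cdot> (Assoc V \<I> X (\<I> \<odot> Y) \<cdot> (interchange V \<I> \<I> X Y \<cdot> ?i)))"
    using Assoc_nat_tail[of "\<one> \<I>" "\<one> X" "LUnit V Y" \<I> X Y "interchange V \<I> \<I> X Y \<cdot> ?i"] by simp
  also have "\<dots> = LUnit V (X \<odot> Y) \<cdot> ((\<one> \<I> \<otimes> LUnit V (X \<odot> Y)) \<cdot> (Assoc V \<I> \<I> (X \<odot> Y) \<cdot> ?i))"
    by (simp add: Comp_eq_tail[OF Assoc_interchange] Comp_assoc_arr Comp_Tens1_tail s)
  also have "\<dots> = LUnit V (X \<odot> Y)"
    by (simp add: Comp_eq_tail[OF triangle] Comp_Tens1 LUnit_TUnit[symmetric])
  finally show ?thesis .
qed

lemma interchange_RUnit: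
  assumes [simp]: "X \<in> Obj V" "Y \<in> Obj V"
  shows "(RUnit V X \<otimes> RUnit V Y)
      \<cdot> (interchange V X Y \<I> \<I> \<cdot> (\<one> (X \<odot> Y) \<otimes> inv_arr V (LUnit V \<I>))) = RUnit V (X \<odot> Y)"
proof -
  let ?i = "\<one> (X \<odot> Y) \<otimes> inv_arr V (LUnit V \<I>)"
  have s: "LUnit V Y \<cdot> ((\<one> \<I> \<otimes> RUnit V Y) \<cdot> shuffle V Y \<I> \<I>) = RUnit V Y \<cdot> (\<one> Y \<otimes> LUnit V \<I>)"
    by (rule iso_cancel_right[of "Assoc V Y \<I> \<I>"])
      (auto simp: Comp_assoc_arr shuffle_Assoc Comp_eq_tail[OF LUnit_nat] Comp_eq_tail[OF LUnit_Tens0]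
        triangle Comp_Tens1 LUnit_Braid)
  have "(RUnit V X \<otimes> RUnit V Y) \<cdot> (interchange V X Y \<I> \<I> \<cdot> ?i)
      = (\<one> X \<otimes> LUnit V Y) \<cdot> (Assoc V X \<I> Y
        \<cdot> ((\<one> (X \<odot> \<I>) \<otimes> RUnit V Y) \<cdot> (interchange V X Y \<I> \<I> \<cdot> ?i)))"
    by (simp add: Comp_eq_tail[OF triangle] Comp_Tens1_tail)
  also have "\<dots> = (\<one> X \<otimes> LUnit V Y) \<cdot> ((\<one> X \<otimes> (\<one> \<I> \<otimes> RUnit V Y))
        \<cdot> (Assoc V X \<I> (Y \<odot> \<I>) \<cdot> (interchange V X Y \<I> \<I> \<cdot> ?i)))"
    using Assoc_nat_tail[of "\<one> X" "\<one> \<I>" "RUnit V Y" X \<I> Y "interchange V X Y \<I> \<I> \<cdot> ?i"] by simp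
  also have "\<dots> = (\<one> X \<otimes> (RUnit V Y \<cdot> (\<one> Y \<otimes> LUnit V \<I>))) \<cdot> (Assoc V X Y (\<I> \<odot> \<I>) \<cdot> ?i)"
    by (simp add: Comp_eq_tail[OF Assoc_interchange] Comp_assoc_arr Comp_Tens1_tail s)
  also have "\<dots> = (\<one> X \<otimes> (RUnit V Y \<cdot> (\<one> Y \<otimes> LUnit V \<I>)))
      \<cdot> ((\<one> X \<otimes> (\<one> Y \<otimes> inv_arr V (LUnit V \<I>))) \<cdot> Assoc V X Y \<I>)"
    using Assoc_nat[of "\<one> X" "\<one> Y" "inv_arr V (LUnit V \<I>)" X Y "\<I> \<odot> \<I>"] by simp
  also have "\<dots> = RUnit V (X \<odot> Y)"
    by (simp add: Comp_Tens1_tail Comp_Tens1 Comp_assoc_arr RUnit_Tens0)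
  finally show ?thesis .
qed

end

section \<open>Opposites, products and lax monoidal functors\<close>

context category
begin

text \<open>Turns naturality of a family of isomorphisms into naturality of their inverses, which
  are the structure maps of \<open>opp\<close>.\<close>

lemma iso_square:
  assumes "a \<cdot> f = g \<cdot> b" "is_iso C a" "is_iso C b" "f \<in> Arr C" "g \<in> Arr C"
    "Cod C f = Dom C a" "Cod C b = Dom C g" "Dom C b = Dom C f"
  shows "f \<cdot> inv_arr C b = inv_arr C a \<cdot> g"
proof (rule iso_cancel_left[of a])
  have "a \<cdot> (f \<cdot> inv_arr C b) = (a \<cdot> f) \<cdot> inv_arr C b"
    using assms(2-) by (simp add: Comp_assoc_arr iso_Arr)
  also have "\<dots> = g" unfolding assms(1) using assms(2-) by (simp add: Comp_assoc_arr iso_Arr)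
  \<comment> \<open>That \<open>g\<close> and \<open>a\<close> have the same codomain is not assumed
    but read off the commuting square.\<close>
  also have "g = a \<cdot> (inv_arr C a \<cdot> g)"
    using assms(2-) arg_cong[OF assms(1), of "Cod C"] by (simp add: iso_Arr)
  finally show "a \<cdot> (f \<cdot> inv_arr C b) = a \<cdot> (inv_arr C a \<cdot> g)" .
qed (use assms(2-) arg_cong[OF assms(1), of "Cod C"] in \<open>auto simp: iso_Arr\<close>)

end

section \<open>Opposite categories\<close>

lemma opp_simps [simp]:
  "Obj (opp V) = Obj V" "Arr (opp V) = Arr V" "Dom (opp V) = Cod V" "Cod (opp V) = Dom V"
  "Ident (opp V) = Ident V" "Comp (opp V) g f = Comp V f g"
  "Tens0 (opp V) = Tens0 V" "Tens1 (opp V) = Tens1 V" "TUnit (opp V) = TUnit V"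
  "Assoc (opp V) X Y Z = inv_arr V (Assoc V X Y Z)"
  "LUnit (opp V) X = inv_arr V (LUnit V X)" "RUnit (opp V) X = inv_arr V (RUnit V X)"
  "Braid (opp V) X Y = inv_arr V (Braid V X Y)"
  by (simp_all add: opp_def)

lemma is_inverse_opp [simp]: "is_inverse (opp V) f g = is_inverse V f g"
  by (auto simp: is_inverse_def in_hom_iff)

lemma is_iso_opp [simp]: "is_iso (opp V) f = is_iso V f"
  and inv_arr_opp [simp]: "inv_arr (opp V) f = inv_arr V f"
  by (simp_all add: is_iso_def inv_arr_def)

lemma category_opp:
  fixes V :: "('o, 'a, 'z) moncat_scheme"
  assumes "category V"
  shows "category (opp V)"
proof -
  interpret category V by fact
  show ?thesis
    by unfold_locales (auto simp: in_hom_iff Comp_assoc_arr)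
qed

context monoidal_category
begin

text \<open>Naturality comes from \<open>iso_square\<close>, and each coherence equation from
  inverting both sides of the same equation in \<open>V\<close>.\<close>

lemma monoidal_category_opp: "monoidal_category (opp V)"
proof -
  interpret op: category "opp V" by (rule category_opp) unfold_locales
  show ?thesis
  proof unfold_locales
    fix f g h X X' Y Y' Z Z'
    assume "f \<in> hom (opp V) X X'" "g \<in> hom (opp V) Y Y'" "h \<in> hom (opp V) Z Z'"
    then show "Assoc (opp V) X' Y' Z' \<cdot>\<^bsub>opp V\<^esub> ((f \<otimes>\<^bsub>opp V\<^esub> g) \<otimes>\<^bsub>opp V\<^esub> h)
        = (f \<otimes>\<^bsub>opp V\<^esub> (g \<otimes>\<^bsub>opp V\<^esub> h)) \<cdot>\<^bsub>opp V\<^esub> Assoc (opp V) X Y Z"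
      using iso_square[OF Assoc_nat[of f g h X Y Z]] by (auto simp: in_hom_iff)
  next
    fix f X Y
    assume "f \<in> hom (opp V) X Y"
    then show "LUnit (opp V) Y \<cdot>\<^bsub>opp V\<^esub> (\<one>\<^bsub>opp V\<^esub> \<I>\<^bsub>opp V\<^esub> \<otimes>\<^bsub>opp V\<^esub> f) = f \<cdot>\<^bsub>opp V\<^esub> LUnit (opp V) X"
      and "RUnit (opp V) Y \<cdot>\<^bsub>opp V\<^esub> (f \<otimes>\<^bsub>opp V\<^esub> \<one>\<^bsub>opp V\<^esub> \<I>\<^bsub>opp V\<^esub>) = f \<cdot>\<^bsub>opp V\<^esub> RUnit (opp V) X"
      using iso_square[OF LUnit_nat[of f X]] iso_square[OF RUnit_nat[of f X]]
      by (auto simp: in_hom_iff)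
  next
    fix W X Y Z
    assume "W \<in> Obj (opp V)" "X \<in> Obj (opp V)" "Y \<in> Obj (opp V)" "Z \<in> Obj (opp V)"
    then show "Assoc (opp V) W X (Y \<odot>\<^bsub>opp V\<^esub> Z) \<cdot>\<^bsub>opp V\<^esub> Assoc (opp V) (W \<odot>\<^bsub>opp V\<^esub> X) Y Z
      = (\<one>\<^bsub>opp V\<^esub> W \<otimes>\<^bsub>opp V\<^esub> Assoc (opp V) X Y Z)
        \<cdot>\<^bsub>opp V\<^esub> (Assoc (opp V) W (X \<odot>\<^bsub>opp V\<^esub> Y) Z \<cdot>\<^bsub>opp V\<^esub> (Assoc (opp V) W X Y \<otimes>\<^bsub>opp V\<^esub> \<one>\<^bsub>opp V\<^esub> Z))"
      using arg_cong[OF pentagon[of W X Y Z], of "inv_arr V"] by (simp add: inv_arr_of_Comp Comp_assoc_arr)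
  next
    fix X Y
    assume "X \<in> Obj (opp V)" "Y \<in> Obj (opp V)"
    then show "(\<one>\<^bsub>opp V\<^esub> X \<otimes>\<^bsub>opp V\<^esub> LUnit (opp V) Y) \<cdot>\<^bsub>opp V\<^esub> Assoc (opp V) X \<I>\<^bsub>opp V\<^esub> Y
      = RUnit (opp V) X \<otimes>\<^bsub>opp V\<^esub> \<one>\<^bsub>opp V\<^esub> Y"
      using arg_cong[OF triangle[of X Y], of "inv_arr V"] by (simp add: inv_arr_of_Comp)
  qed (auto simp: in_hom_iff Comp_Tens1)
qed

end

context symmetric_monoidal_category
begin

lemma symmetric_monoidal_category_opp: "symmetric_monoidal_category (opp V)"
proof -
  interpret op: monoidal_category "opp V" by (rule monoidal_category_opp)
  show ?thesis
  proof unfold_locales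
    fix f g X X' Y Y'
    assume "f \<in> hom (opp V) X X'" "g \<in> hom (opp V) Y Y'"
    \<comment> \<open>By symmetry the inverse of \<open>Braid V X Y\<close> is
      \<open>Braid V Y X\<close>, so naturality is used with the two arrows exchanged.\<close>
    then show "Braid (opp V) X' Y' \<cdot>\<^bsub>opp V\<^esub> (f \<otimes>\<^bsub>opp V\<^esub> g) = (g \<otimes>\<^bsub>opp V\<^esub> f) \<cdot>\<^bsub>opp V\<^esub> Braid (opp V) X Y"
      using Braid_nat[of g f] by (auto simp: in_hom_iff)
  next
    fix X Y Z
    assume "X \<in> Obj (opp V)" "Y \<in> Obj (opp V)" "Z \<in> Obj (opp V)"
    then show "Assoc (opp V) Y Z X \<cdot>\<^bsub>opp V\<^esub> (Braid (opp V) X (Y \<odot>\<^bsub>opp V\<^esub> Z) \<cdot>\<^bsub>opp V\<^esub> Assoc (opp V) X Y Z)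
        = (\<one>\<^bsub>opp V\<^esub> Y \<otimes>\<^bsub>opp V\<^esub> Braid (opp V) X Z)
          \<cdot>\<^bsub>opp V\<^esub> (Assoc (opp V) Y X Z \<cdot>\<^bsub>opp V\<^esub> (Braid (opp V) X Y \<otimes>\<^bsub>opp V\<^esub> \<one>\<^bsub>opp V\<^esub> Z))"
      and "inv_arr (opp V) (Assoc (opp V) Z X Y)
          \<cdot>\<^bsub>opp V\<^esub> (Braid (opp V) (X \<odot>\<^bsub>opp V\<^esub> Y) Z \<cdot>\<^bsub>opp V\<^esub> inv_arr (opp V) (Assoc (opp V) X Y Z))
        = (Braid (opp V) X Z \<otimes>\<^bsub>opp V\<^esub> \<one>\<^bsub>opp V\<^esub> Y)
          \<cdot>\<^bsub>opp V\<^esub> (inv_arr (opp V) (Assoc (opp V) X Z Y) \<cdot>\<^bsub>opp V\<^esub> (\<one>\<^bsub>opp V\<^esub> X \<otimes>\<^bsub>opp V\<^esub> Braid (opp V) Y Z))"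
      using arg_cong[OF hexagon1[of X Y Z], of "inv_arr V"] arg_cong[OF hexagon2[of X Y Z], of "inv_arr V"]
      by (simp_all add: inv_arr_of_Comp Comp_assoc_arr)
  qed (auto simp: in_hom_iff)
qed

end

section \<open>Product categories\<close>

lemma prod_cat_simps [simp]:
  "Obj (prod_cat V W) = Obj V \<times> Obj W" "Arr (prod_cat V W) = Arr V \<times> Arr W"
  "Dom (prod_cat V W) p = (Dom V (fst p), Dom W (snd p))"
  "Cod (prod_cat V W) p = (Cod V (fst p), Cod W (snd p))"
  "Ident (prod_cat V W) x = (Ident V (fst x), Ident W (snd x))"
  "Comp (prod_cat V W) q p = (Comp V (fst q) (fst p), Comp W (snd q) (snd p))"
  "Tens0 (prod_cat V W) x y = (Tens0 V (fst x) (fst y), Tens0 W (snd x) (snd y))"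
  "Tens1 (prod_cat V W) p q = (Tens1 V (fst p) (fst q), Tens1 W (snd p) (snd q))"
  "TUnit (prod_cat V W) = (TUnit V, TUnit W)"
  "Assoc (prod_cat V W) x y z = (Assoc V (fst x) (fst y) (fst z), Assoc W (snd x) (snd y) (snd z))"
  "LUnit (prod_cat V W) x = (LUnit V (fst x), LUnit W (snd x))"
  "RUnit (prod_cat V W) x = (RUnit V (fst x), RUnit W (snd x))"
  "Braid (prod_cat V W) x y = (Braid V (fst x) (fst y), Braid W (snd x) (snd y))"
  by (simp_all add: prod_cat_def map_prod_def split_beta)

lemma is_inverse_prod_cat:
  "is_inverse (prod_cat V W) (f, f') (g, g') \<longleftrightarrow> is_inverse V f g \<and> is_inverse W f' g'"
  by (auto simp: is_inverse_def in_hom_iff)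

lemma category_prod_cat:
  fixes V :: "('o, 'a, 'y) moncat_scheme" and W :: "('p, 'b, 'z) moncat_scheme"
  assumes "category V" "category W"
  shows "category (prod_cat V W)"
proof -
  interpret V: category V by fact
  interpret W: category W by fact
  show ?thesis
    by unfold_locales (auto simp: in_hom_iff V.Comp_assoc_arr W.Comp_assoc_arr)
qed

lemma is_iso_prod_cat: "is_iso (prod_cat V W) (f, f') \<longleftrightarrow> is_iso V f \<and> is_iso W f'"
  by (auto simp: is_iso_def is_inverse_prod_cat)

text \<open>The components must be isomorphisms: otherwise the definite descriptions on the two
  sides are unrelated.\<close>

lemma inv_arr_prod_cat:
  fixes V :: "('o, 'a, 'y) moncat_scheme" and W :: "('p, 'b, 'z) moncat_scheme"
  assumes "category V" "category W" "is_iso V f" "is_iso W f'"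
  shows "inv_arr (prod_cat V W) (f, f') = (inv_arr V f, inv_arr W f')"
proof -
  interpret V: category V by fact
  interpret W: category W by fact
  interpret category "prod_cat V W" by (intro category_prod_cat assms)
  show ?thesis
    using assms by (intro inv_arr_eqI)
      (auto simp: is_inverse_prod_cat V.iso_Arr W.iso_Arr V.is_inverse_inv_arr W.is_inverse_inv_arr)
qed

lemma monoidal_category_prod_cat:
  fixes V :: "('o, 'a, 'y) moncat_scheme" and W :: "('p, 'b, 'z) moncat_scheme"
  assumes "monoidal_category V" "monoidal_category W"
  shows "monoidal_category (prod_cat V W)"
proof -
  interpret V: monoidal_category V by fact
  interpret W: monoidal_category W by fact
  interpret category "prod_cat V W" by (intro category_prod_cat) unfold_locales
  show ?thesis
    by unfold_locales
      (auto simp: in_hom_iff V.Comp_Tens1 W.Comp_Tens1 is_iso_prod_cat V.Assoc_nat W.Assoc_nat V.LUnit_nat W.LUnit_nat V.RUnit_nat W.RUnit_nat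
        V.pentagon W.pentagon V.triangle W.triangle)
qed

lemma symmetric_monoidal_category_prod_cat:
  fixes V :: "('o, 'a, 'y) moncat_scheme" and W :: "('p, 'b, 'z) moncat_scheme"
  assumes "symmetric_monoidal_category V" "symmetric_monoidal_category W"
  shows "symmetric_monoidal_category (prod_cat V W)"
proof -
  interpret V: symmetric_monoidal_category V by fact
  interpret W: symmetric_monoidal_category W by fact
  interpret monoidal_category "prod_cat V W" by (intro monoidal_category_prod_cat) unfold_locales
  show ?thesis
    by unfold_locales
      (auto simp: in_hom_iff is_iso_prod_cat inv_arr_prod_cat V.category_axioms W.category_axioms
        V.Braid_nat W.Braid_nat V.hexagon1 W.hexagon1 V.hexagon2 W.hexagon2)
qed

section \<open>Functors, lax monoidal functors and their action on monoids\<close>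

context cat_functor
begin

lemma Fun0_Obj [simp]: "X \<in> Obj C \<Longrightarrow> Fun0 F X \<in> Obj D"
  by (rule Fun0_in_Obj)

lemma Fun1_typing [simp]:
  assumes "f \<in> Arr C"
  shows "Fun1 F f \<in> Arr D" "Dom D (Fun1 F f) = Fun0 F (Dom C f)" "Cod D (Fun1 F f) = Fun0 F (Cod C f)"
  using Fun1_in_hom[of f "Dom C f" "Cod C f"] assms by (simp_all add: in_hom_iff)

declare Fun1_Ident [simp]

lemma Fun1_of_Comp:
  "f \<in> Arr C \<Longrightarrow> g \<in> Arr C \<Longrightarrow> Cod C f = Dom C g \<Longrightarrow> Fun1 F (g \<cdot>\<^bsub>C\<^esub> f) = Fun1 F g \<cdot>\<^bsub>D\<^esub> Fun1 F f"
  by (rule Fun1_Comp) (auto simp: in_hom_iff)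

lemma Comp_Fun1:
  "f \<in> Arr C \<Longrightarrow> g \<in> Arr C \<Longrightarrow> Cod C f = Dom C g \<Longrightarrow> Fun1 F g \<cdot>\<^bsub>D\<^esub> Fun1 F f = Fun1 F (g \<cdot>\<^bsub>C\<^esub> f)"
  by (simp add: Fun1_of_Comp)

lemma Fun1_square_tail:
  assumes "g \<cdot>\<^bsub>C\<^esub> f = k \<cdot>\<^bsub>C\<^esub> h" "f \<in> Arr C" "g \<in> Arr C" "Cod C f = Dom C g"
    "h \<in> Arr C" "k \<in> Arr C" "Cod C h = Dom C k" "t \<in> Arr D" "Cod D t = Fun0 F (Dom C f)"
  shows "Fun1 F g \<cdot>\<^bsub>D\<^esub> (Fun1 F f \<cdot>\<^bsub>D\<^esub> t) = Fun1 F k \<cdot>\<^bsub>D\<^esub> (Fun1 F h \<cdot>\<^bsub>D\<^esub> t)"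
proof -
  have d: "Dom C f = Dom C h"
    using assms(2-7) arg_cong[OF assms(1), of "Dom C"] by simp
  have "Fun1 F g \<cdot>\<^bsub>D\<^esub> (Fun1 F f \<cdot>\<^bsub>D\<^esub> t) = Fun1 F (g \<cdot>\<^bsub>C\<^esub> f) \<cdot>\<^bsub>D\<^esub> t"
    using assms(2-) by (simp add: Fun1_of_Comp target.Comp_assoc_arr)
  also have "\<dots> = Fun1 F k \<cdot>\<^bsub>D\<^esub> (Fun1 F h \<cdot>\<^bsub>D\<^esub> t)"
    unfolding assms(1) using assms(2-) d by (simp add: Fun1_of_Comp target.Comp_assoc_arr)
  finally show ?thesis .
qed

lemma is_inverse_Fun1: "is_iso C f \<Longrightarrow> is_inverse D (Fun1 F f) (Fun1 F (inv_arr C f))"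
  by (simp add: is_inverse_def in_hom_iff source.iso_Arr Comp_Fun1)

lemma is_iso_Fun1 [simp]: "is_iso C f \<Longrightarrow> is_iso D (Fun1 F f)"
  by (rule target.is_isoI[OF _ is_inverse_Fun1]) (auto simp: source.iso_Arr)

lemma inv_arr_Fun1: "is_iso C f \<Longrightarrow> inv_arr D (Fun1 F f) = Fun1 F (inv_arr C f)"
  by (rule target.inv_arr_eqI[OF _ is_inverse_Fun1]) (auto simp: source.iso_Arr)

end

text \<open>Both tensor products of monoids and convolution monoids have this form, for
  \<open>F\<close> the tensor product and the internal hom respectively; see
  \<open>tensor_mon_image\<close> and \<open>conv_image\<close>.\<close>

definition image_mon :: "('p, 'b, 'z) moncat_scheme \<Rightarrow> ('o, 'a, 'p, 'b, 'w) lax_func_scheme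
    \<Rightarrow> ('o, 'a) mon_obj \<Rightarrow> ('p, 'b) mon_obj"
  where "image_mon W F M =
    \<lparr>Car = Fun0 F (Car M),
     Mult = Fun1 F (Mult M) \<cdot>\<^bsub>W\<^esub> FMult F (Car M) (Car M),
     Unt = Fun1 F (Unt M) \<cdot>\<^bsub>W\<^esub> FUnit F\<rparr>"

lemma image_mon_simps [simp]:
  "Car (image_mon W F M) = Fun0 F (Car M)"
  "Mult (image_mon W F M) = Fun1 F (Mult M) \<cdot>\<^bsub>W\<^esub> FMult F (Car M) (Car M)"
  "Unt (image_mon W F M) = Fun1 F (Unt M) \<cdot>\<^bsub>W\<^esub> FUnit F"
  by (simp_all add: image_mon_def)

context lax_monoidal_functor
begin

lemma FMult_typing [simp]:
  assumes "X \<in> Obj V" "Y \<in> Obj V"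
  shows "FMult F X Y \<in> Arr W" "Dom W (FMult F X Y) = Fun0 F X \<odot>\<^bsub>W\<^esub> Fun0 F Y"
    "Cod W (FMult F X Y) = Fun0 F (X \<odot>\<^bsub>V\<^esub> Y)"
  using FMult_in_hom[OF assms] by (simp_all add: in_hom_iff)

lemma FUnit_typing [simp]:
  "FUnit F \<in> Arr W" "Dom W (FUnit F) = \<I>\<^bsub>W\<^esub>" "Cod W (FUnit F) = Fun0 F \<I>\<^bsub>V\<^esub>"
  using FUnit_in_hom by (simp_all add: in_hom_iff)

lemma FMult_nat:
  assumes "f \<in> Arr V" "g \<in> Arr V" "Cod V f = X" "Cod V g = Y"
  shows "FMult F X Y \<cdot>\<^bsub>W\<^esub> (Fun1 F f \<otimes>\<^bsub>W\<^esub> Fun1 F g) = Fun1 F (f \<otimes>\<^bsub>V\<^esub> g) \<cdot>\<^bsub>W\<^esub> FMult F (Dom V f) (Dom V g)"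
  using assms by (intro FMult_natural) (auto simp: in_hom_iff)

lemma FMult_nat_left:
  assumes "f \<in> Arr V" "Cod V f = X" "Y \<in> Obj V"
  shows "FMult F X Y \<cdot>\<^bsub>W\<^esub> (Fun1 F f \<otimes>\<^bsub>W\<^esub> \<one>\<^bsub>W\<^esub> (Fun0 F Y)) = Fun1 F (f \<otimes>\<^bsub>V\<^esub> \<one>\<^bsub>V\<^esub> Y) \<cdot>\<^bsub>W\<^esub> FMult F (Dom V f) Y"
  using assms FMult_nat[of f "\<one>\<^bsub>V\<^esub> Y" X Y] by simp

lemma FMult_nat_right:
  assumes "g \<in> Arr V" "X \<in> Obj V" "Cod V g = Y"
  shows "FMult F X Y \<cdot>\<^bsub>W\<^esub> (\<one>\<^bsub>W\<^esub> (Fun0 F X) \<otimes>\<^bsub>W\<^esub> Fun1 F g) = Fun1 F (\<one>\<^bsub>V\<^esub> X \<otimes>\<^bsub>V\<^esub> g) \<cdot>\<^bsub>W\<^esub> FMult F X (Dom V g)"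
  using assms FMult_nat[of "\<one>\<^bsub>V\<^esub> X" g X Y] by simp

text \<open>The left unit law at the unit object, precomposed with \<open>FUnit F\<close> in the
  second factor. It makes \<open>FUnit F\<close> multiplicative and later controls the unit of
  \<open>image_mon\<close> on tensor products.\<close>

lemma FUnit_FMult:
  "Fun1 F (LUnit V \<I>\<^bsub>V\<^esub>) \<cdot>\<^bsub>W\<^esub> (FMult F \<I>\<^bsub>V\<^esub> \<I>\<^bsub>V\<^esub> \<cdot>\<^bsub>W\<^esub> (FUnit F \<otimes>\<^bsub>W\<^esub> FUnit F)) = FUnit F \<cdot>\<^bsub>W\<^esub> LUnit W \<I>\<^bsub>W\<^esub>"
proof -
  have "FUnit F \<cdot>\<^bsub>W\<^esub> LUnit W \<I>\<^bsub>W\<^esub> = LUnit W (Fun0 F \<I>\<^bsub>V\<^esub>) \<cdot>\<^bsub>W\<^esub> (\<one>\<^bsub>W\<^esub> \<I>\<^bsub>W\<^esub> \<otimes>\<^bsub>W\<^esub> FUnit F)"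
    by (simp add: target.LUnit_nat)
  also have "\<dots> = Fun1 F (LUnit V \<I>\<^bsub>V\<^esub>) \<cdot>\<^bsub>W\<^esub> (FMult F \<I>\<^bsub>V\<^esub> \<I>\<^bsub>V\<^esub>
      \<cdot>\<^bsub>W\<^esub> ((FUnit F \<otimes>\<^bsub>W\<^esub> \<one>\<^bsub>W\<^esub> (Fun0 F \<I>\<^bsub>V\<^esub>)) \<cdot>\<^bsub>W\<^esub> (\<one>\<^bsub>W\<^esub> \<I>\<^bsub>W\<^esub> \<otimes>\<^bsub>W\<^esub> FUnit F)))"
    by (simp add: FMult_left_unit[symmetric] target.Comp_assoc_arr)
  also have "\<dots> = Fun1 F (LUnit V \<I>\<^bsub>V\<^esub>) \<cdot>\<^bsub>W\<^esub> (FMult F \<I>\<^bsub>V\<^esub> \<I>\<^bsub>V\<^esub> \<cdot>\<^bsub>W\<^esub> (FUnit F \<otimes>\<^bsub>W\<^esub> FUnit F))"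
    by (simp add: target.Comp_Tens1)
  finally show ?thesis ..
qed

text \<open>Naturality of \<open>FMult F\<close> moves the arrows of the monoid together under
  \<open>F\<close>, where its axioms apply; the laws of \<open>F\<close> account for the remaining
  structure maps.\<close>

lemma monoid_in_image_mon:
  assumes "monoid_in V M"
  shows "monoid_in W (image_mon W F M)"
proof -
  define X where "X = Car M"
  define m where "m = Mult M"
  define u where "u = Unt M"
  have [simp]: "X \<in> Obj V" "m \<in> Arr V" "Dom V m = X \<odot>\<^bsub>V\<^esub> X" "Cod V m = X"
      "u \<in> Arr V" "Dom V u = \<I>\<^bsub>V\<^esub>" "Cod V u = X"
    and ax: "m \<cdot>\<^bsub>V\<^esub> (m \<otimes>\<^bsub>V\<^esub> \<one>\<^bsub>V\<^esub> X) = m \<cdot>\<^bsub>V\<^esub> ((\<one>\<^bsub>V\<^esub> X \<otimes>\<^bsub>V\<^esub> m) \<cdot>\<^bsub>V\<^esub> Assoc V X X X)"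
      "m \<cdot>\<^bsub>V\<^esub> (u \<otimes>\<^bsub>V\<^esub> \<one>\<^bsub>V\<^esub> X) = LUnit V X" "m \<cdot>\<^bsub>V\<^esub> (\<one>\<^bsub>V\<^esub> X \<otimes>\<^bsub>V\<^esub> u) = RUnit V X"
    using assms by (auto simp: monoid_in_def in_hom_iff X_def m_def u_def)
  let ?m = "Fun1 F m \<cdot>\<^bsub>W\<^esub> FMult F X X"
  let ?u = "Fun1 F u \<cdot>\<^bsub>W\<^esub> FUnit F"
  let ?X = "Fun0 F X"
  have "?m \<cdot>\<^bsub>W\<^esub> (?m \<otimes>\<^bsub>W\<^esub> \<one>\<^bsub>W\<^esub> ?X)
      = Fun1 F m \<cdot>\<^bsub>W\<^esub> (FMult F X X \<cdot>\<^bsub>W\<^esub> ((Fun1 F m \<otimes>\<^bsub>W\<^esub> \<one>\<^bsub>W\<^esub> ?X) \<cdot>\<^bsub>W\<^esub> (FMult F X X \<otimes>\<^bsub>W\<^esub> \<one>\<^bsub>W\<^esub> ?X)))"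
    by (simp add: target.Comp_assoc_arr target.Comp_Tens1)
  also have "\<dots> = Fun1 F (m \<cdot>\<^bsub>V\<^esub> (m \<otimes>\<^bsub>V\<^esub> \<one>\<^bsub>V\<^esub> X)) \<cdot>\<^bsub>W\<^esub> (FMult F (X \<odot>\<^bsub>V\<^esub> X) X \<cdot>\<^bsub>W\<^esub> (FMult F X X \<otimes>\<^bsub>W\<^esub> \<one>\<^bsub>W\<^esub> ?X))"
    by (simp add: target.Comp_eq_tail[OF FMult_nat_left] Fun1_of_Comp target.Comp_assoc_arr)
  also have "\<dots> = Fun1 F m \<cdot>\<^bsub>W\<^esub> (Fun1 F (\<one>\<^bsub>V\<^esub> X \<otimes>\<^bsub>V\<^esub> m) \<cdot>\<^bsub>W\<^esub> (Fun1 F (Assoc V X X X)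
      \<cdot>\<^bsub>W\<^esub> (FMult F (X \<odot>\<^bsub>V\<^esub> X) X \<cdot>\<^bsub>W\<^esub> (FMult F X X \<otimes>\<^bsub>W\<^esub> \<one>\<^bsub>W\<^esub> ?X))))"
    by (simp add: ax(1) Fun1_of_Comp target.Comp_assoc_arr)
  also have "\<dots> = Fun1 F m \<cdot>\<^bsub>W\<^esub> (Fun1 F (\<one>\<^bsub>V\<^esub> X \<otimes>\<^bsub>V\<^esub> m) \<cdot>\<^bsub>W\<^esub> (FMult F X (X \<odot>\<^bsub>V\<^esub> X)
      \<cdot>\<^bsub>W\<^esub> ((\<one>\<^bsub>W\<^esub> ?X \<otimes>\<^bsub>W\<^esub> FMult F X X) \<cdot>\<^bsub>W\<^esub> Assoc W ?X ?X ?X)))"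
    by (simp add: FMult_assoc)
  also have "\<dots> = Fun1 F m \<cdot>\<^bsub>W\<^esub> (FMult F X X \<cdot>\<^bsub>W\<^esub> ((\<one>\<^bsub>W\<^esub> ?X \<otimes>\<^bsub>W\<^esub> Fun1 F m)
      \<cdot>\<^bsub>W\<^esub> ((\<one>\<^bsub>W\<^esub> ?X \<otimes>\<^bsub>W\<^esub> FMult F X X) \<cdot>\<^bsub>W\<^esub> Assoc W ?X ?X ?X)))"
    by (simp add: target.Comp_eq_tail[OF FMult_nat_right] target.Comp_assoc_arr)
  also have "\<dots> = ?m \<cdot>\<^bsub>W\<^esub> ((\<one>\<^bsub>W\<^esub> ?X \<otimes>\<^bsub>W\<^esub> ?m) \<cdot>\<^bsub>W\<^esub> Assoc W ?X ?X ?X)"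
    by (simp add: target.Comp_assoc_arr target.Comp_Tens1_tail)
  finally have "?m \<cdot>\<^bsub>W\<^esub> (?m \<otimes>\<^bsub>W\<^esub> \<one>\<^bsub>W\<^esub> ?X) = ?m \<cdot>\<^bsub>W\<^esub> ((\<one>\<^bsub>W\<^esub> ?X \<otimes>\<^bsub>W\<^esub> ?m) \<cdot>\<^bsub>W\<^esub> Assoc W ?X ?X ?X)" .
  moreover have "?m \<cdot>\<^bsub>W\<^esub> (?u \<otimes>\<^bsub>W\<^esub> \<one>\<^bsub>W\<^esub> ?X) = LUnit W ?X"
  proof -
    have "?m \<cdot>\<^bsub>W\<^esub> (?u \<otimes>\<^bsub>W\<^esub> \<one>\<^bsub>W\<^esub> ?X)
        = Fun1 F m \<cdot>\<^bsub>W\<^esub> (FMult F X X \<cdot>\<^bsub>W\<^esub> ((Fun1 F u \<otimes>\<^bsub>W\<^esub> \<one>\<^bsub>W\<^esub> ?X) \<cdot>\<^bsub>W\<^esub> (FUnit F \<otimes>\<^bsub>W\<^esub> \<one>\<^bsub>W\<^esub> ?X)))"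
      by (simp add: target.Comp_assoc_arr target.Comp_Tens1)
    also have "\<dots> = Fun1 F (m \<cdot>\<^bsub>V\<^esub> (u \<otimes>\<^bsub>V\<^esub> \<one>\<^bsub>V\<^esub> X)) \<cdot>\<^bsub>W\<^esub> (FMult F \<I>\<^bsub>V\<^esub> X \<cdot>\<^bsub>W\<^esub> (FUnit F \<otimes>\<^bsub>W\<^esub> \<one>\<^bsub>W\<^esub> ?X))"
      by (simp add: target.Comp_eq_tail[OF FMult_nat_left] Fun1_of_Comp target.Comp_assoc_arr)
    finally show ?thesis by (simp add: ax FMult_left_unit)
  qed
  moreover have "?m \<cdot>\<^bsub>W\<^esub> (\<one>\<^bsub>W\<^esub> ?X \<otimes>\<^bsub>W\<^esub> ?u) = RUnit W ?X"
  proof -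
    have "?m \<cdot>\<^bsub>W\<^esub> (\<one>\<^bsub>W\<^esub> ?X \<otimes>\<^bsub>W\<^esub> ?u)
        = Fun1 F m \<cdot>\<^bsub>W\<^esub> (FMult F X X \<cdot>\<^bsub>W\<^esub> ((\<one>\<^bsub>W\<^esub> ?X \<otimes>\<^bsub>W\<^esub> Fun1 F u) \<cdot>\<^bsub>W\<^esub> (\<one>\<^bsub>W\<^esub> ?X \<otimes>\<^bsub>W\<^esub> FUnit F)))"
      by (simp add: target.Comp_assoc_arr target.Comp_Tens1)
    also have "\<dots> = Fun1 F (m \<cdot>\<^bsub>V\<^esub> (\<one>\<^bsub>V\<^esub> X \<otimes>\<^bsub>V\<^esub> u)) \<cdot>\<^bsub>W\<^esub> (FMult F X \<I>\<^bsub>V\<^esub> \<cdot>\<^bsub>W\<^esub> (\<one>\<^bsub>W\<^esub> ?X \<otimes>\<^bsub>W\<^esub> FUnit F))"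
      by (simp add: target.Comp_eq_tail[OF FMult_nat_right] Fun1_of_Comp target.Comp_assoc_arr)
    finally show ?thesis by (simp add: ax FMult_right_unit)
  qed
  ultimately show ?thesis
    by (simp add: monoid_in_def in_hom_iff X_def[symmetric] m_def[symmetric] u_def[symmetric])
qed

lemma monoid_morphism_image_mon:
  assumes "monoid_morphism V M f N" "monoid_in V M" "monoid_in V N"
  shows "monoid_morphism W (image_mon W F M) (Fun1 F f) (image_mon W F N)"
proof -
  have [simp]: "Car M \<in> Obj V" "Mult M \<in> Arr V" "Dom V (Mult M) = Car M \<odot>\<^bsub>V\<^esub> Car M" "Cod V (Mult M) = Car M"
      "Unt M \<in> Arr V" "Dom V (Unt M) = \<I>\<^bsub>V\<^esub>" "Cod V (Unt M) = Car M"
      "Car N \<in> Obj V" "Mult N \<in> Arr V" "Dom V (Mult N) = Car N \<odot>\<^bsub>V\<^esub> Car N" "Cod V (Mult N) = Car N"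
      "Unt N \<in> Arr V" "Dom V (Unt N) = \<I>\<^bsub>V\<^esub>" "Cod V (Unt N) = Car N"
      "f \<in> Arr V" "Dom V f = Car M" "Cod V f = Car N"
    and f: "f \<cdot>\<^bsub>V\<^esub> Mult M = Mult N \<cdot>\<^bsub>V\<^esub> (f \<otimes>\<^bsub>V\<^esub> f)" "f \<cdot>\<^bsub>V\<^esub> Unt M = Unt N"
    using assms by (auto simp: monoid_in_def monoid_morphism_def in_hom_iff)
  show ?thesis
    by (simp add: monoid_morphism_def in_hom_iff target.Comp_assoc_arr FMult_nat Fun1_square_tail[OF f(1)]
        target.Comp_eq_tail[OF Comp_Fun1] f)
qed

lemma monoid_morphism_FUnit: "monoid_morphism W (unit_mon W) (FUnit F) (image_mon W F (unit_mon V))"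
  by (simp add: monoid_morphism_def unit_mon_def in_hom_iff target.Comp_assoc_arr FUnit_FMult)

end

context braided_lax_monoidal_functor
begin

text \<open>A shuffle is made of associators and one braiding, and \<open>FMult F\<close> respects
  both. Precomposing with the associator of \<open>W\<close> avoids inverses.\<close>

lemma FMult_shuffle:
  assumes [simp]: "X \<in> Obj V" "Y \<in> Obj V" "Z \<in> Obj V"
  shows "Fun1 F (shuffle V X Y Z) \<cdot>\<^bsub>W\<^esub> (FMult F X (Y \<odot>\<^bsub>V\<^esub> Z) \<cdot>\<^bsub>W\<^esub> (\<one>\<^bsub>W\<^esub> (Fun0 F X) \<otimes>\<^bsub>W\<^esub> FMult F Y Z))
    = FMult F Y (X \<odot>\<^bsub>V\<^esub> Z) \<cdot>\<^bsub>W\<^esub> ((\<one>\<^bsub>W\<^esub> (Fun0 F Y) \<otimes>\<^bsub>W\<^esub> FMult F X Z)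
      \<cdot>\<^bsub>W\<^esub> shuffle W (Fun0 F X) (Fun0 F Y) (Fun0 F Z))"
    (is "?l = ?r")
proof (rule target.iso_cancel_right[of "Assoc W (Fun0 F X) (Fun0 F Y) (Fun0 F Z)"])
  let ?a = "Assoc W (Fun0 F X) (Fun0 F Y) (Fun0 F Z)"
  let ?Z = "\<one>\<^bsub>W\<^esub> (Fun0 F Z)"
  have "?l \<cdot>\<^bsub>W\<^esub> ?a = Fun1 F (shuffle V X Y Z) \<cdot>\<^bsub>W\<^esub> (Fun1 F (Assoc V X Y Z)
      \<cdot>\<^bsub>W\<^esub> (FMult F (X \<odot>\<^bsub>V\<^esub> Y) Z \<cdot>\<^bsub>W\<^esub> (FMult F X Y \<otimes>\<^bsub>W\<^esub> ?Z)))"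
    by (simp add: target.Comp_assoc_arr FMult_assoc)
  also have "\<dots> = Fun1 F (Assoc V Y X Z) \<cdot>\<^bsub>W\<^esub> (Fun1 F (Braid V X Y \<otimes>\<^bsub>V\<^esub> \<one>\<^bsub>V\<^esub> Z)
      \<cdot>\<^bsub>W\<^esub> (FMult F (X \<odot>\<^bsub>V\<^esub> Y) Z \<cdot>\<^bsub>W\<^esub> (FMult F X Y \<otimes>\<^bsub>W\<^esub> ?Z)))"
    by (simp add: Fun1_square_tail[OF source.shuffle_Assoc])
  also have "\<dots> = Fun1 F (Assoc V Y X Z) \<cdot>\<^bsub>W\<^esub> (FMult F (Y \<odot>\<^bsub>V\<^esub> X) Z
      \<cdot>\<^bsub>W\<^esub> ((Fun1 F (Braid V X Y) \<otimes>\<^bsub>W\<^esub> ?Z) \<cdot>\<^bsub>W\<^esub> (FMult F X Y \<otimes>\<^bsub>W\<^esub> ?Z)))"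
    by (simp add: target.Comp_eq_tail[OF FMult_nat_left] target.Comp_assoc_arr)
  also have "\<dots> = Fun1 F (Assoc V Y X Z) \<cdot>\<^bsub>W\<^esub> (FMult F (Y \<odot>\<^bsub>V\<^esub> X) Z
      \<cdot>\<^bsub>W\<^esub> ((Fun1 F (Braid V X Y) \<cdot>\<^bsub>W\<^esub> FMult F X Y) \<otimes>\<^bsub>W\<^esub> ?Z))"
    by (simp add: target.Comp_Tens1)
  also have "\<dots> = Fun1 F (Assoc V Y X Z) \<cdot>\<^bsub>W\<^esub> (FMult F (Y \<odot>\<^bsub>V\<^esub> X) Z
      \<cdot>\<^bsub>W\<^esub> ((FMult F Y X \<otimes>\<^bsub>W\<^esub> ?Z) \<cdot>\<^bsub>W\<^esub> (Braid W (Fun0 F X) (Fun0 F Y) \<otimes>\<^bsub>W\<^esub> ?Z)))"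
    by (simp add: FMult_braided target.Comp_Tens1)
  also have "\<dots> = (Fun1 F (Assoc V Y X Z) \<cdot>\<^bsub>W\<^esub> (FMult F (Y \<odot>\<^bsub>V\<^esub> X) Z
      \<cdot>\<^bsub>W\<^esub> (FMult F Y X \<otimes>\<^bsub>W\<^esub> ?Z))) \<cdot>\<^bsub>W\<^esub> (Braid W (Fun0 F X) (Fun0 F Y) \<otimes>\<^bsub>W\<^esub> ?Z)"
    by (simp add: target.Comp_assoc_arr)
  also have "\<dots> = ?r \<cdot>\<^bsub>W\<^esub> ?a"
    unfolding FMult_assoc[OF assms(2,1,3)] by (simp add: target.Comp_assoc_arr target.shuffle_Assoc)
  finally show "?l \<cdot>\<^bsub>W\<^esub> ?a = ?r \<cdot>\<^bsub>W\<^esub> ?a" .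
qed auto

text \<open>The associativity law with an arbitrary arrow in the last factor. In the next lemma that
  factor carries a second \<open>FMult F\<close> instead of an identity.\<close>

lemma FMult_Assoc_tail:
  assumes [simp]: "X \<in> Obj V" "Y \<in> Obj V" "Z \<in> Obj V"
    and [simp]: "t \<in> Arr W" "Cod W t = Fun0 F Z"
  shows "Fun1 F (Assoc V X Y Z) \<cdot>\<^bsub>W\<^esub> (FMult F (X \<odot>\<^bsub>V\<^esub> Y) Z \<cdot>\<^bsub>W\<^esub> (FMult F X Y \<otimes>\<^bsub>W\<^esub> t))
    = FMult F X (Y \<odot>\<^bsub>V\<^esub> Z) \<cdot>\<^bsub>W\<^esub> ((\<one>\<^bsub>W\<^esub> (Fun0 F X) \<otimes>\<^bsub>W\<^esub> (FMult F Y Z \<cdot>\<^bsub>W\<^esub> (\<one>\<^bsub>W\<^esub> (Fun0 F Y) \<otimes>\<^bsub>W\<^esub> t)))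
      \<cdot>\<^bsub>W\<^esub> Assoc W (Fun0 F X) (Fun0 F Y) (Dom W t))"
proof -
  let ?t = "\<one>\<^bsub>W\<^esub> (Fun0 F X \<odot>\<^bsub>W\<^esub> Fun0 F Y) \<otimes>\<^bsub>W\<^esub> t"
  have "Fun1 F (Assoc V X Y Z) \<cdot>\<^bsub>W\<^esub> (FMult F (X \<odot>\<^bsub>V\<^esub> Y) Z \<cdot>\<^bsub>W\<^esub> (FMult F X Y \<otimes>\<^bsub>W\<^esub> t))
      = (Fun1 F (Assoc V X Y Z) \<cdot>\<^bsub>W\<^esub> (FMult F (X \<odot>\<^bsub>V\<^esub> Y) Z \<cdot>\<^bsub>W\<^esub> (FMult F X Y \<otimes>\<^bsub>W\<^esub> \<one>\<^bsub>W\<^esub> (Fun0 F Z)))) \<cdot>\<^bsub>W\<^esub> ?t"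
    by (simp add: target.Comp_assoc_arr target.Comp_Tens1)
  also have "\<dots> = FMult F X (Y \<odot>\<^bsub>V\<^esub> Z) \<cdot>\<^bsub>W\<^esub> ((\<one>\<^bsub>W\<^esub> (Fun0 F X) \<otimes>\<^bsub>W\<^esub> FMult F Y Z)
      \<cdot>\<^bsub>W\<^esub> (Assoc W (Fun0 F X) (Fun0 F Y) (Fun0 F Z) \<cdot>\<^bsub>W\<^esub> ?t))"
    by (simp add: FMult_assoc target.Comp_assoc_arr)
  also have "Assoc W (Fun0 F X) (Fun0 F Y) (Fun0 F Z) \<cdot>\<^bsub>W\<^esub> ?t
      = (\<one>\<^bsub>W\<^esub> (Fun0 F X) \<otimes>\<^bsub>W\<^esub> (\<one>\<^bsub>W\<^esub> (Fun0 F Y) \<otimes>\<^bsub>W\<^esub> t)) \<cdot>\<^bsub>W\<^esub> Assoc W (Fun0 F X) (Fun0 F Y) (Dom W t)"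
    using target.Assoc_nat[of "\<one>\<^bsub>W\<^esub> (Fun0 F X)" "\<one>\<^bsub>W\<^esub> (Fun0 F Y)" t "Fun0 F X" "Fun0 F Y" "Fun0 F Z"] by simp
  finally show ?thesis by (simp add: target.Comp_Tens1_tail)
qed

text \<open>The point at which \<open>F\<close> being braided matters for monoids: the
  multiplication of a tensor product of monoids contains an interchange, and \<open>FMult F\<close>
  has to commute with it. Composition with the image of an associator leaves only shuffles.\<close>

lemma FMult_interchange:
  assumes [simp]: "A \<in> Obj V" "X \<in> Obj V" "Y \<in> Obj V" "Z \<in> Obj V"
  shows "Fun1 F (interchange V A X Y Z) \<cdot>\<^bsub>W\<^esub> (FMult F (A \<odot>\<^bsub>V\<^esub> X) (Y \<odot>\<^bsub>V\<^esub> Z) \<cdot>\<^bsub>W\<^esub> (FMult F A X \<otimes>\<^bsub>W\<^esub> FMult F Y Z))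
    = FMult F (A \<odot>\<^bsub>V\<^esub> Y) (X \<odot>\<^bsub>V\<^esub> Z) \<cdot>\<^bsub>W\<^esub> ((FMult F A Y \<otimes>\<^bsub>W\<^esub> FMult F X Z)
      \<cdot>\<^bsub>W\<^esub> interchange W (Fun0 F A) (Fun0 F X) (Fun0 F Y) (Fun0 F Z))"
    (is "?l = ?r")
proof (rule target.iso_cancel_left[of "Fun1 F (Assoc V A Y (X \<odot>\<^bsub>V\<^esub> Z))"])
  let ?a = "Fun1 F (Assoc V A Y (X \<odot>\<^bsub>V\<^esub> Z))"
  let ?A = "\<one>\<^bsub>W\<^esub> (Fun0 F A)"
  let ?n = "FMult F A (Y \<odot>\<^bsub>V\<^esub> (X \<odot>\<^bsub>V\<^esub> Z)) \<cdot>\<^bsub>W\<^esub> ((?A \<otimes>\<^bsub>W\<^esub> (FMult F Y (X \<odot>\<^bsub>V\<^esub> Z)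
      \<cdot>\<^bsub>W\<^esub> ((\<one>\<^bsub>W\<^esub> (Fun0 F Y) \<otimes>\<^bsub>W\<^esub> FMult F X Z) \<cdot>\<^bsub>W\<^esub> shuffle W (Fun0 F X) (Fun0 F Y) (Fun0 F Z))))
      \<cdot>\<^bsub>W\<^esub> Assoc W (Fun0 F A) (Fun0 F X) (Fun0 F Y \<odot>\<^bsub>W\<^esub> Fun0 F Z))"
  have "?a \<cdot>\<^bsub>W\<^esub> ?l = Fun1 F (\<one>\<^bsub>V\<^esub> A \<otimes>\<^bsub>V\<^esub> shuffle V X Y Z) \<cdot>\<^bsub>W\<^esub> (Fun1 F (Assoc V A X (Y \<odot>\<^bsub>V\<^esub> Z))
      \<cdot>\<^bsub>W\<^esub> (FMult F (A \<odot>\<^bsub>V\<^esub> X) (Y \<odot>\<^bsub>V\<^esub> Z) \<cdot>\<^bsub>W\<^esub> (FMult F A X \<otimes>\<^bsub>W\<^esub> FMult F Y Z)))"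
    by (simp add: Fun1_square_tail[OF source.Assoc_interchange])
  also have "\<dots> = Fun1 F (\<one>\<^bsub>V\<^esub> A \<otimes>\<^bsub>V\<^esub> shuffle V X Y Z) \<cdot>\<^bsub>W\<^esub> (FMult F A (X \<odot>\<^bsub>V\<^esub> (Y \<odot>\<^bsub>V\<^esub> Z))
      \<cdot>\<^bsub>W\<^esub> ((?A \<otimes>\<^bsub>W\<^esub> (FMult F X (Y \<odot>\<^bsub>V\<^esub> Z) \<cdot>\<^bsub>W\<^esub> (\<one>\<^bsub>W\<^esub> (Fun0 F X) \<otimes>\<^bsub>W\<^esub> FMult F Y Z)))
      \<cdot>\<^bsub>W\<^esub> Assoc W (Fun0 F A) (Fun0 F X) (Fun0 F Y \<odot>\<^bsub>W\<^esub> Fun0 F Z)))"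
    by (simp add: FMult_Assoc_tail)
  also have "\<dots> = FMult F A (Y \<odot>\<^bsub>V\<^esub> (X \<odot>\<^bsub>V\<^esub> Z)) \<cdot>\<^bsub>W\<^esub> ((?A \<otimes>\<^bsub>W\<^esub> Fun1 F (shuffle V X Y Z))
      \<cdot>\<^bsub>W\<^esub> ((?A \<otimes>\<^bsub>W\<^esub> (FMult F X (Y \<odot>\<^bsub>V\<^esub> Z) \<cdot>\<^bsub>W\<^esub> (\<one>\<^bsub>W\<^esub> (Fun0 F X) \<otimes>\<^bsub>W\<^esub> FMult F Y Z)))
      \<cdot>\<^bsub>W\<^esub> Assoc W (Fun0 F A) (Fun0 F X) (Fun0 F Y \<odot>\<^bsub>W\<^esub> Fun0 F Z)))"
    using FMult_nat_right[of "shuffle V X Y Z" A]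
    by (simp add: target.Comp_eq_tail[OF FMult_nat_right] target.Comp_assoc_arr)
  also have "\<dots> = ?n"
    by (simp add: target.Comp_Tens1_tail FMult_shuffle)
  finally have l: "?a \<cdot>\<^bsub>W\<^esub> ?l = ?n" .
  have "?a \<cdot>\<^bsub>W\<^esub> ?r = (?a \<cdot>\<^bsub>W\<^esub> (FMult F (A \<odot>\<^bsub>V\<^esub> Y) (X \<odot>\<^bsub>V\<^esub> Z) \<cdot>\<^bsub>W\<^esub> (FMult F A Y \<otimes>\<^bsub>W\<^esub> FMult F X Z)))
      \<cdot>\<^bsub>W\<^esub> interchange W (Fun0 F A) (Fun0 F X) (Fun0 F Y) (Fun0 F Z)"
    by (simp add: target.Comp_assoc_arr)
  also have "\<dots> = ?n"
    by (simp add: FMult_Assoc_tail target.Comp_assoc_arr target.Assoc_interchange target.Comp_Tens1_tail)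
  finally show "?a \<cdot>\<^bsub>W\<^esub> ?l = ?a \<cdot>\<^bsub>W\<^esub> ?r" using l by simp
qed auto

lemma monoid_morphism_FMult:
  assumes "monoid_in V M" "monoid_in V N"
  shows "monoid_morphism W (tensor_mon W (image_mon W F M) (image_mon W F N))
    (FMult F (Car M) (Car N)) (image_mon W F (tensor_mon V M N))"
proof -
  have [simp]: "Car M \<in> Obj V" "Mult M \<in> Arr V" "Dom V (Mult M) = Car M \<odot>\<^bsub>V\<^esub> Car M" "Cod V (Mult M) = Car M"
      "Unt M \<in> Arr V" "Dom V (Unt M) = \<I>\<^bsub>V\<^esub>" "Cod V (Unt M) = Car M"
      "Car N \<in> Obj V" "Mult N \<in> Arr V" "Dom V (Mult N) = Car N \<odot>\<^bsub>V\<^esub> Car N" "Cod V (Mult N) = Car N"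
      "Unt N \<in> Arr V" "Dom V (Unt N) = \<I>\<^bsub>V\<^esub>" "Cod V (Unt N) = Car N"
    using assms by (auto simp: monoid_in_def in_hom_iff)
  let ?X = "Car M" and ?Y = "Car N"
  let ?x = "Fun0 F ?X" and ?y = "Fun0 F ?Y"
  have "FMult F ?X ?Y \<cdot>\<^bsub>W\<^esub> (((Fun1 F (Mult M) \<cdot>\<^bsub>W\<^esub> FMult F ?X ?X) \<otimes>\<^bsub>W\<^esub> (Fun1 F (Mult N) \<cdot>\<^bsub>W\<^esub> FMult F ?Y ?Y))
        \<cdot>\<^bsub>W\<^esub> interchange W ?x ?y ?x ?y)
      = FMult F ?X ?Y \<cdot>\<^bsub>W\<^esub> ((Fun1 F (Mult M) \<otimes>\<^bsub>W\<^esub> Fun1 F (Mult N)) \<cdot>\<^bsub>W\<^esub> ((FMult F ?X ?X \<otimes>\<^bsub>W\<^esub> FMult F ?Y ?Y)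
        \<cdot>\<^bsub>W\<^esub> interchange W ?x ?y ?x ?y))"
    by (simp add: target.Comp_Tens1_tail)
  also have "\<dots> = Fun1 F (Mult M \<otimes>\<^bsub>V\<^esub> Mult N) \<cdot>\<^bsub>W\<^esub> (FMult F (?X \<odot>\<^bsub>V\<^esub> ?X) (?Y \<odot>\<^bsub>V\<^esub> ?Y)
        \<cdot>\<^bsub>W\<^esub> ((FMult F ?X ?X \<otimes>\<^bsub>W\<^esub> FMult F ?Y ?Y) \<cdot>\<^bsub>W\<^esub> interchange W ?x ?y ?x ?y))"
    by (simp add: target.Comp_eq_tail[OF FMult_nat] target.Comp_assoc_arr)
  also have "\<dots> = Fun1 F (Mult M \<otimes>\<^bsub>V\<^esub> Mult N) \<cdot>\<^bsub>W\<^esub> (Fun1 F (interchange V ?X ?Y ?X ?Y)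
        \<cdot>\<^bsub>W\<^esub> (FMult F (?X \<odot>\<^bsub>V\<^esub> ?Y) (?X \<odot>\<^bsub>V\<^esub> ?Y) \<cdot>\<^bsub>W\<^esub> (FMult F ?X ?Y \<otimes>\<^bsub>W\<^esub> FMult F ?X ?Y)))"
    by (simp add: FMult_interchange)
  finally have m: "FMult F ?X ?Y \<cdot>\<^bsub>W\<^esub> (((Fun1 F (Mult M) \<cdot>\<^bsub>W\<^esub> FMult F ?X ?X) \<otimes>\<^bsub>W\<^esub> (Fun1 F (Mult N) \<cdot>\<^bsub>W\<^esub> FMult F ?Y ?Y))
        \<cdot>\<^bsub>W\<^esub> interchange W ?x ?y ?x ?y) = \<dots>" .
  have "FMult F ?X ?Y \<cdot>\<^bsub>W\<^esub> (((Fun1 F (Unt M) \<cdot>\<^bsub>W\<^esub> FUnit F) \<otimes>\<^bsub>W\<^esub> (Fun1 F (Unt N) \<cdot>\<^bsub>W\<^esub> FUnit F))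
        \<cdot>\<^bsub>W\<^esub> inv_arr W (LUnit W \<I>\<^bsub>W\<^esub>))
      = FMult F ?X ?Y \<cdot>\<^bsub>W\<^esub> ((Fun1 F (Unt M) \<otimes>\<^bsub>W\<^esub> Fun1 F (Unt N)) \<cdot>\<^bsub>W\<^esub> ((FUnit F \<otimes>\<^bsub>W\<^esub> FUnit F)
        \<cdot>\<^bsub>W\<^esub> inv_arr W (LUnit W \<I>\<^bsub>W\<^esub>)))"
    by (simp add: target.Comp_Tens1_tail)
  also have "\<dots> = Fun1 F (Unt M \<otimes>\<^bsub>V\<^esub> Unt N) \<cdot>\<^bsub>W\<^esub> (FMult F \<I>\<^bsub>V\<^esub> \<I>\<^bsub>V\<^esub> \<cdot>\<^bsub>W\<^esub> ((FUnit F \<otimes>\<^bsub>W\<^esub> FUnit F)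
        \<cdot>\<^bsub>W\<^esub> inv_arr W (LUnit W \<I>\<^bsub>W\<^esub>)))"
    by (simp add: target.Comp_eq_tail[OF FMult_nat] target.Comp_assoc_arr)
  \<comment> \<open>The unit of a tensor monoid starts with an inverse unitor, so
    \<open>FUnit_FMult\<close> is needed with its unitors inverted.\<close>
  also have "FMult F \<I>\<^bsub>V\<^esub> \<I>\<^bsub>V\<^esub> \<cdot>\<^bsub>W\<^esub> ((FUnit F \<otimes>\<^bsub>W\<^esub> FUnit F) \<cdot>\<^bsub>W\<^esub> inv_arr W (LUnit W \<I>\<^bsub>W\<^esub>))
      = Fun1 F (inv_arr V (LUnit V \<I>\<^bsub>V\<^esub>)) \<cdot>\<^bsub>W\<^esub> FUnit F"
    using target.iso_square[OF FUnit_FMult] by (simp add: inv_arr_Fun1 target.Comp_assoc_arr)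
  finally show ?thesis
    using m by (simp add: monoid_morphism_def tensor_mon_def in_hom_iff Fun1_of_Comp target.Comp_assoc_arr)
qed

end

section \<open>The symmetric monoidal category of monoids\<close>

lemma monoid_inD:
  assumes "monoid_in V M"
  shows "Car M \<in> Obj V" "Mult M \<in> Arr V" "Dom V (Mult M) = Car M \<odot>\<^bsub>V\<^esub> Car M" "Cod V (Mult M) = Car M"
    "Unt M \<in> Arr V" "Dom V (Unt M) = \<I>\<^bsub>V\<^esub>" "Cod V (Unt M) = Car M"
    "Mult M \<cdot>\<^bsub>V\<^esub> (Mult M \<otimes>\<^bsub>V\<^esub> \<one>\<^bsub>V\<^esub> (Car M))
      = Mult M \<cdot>\<^bsub>V\<^esub> ((\<one>\<^bsub>V\<^esub> (Car M) \<otimes>\<^bsub>V\<^esub> Mult M) \<cdot>\<^bsub>V\<^esub> Assoc V (Car M) (Car M) (Car M))"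
    "Mult M \<cdot>\<^bsub>V\<^esub> (Unt M \<otimes>\<^bsub>V\<^esub> \<one>\<^bsub>V\<^esub> (Car M)) = LUnit V (Car M)"
    "Mult M \<cdot>\<^bsub>V\<^esub> (\<one>\<^bsub>V\<^esub> (Car M) \<otimes>\<^bsub>V\<^esub> Unt M) = RUnit V (Car M)"
  using assms by (auto simp: monoid_in_def in_hom_iff)

lemma monoid_morphismD:
  assumes "monoid_morphism V A f B"
  shows "f \<in> Arr V" "Dom V f = Car A" "Cod V f = Car B"
    "f \<cdot>\<^bsub>V\<^esub> Mult A = Mult B \<cdot>\<^bsub>V\<^esub> (f \<otimes>\<^bsub>V\<^esub> f)" "f \<cdot>\<^bsub>V\<^esub> Unt A = Unt B"
  using assms by (auto simp: monoid_morphism_def in_hom_iff)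

lemma monoid_morphismI:
  assumes "f \<in> Arr V" "Dom V f = Car A" "Cod V f = Car B"
    "f \<cdot>\<^bsub>V\<^esub> Mult A = Mult B \<cdot>\<^bsub>V\<^esub> (f \<otimes>\<^bsub>V\<^esub> f)" "f \<cdot>\<^bsub>V\<^esub> Unt A = Unt B"
  shows "monoid_morphism V A f B"
  using assms by (auto simp: monoid_morphism_def in_hom_iff)

lemma Mon_simps [simp]:
  "Obj (Mon V) = {A. monoid_in V A}"
  "(A, f, B) \<in> Arr (Mon V) \<longleftrightarrow> monoid_in V A \<and> monoid_in V B \<and> monoid_morphism V A f B"
  "Dom (Mon V) p = fst p" "Cod (Mon V) p = snd (snd p)"
  "Ident (Mon V) A = (A, \<one>\<^bsub>V\<^esub> (Car A), A)"
  "Comp (Mon V) q p = (fst p, underlying q \<cdot>\<^bsub>V\<^esub> underlying p, snd (snd q))"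
  "Tens0 (Mon V) = tensor_mon V"
  "Tens1 (Mon V) p q = (tensor_mon V (fst p) (fst q), underlying p \<otimes>\<^bsub>V\<^esub> underlying q,
     tensor_mon V (snd (snd p)) (snd (snd q)))"
  "TUnit (Mon V) = unit_mon V"
  "Assoc (Mon V) A B C = (tensor_mon V (tensor_mon V A B) C, Assoc V (Car A) (Car B) (Car C),
     tensor_mon V A (tensor_mon V B C))"
  "LUnit (Mon V) A = (tensor_mon V (unit_mon V) A, LUnit V (Car A), A)"
  "RUnit (Mon V) A = (tensor_mon V A (unit_mon V), RUnit V (Car A), A)"
  "Braid (Mon V) A B = (tensor_mon V A B, Braid V (Car A) (Car B), tensor_mon V B A)"
  by (simp_all add: Mon_def split_beta)

lemma in_hom_Mon_iff:
  "p \<in> hom (Mon V) A B \<longleftrightarrow> (\<exists>f. p = (A, f, B) \<and> monoid_in V A \<and> monoid_in V B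
     \<and> monoid_morphism V A f B \<and> f \<in> Arr V \<and> Dom V f = Car A \<and> Cod V f = Car B)"
  by (cases p) (auto simp: in_hom_iff dest: monoid_morphismD)

lemma tensor_mon_simps [simp]:
  "Car (tensor_mon V A B) = Car A \<odot>\<^bsub>V\<^esub> Car B"
  "Mult (tensor_mon V A B) = (Mult A \<otimes>\<^bsub>V\<^esub> Mult B) \<cdot>\<^bsub>V\<^esub> interchange V (Car A) (Car B) (Car A) (Car B)"
  "Unt (tensor_mon V A B) = (Unt A \<otimes>\<^bsub>V\<^esub> Unt B) \<cdot>\<^bsub>V\<^esub> inv_arr V (LUnit V \<I>\<^bsub>V\<^esub>)"
  by (simp_all add: tensor_mon_def)

lemma unit_mon_simps [simp]:
  "Car (unit_mon V) = \<I>\<^bsub>V\<^esub>" "Mult (unit_mon V) = LUnit V \<I>\<^bsub>V\<^esub>" "Unt (unit_mon V) = \<one>\<^bsub>V\<^esub> \<I>\<^bsub>V\<^esub>"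
  by (simp_all add: unit_mon_def)

text \<open>Monoids in a product category are pairs of monoids. Packing the pair as one record lets
  \<open>image_mon\<close> treat functors of two variables.\<close>

definition pair_mon :: "('o, 'a) mon_obj \<Rightarrow> ('p, 'b) mon_obj \<Rightarrow> ('o \<times> 'p, 'a \<times> 'b) mon_obj"
  where "pair_mon A B = \<lparr>Car = (Car A, Car B), Mult = (Mult A, Mult B), Unt = (Unt A, Unt B)\<rparr>"

lemma pair_mon_simps [simp]:
  "Car (pair_mon A B) = (Car A, Car B)" "Mult (pair_mon A B) = (Mult A, Mult B)"
  "Unt (pair_mon A B) = (Unt A, Unt B)"
  by (simp_all add: pair_mon_def)

lemma monoid_in_pair_mon:
  "monoid_in V A \<Longrightarrow> monoid_in W B \<Longrightarrow> monoid_in (prod_cat V W) (pair_mon A B)"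
  by (simp add: monoid_in_def in_hom_iff)

lemma monoid_morphism_pair_mon:
  "monoid_morphism V A f B \<Longrightarrow> monoid_morphism W A' f' B'
    \<Longrightarrow> monoid_morphism (prod_cat V W) (pair_mon A A') (f, f') (pair_mon B B')"
  by (simp add: monoid_morphism_def in_hom_iff)

text \<open>With this functor, closure of monoids and of their morphisms under tensor products
  becomes an instance of the general facts on lax monoidal functors.\<close>

definition tensor_functor :: "('o, 'a, 'z) moncat_scheme \<Rightarrow> ('o \<times> 'o, 'a \<times> 'a, 'o, 'a) lax_func"
  where "tensor_functor V =
    \<lparr>Fun0 = (\<lambda>x. fst x \<odot>\<^bsub>V\<^esub> snd x), Fun1 = (\<lambda>p. fst p \<otimes>\<^bsub>V\<^esub> snd p),
     FMult = (\<lambda>x y. interchange V (fst x) (snd x) (fst y) (snd y)),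
     FUnit = inv_arr V (LUnit V \<I>\<^bsub>V\<^esub>)\<rparr>"

lemma tensor_mon_image: "tensor_mon V A B = image_mon V (tensor_functor V) (pair_mon A B)"
  by (simp add: tensor_mon_def image_mon_def tensor_functor_def)

context monoidal_category
begin

lemma monoid_in_unit_mon: "monoid_in V (unit_mon V)"
  by (simp add: monoid_in_def in_hom_iff triangle LUnit_TUnit[symmetric])

lemma monoid_morphism_Ident: "monoid_in V A \<Longrightarrow> monoid_morphism V A (\<one> (Car A)) A"
  by (simp add: monoid_morphism_def in_hom_iff monoid_inD)

lemma monoid_morphism_Comp:
  assumes f: "monoid_morphism V A f B" and g: "monoid_morphism V B g C"
    and [simp]: "monoid_in V A" "monoid_in V B" "monoid_in V C"
  shows "monoid_morphism V A (g \<cdot> f) C"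
proof -
  note [simp] = monoid_inD(1-7) monoid_morphismD(1-3)[OF f] monoid_morphismD(1-3)[OF g]
  show ?thesis
    by (simp add: monoid_morphism_def in_hom_iff Comp_assoc_arr monoid_morphismD(4,5)[OF f]
        monoid_morphismD(5)[OF g] Comp_eq_tail[OF monoid_morphismD(4)[OF g]] Comp_Tens1)
qed

text \<open>Hence a structure map of \<open>Mon V\<close> is invertible as soon as its underlying
  arrow is.\<close>

lemma monoid_morphism_inv_arr:
  assumes f: "monoid_morphism V A f B" and [simp]: "is_iso V f" "monoid_in V A" "monoid_in V B"
  shows "monoid_morphism V B (inv_arr V f) A"
proof -
  note [simp] = monoid_inD(1-7) monoid_morphismD(1-3)[OF f]
  have "f \<cdot> (inv_arr V f \<cdot> Mult B) = f \<cdot> (Mult A \<cdot> (inv_arr V f \<otimes> inv_arr V f))"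
    by (simp add: Comp_eq_tail[OF monoid_morphismD(4)[OF f]] Comp_assoc_arr Comp_Tens1)
  then have "inv_arr V f \<cdot> Mult B = Mult A \<cdot> (inv_arr V f \<otimes> inv_arr V f)"
    by (rule iso_cancel_left[rotated]) auto
  moreover have "inv_arr V f \<cdot> Unt B = Unt A"
    by (simp add: monoid_morphismD(5)[OF f, symmetric])
  ultimately show ?thesis
    by (simp add: monoid_morphism_def in_hom_iff)
qed

lemma category_Mon: "category (Mon V)"
  by unfold_locales
    (auto simp: in_hom_Mon_iff Comp_assoc_arr monoid_inD(1) intro: monoid_morphism_Ident monoid_morphism_Comp)

lemma is_inverse_Mon:
  assumes "monoid_morphism V A f B" "is_iso V f" "monoid_in V A" "monoid_in V B"
  shows "is_inverse (Mon V) (A, f, B) (B, inv_arr V f, A)"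
  using assms monoid_morphismD[OF assms(1)]
  by (auto simp: is_inverse_def in_hom_Mon_iff intro: monoid_morphism_inv_arr)

lemma is_iso_Mon:
  assumes "monoid_morphism V A f B" "is_iso V f" "monoid_in V A" "monoid_in V B"
  shows "is_iso (Mon V) (A, f, B)"
  using assms by (intro category.is_isoI[OF category_Mon _ is_inverse_Mon]) auto

lemma inv_arr_Mon:
  assumes "monoid_morphism V A f B" "is_iso V f" "monoid_in V A" "monoid_in V B"
  shows "inv_arr (Mon V) (A, f, B) = (B, inv_arr V f, A)"
  using assms by (intro category.inv_arr_eqI[OF category_Mon _ is_inverse_Mon]) auto

end

context symmetric_monoidal_category
begin

lemma Braid_TUnit: "Braid V \<I> \<I> = \<one> (\<I> \<odot> \<I>)"
  by (rule iso_cancel_left[of "LUnit V \<I>"]) (auto simp: LUnit_Braid LUnit_TUnit[symmetric])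

text \<open>\<open>interchange_Assoc\<close> with all interchanges inverted, by composing with the
  invertible \<open>?t\<close>. This direction occurs in multiplications of monoids and in
  evaluations of the internal hom. The two unit laws are inverted likewise below.\<close>

lemma Assoc_interchange_Tens:
  assumes [simp]: "a \<in> Obj V" "b \<in> Obj V" "c \<in> Obj V" "x \<in> Obj V" "y \<in> Obj V" "z \<in> Obj V"
  shows "Assoc V (a \<odot> x) (b \<odot> y) (c \<odot> z)
      \<cdot> ((interchange V a b x y \<otimes> \<one> (c \<odot> z)) \<cdot> interchange V (a \<odot> b) c (x \<odot> y) z)
    = (\<one> (a \<odot> x) \<otimes> interchange V b c y z) \<cdot> (interchange V a (b \<odot> c) x (y \<odot> z)
      \<cdot> (Assoc V a b c \<otimes> Assoc V x y z))"
    (is "?l = ?r")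
proof (rule iso_cancel_right)
  let ?t = "interchange V (a \<odot> b) (x \<odot> y) c z \<cdot> (interchange V a x b y \<otimes> \<one> (c \<odot> z))"
  show "?l \<cdot> ?t = ?r \<cdot> ?t"
    by (simp add: Comp_assoc_arr Comp_Tens1 interchange_Assoc Comp_eq_tail[OF interchange_involution] Comp_Tens1_tail)
qed auto

lemma LUnit_Tens1_LUnit:
  assumes [simp]: "X \<in> Obj V" "Y \<in> Obj V"
  shows "LUnit V X \<otimes> LUnit V Y = LUnit V (X \<odot> Y) \<cdot> ((LUnit V \<I> \<otimes> \<one> (X \<odot> Y)) \<cdot> interchange V \<I> X \<I> Y)"
proof -
  let ?t = "(LUnit V \<I> \<otimes> \<one> (X \<odot> Y)) \<cdot> interchange V \<I> X \<I> Y"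
  have "LUnit V X \<otimes> LUnit V Y = (LUnit V X \<otimes> LUnit V Y)
      \<cdot> ((interchange V \<I> \<I> X Y \<cdot> (inv_arr V (LUnit V \<I>) \<otimes> \<one> (X \<odot> Y))) \<cdot> ?t)"
    by (simp add: Comp_assoc_arr Comp_Tens1_tail)
  then show ?thesis
    using Comp_eq_tail[OF interchange_LUnit[of X Y], of ?t] by simp
qed

lemma RUnit_Tens1_RUnit:
  assumes [simp]: "X \<in> Obj V" "Y \<in> Obj V"
  shows "RUnit V X \<otimes> RUnit V Y = RUnit V (X \<odot> Y) \<cdot> ((\<one> (X \<odot> Y) \<otimes> LUnit V \<I>) \<cdot> interchange V X \<I> Y \<I>)"
proof -
  let ?t = "(\<one> (X \<odot> Y) \<otimes> LUnit V \<I>) \<cdot> interchange V X \<I> Y \<I>"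
  have "RUnit V X \<otimes> RUnit V Y = (RUnit V X \<otimes> RUnit V Y)
      \<cdot> ((interchange V X Y \<I> \<I> \<cdot> (\<one> (X \<odot> Y) \<otimes> inv_arr V (LUnit V \<I>))) \<cdot> ?t)"
    by (simp add: Comp_assoc_arr Comp_Tens1_tail)
  then show ?thesis
    using Comp_eq_tail[OF interchange_RUnit[of X Y], of ?t] by simp
qed

lemma tensor_functor_lax: "lax_monoidal_functor (prod_cat V V) V (tensor_functor V)"
proof -
  interpret VV: monoidal_category "prod_cat V V"
    by (rule monoidal_category_prod_cat) unfold_locales
  show ?thesis
    by unfold_locales
      (auto simp: tensor_functor_def in_hom_iff Comp_Tens1 interchange_nat interchange_Assoc
        interchange_LUnit interchange_RUnit)
qed

lemma monoid_in_tensor_mon: "monoid_in V A \<Longrightarrow> monoid_in V B \<Longrightarrow> monoid_in V (tensor_mon V A B)"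
  unfolding tensor_mon_image
  by (intro lax_monoidal_functor.monoid_in_image_mon[OF tensor_functor_lax] monoid_in_pair_mon)

lemma monoid_morphism_Tens1:
  assumes "monoid_morphism V A f B" "monoid_morphism V A' f' B'"
    "monoid_in V A" "monoid_in V B" "monoid_in V A'" "monoid_in V B'"
  shows "monoid_morphism V (tensor_mon V A A') (f \<otimes> f') (tensor_mon V B B')"
  using lax_monoidal_functor.monoid_morphism_image_mon[OF tensor_functor_lax
      monoid_morphism_pair_mon[OF assms(1,2)] monoid_in_pair_mon[OF assms(3,5)]
      monoid_in_pair_mon[OF assms(4,6)]]
  by (simp add: tensor_mon_image tensor_functor_def)

lemma monoid_morphism_Assoc:
  assumes [simp]: "monoid_in V A" "monoid_in V B" "monoid_in V C"
  shows "monoid_morphism V (tensor_mon V (tensor_mon V A B) C) (Assoc V (Car A) (Car B) (Car C))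
    (tensor_mon V A (tensor_mon V B C))"
proof (rule monoid_morphismI)
  note [simp] = monoid_inD(1-7)
  let ?a = "Car A" and ?b = "Car B" and ?c = "Car C"
  have "Assoc V ?a ?b ?c \<cdot> Mult (tensor_mon V (tensor_mon V A B) C)
      = Assoc V ?a ?b ?c \<cdot> (((Mult A \<otimes> Mult B) \<otimes> Mult C) \<cdot> ((interchange V ?a ?b ?a ?b \<otimes> \<one> (?c \<odot> ?c))
        \<cdot> interchange V (?a \<odot> ?b) ?c (?a \<odot> ?b) ?c))"
    by (simp add: Comp_Tens1_tail)
  also have "\<dots> = (Mult A \<otimes> (Mult B \<otimes> Mult C)) \<cdot> ((\<one> (?a \<odot> ?a) \<otimes> interchange V ?b ?c ?b ?c)
      \<cdot> (interchange V ?a (?b \<odot> ?c) ?a (?b \<odot> ?c) \<cdot> (Assoc V ?a ?b ?c \<otimes> Assoc V ?a ?b ?c)))"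
    by (simp add: Assoc_nat_tail Assoc_interchange_Tens)
  also have "\<dots> = Mult (tensor_mon V A (tensor_mon V B C)) \<cdot> (Assoc V ?a ?b ?c \<otimes> Assoc V ?a ?b ?c)"
    by (simp add: Comp_Tens1_tail Comp_assoc_arr)
  finally show "Assoc V ?a ?b ?c \<cdot> Mult (tensor_mon V (tensor_mon V A B) C) = \<dots>" .
  let ?i = "inv_arr V (LUnit V \<I>)"
  \<comment> \<open>The two ways of splitting the unit into three factors agree, up to the
    associator.\<close>
  have i: "Assoc V \<I> \<I> \<I> \<cdot> (?i \<otimes> \<one> \<I>) = \<one> \<I> \<otimes> ?i"
    by (rule iso_cancel_left[of "\<one> \<I> \<otimes> LUnit V \<I>"])
      (auto simp: Comp_eq_tail[OF triangle] Comp_Tens1 LUnit_TUnit[symmetric])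
  have "Assoc V ?a ?b ?c \<cdot> Unt (tensor_mon V (tensor_mon V A B) C)
      = Assoc V ?a ?b ?c \<cdot> (((Unt A \<otimes> Unt B) \<otimes> Unt C) \<cdot> ((?i \<otimes> \<one> \<I>) \<cdot> ?i))"
    by (simp add: Comp_Tens1_tail)
  also have "\<dots> = (Unt A \<otimes> (Unt B \<otimes> Unt C)) \<cdot> (Assoc V \<I> \<I> \<I> \<cdot> ((?i \<otimes> \<one> \<I>) \<cdot> ?i))"
    by (simp add: Assoc_nat_tail)
  also have "\<dots> = Unt (tensor_mon V A (tensor_mon V B C))"
    by (simp add: Comp_eq_tail[OF i] Comp_Tens1_tail)
  finally show "Assoc V ?a ?b ?c \<cdot> Unt (tensor_mon V (tensor_mon V A B) C)
      = Unt (tensor_mon V A (tensor_mon V B C))" .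
qed (auto simp: monoid_inD)

lemma monoid_morphism_LUnit:
  assumes [simp]: "monoid_in V A"
  shows "monoid_morphism V (tensor_mon V (unit_mon V) A) (LUnit V (Car A)) A"
proof (rule monoid_morphismI)
  note [simp] = monoid_inD(1-7)
  let ?a = "Car A"
  have "Mult A \<cdot> (LUnit V ?a \<otimes> LUnit V ?a)
      = LUnit V ?a \<cdot> ((\<one> \<I> \<otimes> Mult A) \<cdot> ((LUnit V \<I> \<otimes> \<one> (?a \<odot> ?a)) \<cdot> interchange V \<I> ?a \<I> ?a))"
    by (simp add: Comp_eq_tail[OF LUnit_nat] Comp_assoc_arr LUnit_Tens1_LUnit)
  then show "LUnit V ?a \<cdot> Mult (tensor_mon V (unit_mon V) A) = Mult A \<cdot> (LUnit V ?a \<otimes> LUnit V ?a)"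
    by (simp add: Comp_Tens1_tail)
  show "LUnit V ?a \<cdot> Unt (tensor_mon V (unit_mon V) A) = Unt A"
    by (simp add: Comp_eq_tail[OF LUnit_nat] Comp_assoc_arr)
qed (auto simp: monoid_inD)

lemma monoid_morphism_RUnit:
  assumes [simp]: "monoid_in V A"
  shows "monoid_morphism V (tensor_mon V A (unit_mon V)) (RUnit V (Car A)) A"
proof (rule monoid_morphismI)
  note [simp] = monoid_inD(1-7)
  let ?a = "Car A"
  have "Mult A \<cdot> (RUnit V ?a \<otimes> RUnit V ?a)
      = RUnit V ?a \<cdot> ((Mult A \<otimes> \<one> \<I>) \<cdot> ((\<one> (?a \<odot> ?a) \<otimes> LUnit V \<I>) \<cdot> interchange V ?a \<I> ?a \<I>))"
    by (simp add: Comp_eq_tail[OF RUnit_nat] Comp_assoc_arr RUnit_Tens1_RUnit)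
  then show "RUnit V ?a \<cdot> Mult (tensor_mon V A (unit_mon V)) = Mult A \<cdot> (RUnit V ?a \<otimes> RUnit V ?a)"
    by (simp add: Comp_Tens1_tail)
  show "RUnit V ?a \<cdot> Unt (tensor_mon V A (unit_mon V)) = Unt A"
    by (simp add: Comp_eq_tail[OF RUnit_nat] Comp_assoc_arr LUnit_TUnit)
qed (auto simp: monoid_inD)

lemma monoid_morphism_Braid:
  assumes [simp]: "monoid_in V A" "monoid_in V B"
  shows "monoid_morphism V (tensor_mon V A B) (Braid V (Car A) (Car B)) (tensor_mon V B A)"
proof (rule monoid_morphismI)
  note [simp] = monoid_inD(1-7)
  show "Braid V (Car A) (Car B) \<cdot> Mult (tensor_mon V A B)
      = Mult (tensor_mon V B A) \<cdot> (Braid V (Car A) (Car B) \<otimes> Braid V (Car A) (Car B))"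
    by (simp add: Comp_eq_tail[OF Braid_nat] Comp_assoc_arr interchange_Braid)
  show "Braid V (Car A) (Car B) \<cdot> Unt (tensor_mon V A B) = Unt (tensor_mon V B A)"
    by (simp add: Comp_eq_tail[OF Braid_nat] Comp_assoc_arr Braid_TUnit)
qed (auto simp: monoid_inD)

text \<open>Arrows with given ends are equal when their underlying arrows are, so every equation is
  inherited from \<open>V\<close>. The content is that the structure maps are monoid
  morphisms.\<close>

theorem symmetric_monoidal_category_Mon: "symmetric_monoidal_category (Mon V)"
proof -
  interpret M: category "Mon V" by (rule category_Mon)
  note intros = monoid_in_tensor_mon monoid_in_unit_mon monoid_morphism_Ident monoid_morphism_Comp
    monoid_morphism_Tens1 monoid_morphism_Assoc monoid_morphism_LUnit monoid_morphism_RUnit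
    monoid_morphism_Braid
  show ?thesis
    by unfold_locales
      (auto simp: in_hom_Mon_iff monoid_inD(1) Comp_Tens1 Assoc_nat LUnit_nat RUnit_nat pentagon triangle
        Braid_nat hexagon1 hexagon2 inv_arr_Mon intros intro: intros is_iso_Mon)
qed

lemma symmetric_monoidal_category_Comon: "symmetric_monoidal_category (Comon V)"
proof -
  interpret op: symmetric_monoidal_category "opp V" by (rule symmetric_monoidal_category_opp)
  interpret M: symmetric_monoidal_category "Mon (opp V)" by (rule op.symmetric_monoidal_category_Mon)
  show ?thesis
    unfolding Comon_def by (rule M.symmetric_monoidal_category_opp)
qed

end

section \<open>The internal hom as a braided lax monoidal functor\<close>

definition ihom_functor :: "('o, 'a, 'z) closed_moncat_scheme \<Rightarrow> ('o \<times> 'o, 'a \<times> 'a, 'o, 'a) lax_func"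
  where "ihom_functor V =
    \<lparr>Fun0 = (\<lambda>x. IHom V (fst x) (snd x)), Fun1 = (\<lambda>p. ihom_map V (fst p) (snd p)),
     FMult = (\<lambda>x y. ihom_mult V (fst x) (snd x) (fst y) (snd y)), FUnit = ihom_unit V\<rparr>"

lemma conv_image: "conv V C B = image_mon V (ihom_functor V) (pair_mon C B)"
  by (simp add: conv_def image_mon_def ihom_functor_def)

context symmetric_monoidal_closed_category
begin

lemma IHom_Obj [simp]: "X \<in> Obj V \<Longrightarrow> Y \<in> Obj V \<Longrightarrow> IHom V X Y \<in> Obj V"
  by (rule IHom_in_Obj)

lemma Ev_typing [simp]:
  assumes "X \<in> Obj V" "Y \<in> Obj V"
  shows "Ev V X Y \<in> Arr V" "Dom V (Ev V X Y) = IHom V X Y \<odot> X" "Cod V (Ev V X Y) = Y"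
  using Ev_in_hom[OF assms] by (simp_all add: in_hom_iff)

lemma transpose_in_hom:
  assumes "X \<in> Obj V" "Z \<in> Obj V" "f \<in> Arr V" "Dom V f = Z \<odot> X" "Cod V f = Y"
  shows "transpose V Z X Y f \<in> hom V Z (IHom V X Y) \<and> Ev V X Y \<cdot> (transpose V Z X Y f \<otimes> \<one> X) = f"
  unfolding transpose_def by (rule theI', rule Ev_universal) (use assms in \<open>auto simp: in_hom_iff\<close>)

lemma transpose_typing [simp]:
  assumes "X \<in> Obj V" "Z \<in> Obj V" "f \<in> Arr V" "Dom V f = Z \<odot> X" "Cod V f = Y"
  shows "transpose V Z X Y f \<in> Arr V" "Dom V (transpose V Z X Y f) = Z"
    "Cod V (transpose V Z X Y f) = IHom V X Y"
  using transpose_in_hom[OF assms] by (simp_all add: in_hom_iff)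

text \<open>The extra arrows \<open>k\<close> and \<open>h\<close> let one rewrite evaluate a
  transpose in the middle of a composite. The evaluation rules for \<open>ihom_map\<close> and
  \<open>ihom_mult\<close> below follow from it.\<close>

lemma Ev_transpose:
  assumes "X \<in> Obj V" "Z \<in> Obj V" "f \<in> Arr V" "Dom V f = Z \<odot> X" "Cod V f = Y"
    and "k \<in> Arr V" "Cod V k = Z" "h \<in> Arr V" "Cod V h = X"
  shows "Ev V X Y \<cdot> ((transpose V Z X Y f \<cdot> k) \<otimes> h) = f \<cdot> (k \<otimes> h)"
proof -
  have [simp]: "Y \<in> Obj V" using assms by auto
  have "Ev V X Y \<cdot> ((transpose V Z X Y f \<cdot> k) \<otimes> h) = (Ev V X Y \<cdot> (transpose V Z X Y f \<otimes> \<one> X)) \<cdot> (k \<otimes> h)"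
    using assms by (simp add: Comp_assoc_arr Comp_Tens1)
  also have "Ev V X Y \<cdot> (transpose V Z X Y f \<otimes> \<one> X) = f"
    using transpose_in_hom[OF assms(1-5)] by simp
  finally show ?thesis .
qed

text \<open>Testing on an isomorphism \<open>k\<close> instead of the identity of \<open>X\<close>
  pays off for arrows such as \<open>[k, g]\<close> with \<open>k\<close> an inverse structure map:
  evaluated on the structure map itself, the inverse disappears.\<close>

lemma ihom_eqI:
  assumes "Ev V X Y \<cdot> (g \<otimes> k) = Ev V X Y \<cdot> (h \<otimes> k)" "is_iso V k" "Cod V k = X" "Y \<in> Obj V"
    "g \<in> Arr V" "h \<in> Arr V" "Dom V g = Dom V h" "Cod V g = IHom V X Y" "Cod V h = IHom V X Y"
  shows "g = h"
proof -
  have k [simp]: "k \<in> Arr V" "X \<in> Obj V" using assms(2,3) iso_Arr[of k] by auto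
  have "Ev V X Y \<cdot> (g \<otimes> \<one> X) = Ev V X Y \<cdot> (h \<otimes> \<one> X)"
    by (rule iso_cancel_right[of "\<one> (Dom V h) \<otimes> k"]) (use assms in \<open>auto simp: Comp_assoc_arr Comp_Tens1\<close>)
  moreover have "\<exists>!u. u \<in> hom V (Dom V g) (IHom V X Y) \<and> Ev V X Y \<cdot> (u \<otimes> \<one> X) = Ev V X Y \<cdot> (h \<otimes> \<one> X)"
    by (rule Ev_universal) (use assms in \<open>auto simp: in_hom_iff\<close>)
  ultimately show ?thesis
    using assms by (auto simp: in_hom_iff)
qed

lemma ihom_map_typing [simp]:
  assumes "f \<in> Arr V" "g \<in> Arr V"
  shows "ihom_map V f g \<in> Arr V" "Dom V (ihom_map V f g) = IHom V (Cod V f) (Dom V g)"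
    "Cod V (ihom_map V f g) = IHom V (Dom V f) (Cod V g)"
  using assms by (simp_all add: ihom_map_def Let_def)

lemma Ev_ihom_map_Comp:
  assumes "f \<in> Arr V" "g \<in> Arr V" "Dom V f = X" "Cod V g = Y"
    "k \<in> Arr V" "Cod V k = IHom V (Cod V f) (Dom V g)" "h \<in> Arr V" "Cod V h = X"
  shows "Ev V X Y \<cdot> ((ihom_map V f g \<cdot> k) \<otimes> h) = g \<cdot> (Ev V (Cod V f) (Dom V g) \<cdot> (k \<otimes> (f \<cdot> h)))"
  using assms by (auto simp: ihom_map_def Let_def Ev_transpose Comp_assoc_arr Comp_Tens1)

lemma Ev_ihom_map:
  assumes "f \<in> Arr V" "g \<in> Arr V" "Dom V f = X" "Cod V g = Y" "h \<in> Arr V" "Cod V h = X"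
  shows "Ev V X Y \<cdot> (ihom_map V f g \<otimes> h)
    = g \<cdot> (Ev V (Cod V f) (Dom V g) \<cdot> (\<one> (IHom V (Cod V f) (Dom V g)) \<otimes> (f \<cdot> h)))"
  using assms Ev_ihom_map_Comp[of f g X Y "\<one> (IHom V (Cod V f) (Dom V g))" h] by auto

lemma ihom_mult_typing [simp]:
  assumes "X \<in> Obj V" "Y \<in> Obj V" "X' \<in> Obj V" "Y' \<in> Obj V"
  shows "ihom_mult V X Y X' Y' \<in> Arr V"
    "Dom V (ihom_mult V X Y X' Y') = IHom V X Y \<odot> IHom V X' Y'"
    "Cod V (ihom_mult V X Y X' Y') = IHom V (X \<odot> X') (Y \<odot> Y')"
  using assms by (simp_all add: ihom_mult_def)

lemma Ev_ihom_mult_Comp: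
  assumes "X \<in> Obj V" "Y \<in> Obj V" "X' \<in> Obj V" "Y' \<in> Obj V"
    "k \<in> Arr V" "Cod V k = IHom V X Y \<odot> IHom V X' Y'" "h \<in> Arr V" "Cod V h = X \<odot> X'"
  shows "Ev V (X \<odot> X') (Y \<odot> Y') \<cdot> ((ihom_mult V X Y X' Y' \<cdot> k) \<otimes> h)
    = (Ev V X Y \<otimes> Ev V X' Y') \<cdot> (interchange V (IHom V X Y) (IHom V X' Y') X X' \<cdot> (k \<otimes> h))"
  using assms by (simp add: ihom_mult_def Ev_transpose Comp_assoc_arr)

lemma Ev_ihom_mult:
  assumes "X \<in> Obj V" "Y \<in> Obj V" "X' \<in> Obj V" "Y' \<in> Obj V" "h \<in> Arr V" "Cod V h = X \<odot> X'"
  shows "Ev V (X \<odot> X') (Y \<odot> Y') \<cdot> (ihom_mult V X Y X' Y' \<otimes> h)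
    = (Ev V X Y \<otimes> Ev V X' Y') \<cdot> (interchange V (IHom V X Y) (IHom V X' Y') X X'
      \<cdot> (\<one> (IHom V X Y \<odot> IHom V X' Y') \<otimes> h))"
  using assms Ev_ihom_mult_Comp[of X Y X' Y' "\<one> (IHom V X Y \<odot> IHom V X' Y')" h] by simp

lemma ihom_unit_typing [simp]:
  "ihom_unit V \<in> Arr V" "Dom V (ihom_unit V) = \<I>" "Cod V (ihom_unit V) = IHom V \<I> \<I>"
  by (simp_all add: ihom_unit_def)

lemma Ev_ihom_unit: "Ev V \<I> \<I> \<cdot> (ihom_unit V \<otimes> \<one> \<I>) = LUnit V \<I>"
  using Ev_transpose[of \<I> \<I> "LUnit V \<I>" \<I> "\<one> \<I>" "\<one> \<I>"] by (simp add: ihom_unit_def)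

lemma ihom_map_Ident [simp]:
  assumes [simp]: "X \<in> Obj V" "Y \<in> Obj V"
  shows "ihom_map V (\<one> X) (\<one> Y) = \<one> (IHom V X Y)"
  by (rule ihom_eqI[of X Y _ "\<one> X"]) (auto simp: Ev_ihom_map)

lemma ihom_map_Comp:
  assumes "f \<in> Arr V" "g \<in> Arr V" "f' \<in> Arr V" "g' \<in> Arr V" "Dom V f = Cod V f'" "Cod V g = Dom V g'"
  shows "ihom_map V f' g' \<cdot> ihom_map V f g = ihom_map V (f \<cdot> f') (g' \<cdot> g)"
  by (rule ihom_eqI[of "Dom V f'" "Cod V g'" _ "\<one> (Dom V f')"])
    (use assms in \<open>auto simp: Ev_ihom_map Ev_ihom_map_Comp Comp_assoc_arr\<close>)

section \<open>Laws of the internal hom, checked by evaluation\<close>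

lemma ihom_mult_nat:
  assumes [simp]: "f \<in> Arr V" "g \<in> Arr V" "f' \<in> Arr V" "g' \<in> Arr V"
    "Dom V f = X" "Cod V g = Y" "Dom V f' = X'" "Cod V g' = Y'"
  shows "ihom_mult V X Y X' Y' \<cdot> (ihom_map V f g \<otimes> ihom_map V f' g')
    = ihom_map V (f \<otimes> f') (g \<otimes> g') \<cdot> ihom_mult V (Cod V f) (Dom V g) (Cod V f') (Dom V g')"
    (is "?l = ?r")
proof (rule ihom_eqI)
  have [simp]: "X \<in> Obj V" "Y \<in> Obj V" "X' \<in> Obj V" "Y' \<in> Obj V"
    using Dom_Obj[of f] Cod_Obj[of g] Dom_Obj[of f'] Cod_Obj[of g'] by simp_all
  let ?H = "IHom V (Cod V f) (Dom V g)" and ?H' = "IHom V (Cod V f') (Dom V g')"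
  \<comment> \<open>The identity is written as a tensor because naturality of the interchange
    matches only four separate arrows.\<close>
  let ?k = "\<one> X \<otimes> \<one> X'"
  let ?n = "((g \<cdot> (Ev V (Cod V f) (Dom V g) \<cdot> (\<one> ?H \<otimes> f)))
      \<otimes> (g' \<cdot> (Ev V (Cod V f') (Dom V g') \<cdot> (\<one> ?H' \<otimes> f')))) \<cdot> interchange V ?H ?H' X X'"
  have "Ev V (X \<odot> X') (Y \<odot> Y') \<cdot> (?l \<otimes> ?k) = (Ev V X Y \<otimes> Ev V X' Y')
      \<cdot> (interchange V (IHom V X Y) (IHom V X' Y') X X' \<cdot> ((ihom_map V f g \<otimes> ihom_map V f' g') \<otimes> ?k))"
    by (subst Ev_ihom_mult_Comp) simp_all
  also have "\<dots> = ?n"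
    by (subst interchange_nat) (simp_all add: Comp_Tens1_tail Ev_ihom_map)
  also have "\<dots> = (g \<otimes> g') \<cdot> ((Ev V (Cod V f) (Dom V g) \<otimes> Ev V (Cod V f') (Dom V g'))
     \<cdot> (interchange V ?H ?H' (Cod V f) (Cod V f') \<cdot> ((\<one> ?H \<otimes> \<one> ?H') \<otimes> (f \<otimes> f'))))"
    by (simp add: interchange_nat Comp_Tens1_tail del: Tens1_Ident)
  also have "\<dots> = Ev V (X \<odot> X') (Y \<odot> Y') \<cdot> (?r \<otimes> ?k)"
    by (simp add: Ev_ihom_map_Comp Ev_ihom_mult)
  finally show "Ev V (X \<odot> X') (Y \<odot> Y') \<cdot> (?l \<otimes> ?k) = Ev V (X \<odot> X') (Y \<odot> Y') \<cdot> (?r \<otimes> ?k)" .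
qed (use Dom_Obj[of f] Cod_Obj[of g] Dom_Obj[of f'] Cod_Obj[of g'] in auto)

text \<open>The associator of \<open>opp V\<close> is inverse, whence the first argument of
  \<open>ihom_map\<close>. Evaluation on \<open>?a\<close> cancels it and leaves three evaluations
  after the two sides of \<open>Assoc_interchange_Tens\<close>. The unit laws are treated the same
  way, by evaluating on a unitor.\<close>

lemma ihom_mult_assoc:
  assumes [simp]: "X \<in> Obj V" "Y \<in> Obj V" "X' \<in> Obj V" "Y' \<in> Obj V" "X'' \<in> Obj V" "Y'' \<in> Obj V"
  shows "ihom_map V (inv_arr V (Assoc V X X' X'')) (Assoc V Y Y' Y'')
      \<cdot> (ihom_mult V (X \<odot> X') (Y \<odot> Y') X'' Y'' \<cdot> (ihom_mult V X Y X' Y' \<otimes> \<one> (IHom V X'' Y'')))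
    = ihom_mult V X Y (X' \<odot> X'') (Y' \<odot> Y'') \<cdot> ((\<one> (IHom V X Y) \<otimes> ihom_mult V X' Y' X'' Y'')
      \<cdot> Assoc V (IHom V X Y) (IHom V X' Y') (IHom V X'' Y''))"
    (is "?l = ?r")
proof (rule ihom_eqI)
  let ?H = "IHom V X Y" and ?H' = "IHom V X' Y'" and ?H'' = "IHom V X'' Y''"
  let ?e = "Ev V X Y" and ?e' = "Ev V X' Y'" and ?e'' = "Ev V X'' Y''"
  let ?a = "Assoc V X X' X''" and ?b = "Assoc V Y Y' Y''" and ?c = "Assoc V ?H ?H' ?H''"
  let ?E = "Ev V (X \<odot> (X' \<odot> X'')) (Y \<odot> (Y' \<odot> Y''))"
  have "?E \<cdot> (?l \<otimes> ?a) = ?b \<cdot> ((Ev V (X \<odot> X') (Y \<odot> Y') \<otimes> ?e'')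
      \<cdot> (interchange V (IHom V (X \<odot> X') (Y \<odot> Y')) ?H'' (X \<odot> X') X''
      \<cdot> ((ihom_mult V X Y X' Y' \<otimes> \<one> ?H'') \<otimes> (\<one> (X \<odot> X') \<otimes> \<one> X''))))"
    by (simp add: Ev_ihom_map_Comp Ev_ihom_mult_Comp)
  also have "\<dots> = ?b \<cdot> (((?e \<otimes> ?e') \<otimes> ?e'') \<cdot> ((interchange V ?H ?H' X X' \<otimes> \<one> (?H'' \<odot> X''))
      \<cdot> interchange V (?H \<odot> ?H') ?H'' (X \<odot> X') X''))"
    by (subst interchange_nat) (simp_all add: Comp_Tens1_tail Ev_ihom_mult)
  also have "\<dots> = (?e \<otimes> (?e' \<otimes> ?e'')) \<cdot> ((\<one> (?H \<odot> X) \<otimes> interchange V ?H' ?H'' X' X'')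
      \<cdot> (interchange V ?H (?H' \<odot> ?H'') X (X' \<odot> X'') \<cdot> (?c \<otimes> ?a)))"
    by (simp add: Assoc_nat_tail Assoc_interchange_Tens)
  also have "\<dots> = (?e \<otimes> Ev V (X' \<odot> X'') (Y' \<odot> Y'')) \<cdot> (((\<one> ?H \<otimes> \<one> X) \<otimes> (ihom_mult V X' Y' X'' Y'' \<otimes> \<one> (X' \<odot> X'')))
      \<cdot> (interchange V ?H (?H' \<odot> ?H'') X (X' \<odot> X'') \<cdot> (?c \<otimes> ?a)))"
    by (simp add: Comp_Tens1_tail Ev_ihom_mult)
  also have "\<dots> = (?e \<otimes> Ev V (X' \<odot> X'') (Y' \<odot> Y''))
      \<cdot> ((interchange V ?H (IHom V (X' \<odot> X'') (Y' \<odot> Y'')) X (X' \<odot> X'')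
      \<cdot> ((\<one> ?H \<otimes> ihom_mult V X' Y' X'' Y'') \<otimes> (\<one> X \<otimes> \<one> (X' \<odot> X'')))) \<cdot> (?c \<otimes> ?a))"
    by (subst interchange_nat) (simp_all add: Comp_assoc_arr)
  also have "\<dots> = ?E \<cdot> (?r \<otimes> ?a)"
    by (simp add: Ev_ihom_mult_Comp Comp_assoc_arr Comp_Tens1)
  finally show "?E \<cdot> (?l \<otimes> ?a) = ?E \<cdot> (?r \<otimes> ?a)" .
qed auto

lemma ihom_mult_left_unit:
  assumes [simp]: "X \<in> Obj V" "Y \<in> Obj V"
  shows "ihom_map V (inv_arr V (LUnit V X)) (LUnit V Y)
    \<cdot> (ihom_mult V \<I> \<I> X Y \<cdot> (ihom_unit V \<otimes> \<one> (IHom V X Y))) = LUnit V (IHom V X Y)"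
    (is "?l = ?r")
proof (rule ihom_eqI)
  let ?H = "IHom V X Y"
  have "Ev V X Y \<cdot> (?l \<otimes> LUnit V X) = LUnit V Y \<cdot> ((Ev V \<I> \<I> \<otimes> Ev V X Y)
      \<cdot> (interchange V (IHom V \<I> \<I>) ?H \<I> X \<cdot> ((ihom_unit V \<otimes> \<one> ?H) \<otimes> (\<one> \<I> \<otimes> \<one> X))))"
    by (simp add: Ev_ihom_map_Comp Ev_ihom_mult_Comp)
  also have "\<dots> = LUnit V Y \<cdot> ((\<one> \<I> \<otimes> Ev V X Y) \<cdot> ((LUnit V \<I> \<otimes> \<one> (?H \<odot> X)) \<cdot> interchange V \<I> ?H \<I> X))"
    by (subst interchange_nat) (simp_all add: Comp_Tens1_tail Ev_ihom_unit)
  also have "\<dots> = Ev V X Y \<cdot> (?r \<otimes> LUnit V X)"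
    by (simp add: Comp_eq_tail[OF LUnit_nat] Comp_assoc_arr LUnit_Tens1_LUnit)
  finally show "Ev V X Y \<cdot> (?l \<otimes> LUnit V X) = Ev V X Y \<cdot> (?r \<otimes> LUnit V X)" .
qed auto

lemma ihom_mult_right_unit:
  assumes [simp]: "X \<in> Obj V" "Y \<in> Obj V"
  shows "ihom_map V (inv_arr V (RUnit V X)) (RUnit V Y)
    \<cdot> (ihom_mult V X Y \<I> \<I> \<cdot> (\<one> (IHom V X Y) \<otimes> ihom_unit V)) = RUnit V (IHom V X Y)"
    (is "?l = ?r")
proof (rule ihom_eqI)
  let ?H = "IHom V X Y"
  have "Ev V X Y \<cdot> (?l \<otimes> RUnit V X) = RUnit V Y \<cdot> ((Ev V X Y \<otimes> Ev V \<I> \<I>)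
      \<cdot> (interchange V ?H (IHom V \<I> \<I>) X \<I> \<cdot> ((\<one> ?H \<otimes> ihom_unit V) \<otimes> (\<one> X \<otimes> \<one> \<I>))))"
    by (simp add: Ev_ihom_map_Comp Ev_ihom_mult_Comp)
  also have "\<dots> = RUnit V Y \<cdot> ((Ev V X Y \<otimes> \<one> \<I>) \<cdot> ((\<one> (?H \<odot> X) \<otimes> LUnit V \<I>) \<cdot> interchange V ?H \<I> X \<I>))"
    by (subst interchange_nat) (simp_all add: Comp_Tens1_tail Ev_ihom_unit)
  also have "\<dots> = Ev V X Y \<cdot> (?r \<otimes> RUnit V X)"
    by (simp add: Comp_eq_tail[OF RUnit_nat] Comp_assoc_arr RUnit_Tens1_RUnit)
  finally show "Ev V X Y \<cdot> (?l \<otimes> RUnit V X) = Ev V X Y \<cdot> (?r \<otimes> RUnit V X)" .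
qed auto

text \<open>\<open>Braid V X' X\<close> is the braiding of \<open>opp V\<close> at \<open>X\<close>
  and \<open>X'\<close>. Evaluation on \<open>Braid V X X'\<close> cancels it, and
  \<open>interchange_Braid\<close> remains.\<close>

lemma ihom_mult_braided:
  assumes [simp]: "X \<in> Obj V" "Y \<in> Obj V" "X' \<in> Obj V" "Y' \<in> Obj V"
  shows "ihom_map V (Braid V X' X) (Braid V Y Y') \<cdot> ihom_mult V X Y X' Y'
    = ihom_mult V X' Y' X Y \<cdot> Braid V (IHom V X Y) (IHom V X' Y')"
    (is "?l = ?r")
proof (rule ihom_eqI)
  let ?H = "IHom V X Y" and ?H' = "IHom V X' Y'"
  let ?E = "Ev V (X' \<odot> X) (Y' \<odot> Y)"
  have "?E \<cdot> (?l \<otimes> Braid V X X') = Braid V Y Y' \<cdot> ((Ev V X Y \<otimes> Ev V X' Y') \<cdot> interchange V ?H ?H' X X')"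
    by (simp add: Ev_ihom_map_Comp Ev_ihom_mult)
  also have "\<dots> = ?E \<cdot> (?r \<otimes> Braid V X X')"
    by (simp add: Ev_ihom_mult_Comp interchange_Braid Comp_eq_tail[OF Braid_nat] Comp_assoc_arr)
  finally show "?E \<cdot> (?l \<otimes> Braid V X X') = ?E \<cdot> (?r \<otimes> Braid V X X')" .
qed auto

lemma ihom_functor_braided_lax:
  "braided_lax_monoidal_functor (prod_cat (opp V) V) V (ihom_functor V)"
proof -
  interpret op: symmetric_monoidal_category "opp V" by (rule symmetric_monoidal_category_opp)
  interpret S: symmetric_monoidal_category "prod_cat (opp V) V"
    by (rule symmetric_monoidal_category_prod_cat) unfold_locales
  show ?thesis
    by unfold_locales
      (auto simp: ihom_functor_def in_hom_iff ihom_map_Comp ihom_mult_nat ihom_mult_assoc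
        ihom_mult_left_unit ihom_mult_right_unit ihom_mult_braided)
qed

end

section \<open>Convolution as a braided lax monoidal functor\<close>

lemma hom_opp [simp]: "hom (opp V) X Y = hom V Y X"
  by (auto simp: in_hom_iff)

lemma in_hom_prod_cat_iff:
  "p \<in> hom (prod_cat V W) x y \<longleftrightarrow> fst p \<in> hom V (fst x) (fst y) \<and> snd p \<in> hom W (snd x) (snd y)"
  by (cases p, cases x, cases y) (auto simp: in_hom_iff)

text \<open>The interchange contains an inverse associator, and inverses in a product category split
  into components only for isomorphisms. This is why the carriers have to be objects.\<close>

lemma tensor_mon_pair_mon:
  fixes V :: "('o, 'a, 'y) moncat_scheme" and W :: "('p, 'b, 'z) moncat_scheme"
  assumes "monoidal_category V" "monoidal_category W"
    and "Car C \<in> Obj V" "Car C' \<in> Obj V" "Car B \<in> Obj W" "Car B' \<in> Obj W"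
  shows "tensor_mon (prod_cat V W) (pair_mon C B) (pair_mon C' B')
    = pair_mon (tensor_mon V C C') (tensor_mon W B B')"
proof -
  interpret V: monoidal_category V by fact
  interpret W: monoidal_category W by fact
  show ?thesis
    using assms(3-)
    by (simp add: tensor_mon_def pair_mon_def interchange_def inv_arr_prod_cat
        V.category_axioms W.category_axioms)
qed

lemma unit_mon_prod_cat: "unit_mon (prod_cat V W) = pair_mon (unit_mon V) (unit_mon W)"
  by (simp add: unit_mon_def pair_mon_def)

lemma conv_simps [simp]: "Car (conv V C B) = IHom V (Car C) (Car B)"
  by (simp add: conv_def)

definition conv_functor :: "('o, 'a, 'z) closed_moncat_scheme \<Rightarrow>
    (('o, 'a) mon_obj \<times> ('o, 'a) mon_obj, ('o, 'a) mon_arr \<times> ('o, 'a) mon_arr,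
      ('o, 'a) mon_obj, ('o, 'a) mon_arr) lax_func"
  where "conv_functor V =
    \<lparr>Fun0 = (\<lambda>x. conv V (fst x) (snd x)), Fun1 = (\<lambda>p. conv_map V (fst p) (snd p)),
     FMult = (\<lambda>x y. conv_mult V (fst x) (snd x) (fst y) (snd y)), FUnit = conv_unit V\<rparr>"

context symmetric_monoidal_closed_category
begin

interpretation op: symmetric_monoidal_category "opp V"
  by (rule symmetric_monoidal_category_opp)

interpretation ih: braided_lax_monoidal_functor "prod_cat (opp V) V" V "ihom_functor V"
  by (rule ihom_functor_braided_lax)

lemma monoid_in_conv: "monoid_in (opp V) C \<Longrightarrow> monoid_in V B \<Longrightarrow> monoid_in V (conv V C B)"
  unfolding conv_image by (intro ih.monoid_in_image_mon monoid_in_pair_mon)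

lemma monoid_morphism_conv:
  assumes "monoid_morphism (opp V) C f C'" "monoid_morphism V B g B'"
    "monoid_in (opp V) C" "monoid_in (opp V) C'" "monoid_in V B" "monoid_in V B'"
  shows "monoid_morphism V (conv V C B) (ihom_map V f g) (conv V C' B')"
  using ih.monoid_morphism_image_mon[OF monoid_morphism_pair_mon[OF assms(1,2)]
      monoid_in_pair_mon[OF assms(3,5)] monoid_in_pair_mon[OF assms(4,6)]]
  by (simp add: conv_image ihom_functor_def)

lemma monoid_morphism_conv_mult:
  assumes "monoid_in (opp V) C" "monoid_in V B" "monoid_in (opp V) C'" "monoid_in V B'"
  shows "monoid_morphism V (tensor_mon V (conv V C B) (conv V C' B'))
    (ihom_mult V (Car C) (Car B) (Car C') (Car B'))
    (conv V (tensor_mon (opp V) C C') (tensor_mon V B B'))"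
  using ih.monoid_morphism_FMult[OF monoid_in_pair_mon[OF assms(1,2)] monoid_in_pair_mon[OF assms(3,4)]]
    tensor_mon_pair_mon[OF op.monoidal_category_axioms monoidal_category_axioms, of C C' B B']
    monoid_inD(1)[OF assms(1)] monoid_inD(1)[OF assms(2)] monoid_inD(1)[OF assms(3)]
    monoid_inD(1)[OF assms(4)]
  by (simp add: conv_image ihom_functor_def)

lemma monoid_morphism_conv_unit:
  "monoid_morphism V (unit_mon V) (ihom_unit V) (conv V (unit_mon (opp V)) (unit_mon V))"
  using ih.monoid_morphism_FUnit by (simp add: conv_image ihom_functor_def unit_mon_prod_cat)

text \<open>On underlying arrows every law is one for the internal hom. New are only the facts that
  the arrows involved are monoid morphisms, obtained from the action of \<open>ihom_functor\<close>
  on monoids.\<close>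

theorem conv_functor_braided_lax:
  "braided_lax_monoidal_functor (prod_cat (opp (Comon V)) (Mon V)) (Mon V) (conv_functor V)"
proof -
  interpret M: symmetric_monoidal_category "Mon V" by (rule symmetric_monoidal_category_Mon)
  interpret N: symmetric_monoidal_category "Mon (opp V)" by (rule op.symmetric_monoidal_category_Mon)
  interpret C: symmetric_monoidal_category "Comon V" by (rule symmetric_monoidal_category_Comon)
  interpret C': symmetric_monoidal_category "opp (Comon V)" by (rule C.symmetric_monoidal_category_opp)
  interpret S: symmetric_monoidal_category "prod_cat (opp (Comon V)) (Mon V)"
    by (rule symmetric_monoidal_category_prod_cat) unfold_locales
  have opp_opp: "inv_arr (Mon (opp V)) (inv_arr (Mon (opp V)) (Assoc (Mon (opp V)) X Y Z))
        = Assoc (Mon (opp V)) X Y Z"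
      "inv_arr (Mon (opp V)) (inv_arr (Mon (opp V)) (LUnit (Mon (opp V)) X)) = LUnit (Mon (opp V)) X"
      "inv_arr (Mon (opp V)) (inv_arr (Mon (opp V)) (RUnit (Mon (opp V)) X)) = RUnit (Mon (opp V)) X"
    if "monoid_in (opp V) X" "monoid_in (opp V) Y" "monoid_in (opp V) Z" for X Y Z
    using that by (simp_all del: Mon_simps add: Mon_simps(1))
  \<comment> \<open>The double opposite of \<open>Mon (opp V)\<close> restores its structure maps only on objects, as \<open>inv_arr\<close> is
    unspecified elsewhere.\<close>
  note opp_opp = opp_opp[simplified]
  note Car_Obj = monoid_inD(1)[of "opp V", simplified] monoid_inD(1)[of V]
  \<comment> \<open>Stated with \<open>Braid V (Car Y) (Car X)\<close> because simplification gives
    the inverse braiding of \<open>V\<close> this form.\<close>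
  have opp_opp_Braid:
    "inv_arr (Mon (opp V)) (inv_arr (Mon (opp V))
        (tensor_mon (opp V) X Y, Braid V (Car Y) (Car X), tensor_mon (opp V) Y X))
      = (tensor_mon (opp V) X Y, Braid V (Car Y) (Car X), tensor_mon (opp V) Y X)"
    if "monoid_in (opp V) X" "monoid_in (opp V) Y" for X Y
    using N.inv_arr_inv_arr[OF N.Braid_iso[of X Y]] that by (simp add: Car_Obj)
  note intros = monoid_in_conv monoid_in_tensor_mon monoid_in_unit_mon op.monoid_in_tensor_mon
    op.monoid_in_unit_mon monoid_morphism_conv monoid_morphism_conv_mult monoid_morphism_conv_unit
  show ?thesis
    by unfold_locales
      (auto simp: conv_functor_def conv_map_def conv_mult_def conv_unit_def Comon_def
        in_hom_prod_cat_iff in_hom_Mon_iff opp_opp opp_opp_Braid Car_Obj ihom_map_Comp ihom_mult_nat ihom_mult_assoc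
        ihom_mult_left_unit ihom_mult_right_unit ihom_mult_braided intros intro: intros)
qed

end

section \<open>Parametrized right adjoints of braided lax monoidal functors\<close>

text \<open>For fixed \<open>B\<close>, \<open>\<eta> A B : A \<rightarrow> K(R(A, B), B)\<close> is a universal arrow, so that
  \<open>M(A, K(C, B)) \<cong> E(C, R(A, B))\<close>. Only the uniqueness half is assumed in general: the arrows that the
  existence half would provide are the values of \<open>Fun1 R\<close>, \<open>FMult R\<close> and \<open>FUnit R\<close>.\<close>

locale parametrized_right_adjoint =
  E: symmetric_monoidal_category E + D: symmetric_monoidal_category D
  + M: symmetric_monoidal_category M + K: braided_lax_monoidal_functor "prod_cat (opp E) D" M K
  for E :: "('e, 'f, 'x) moncat_scheme" and D :: "('p, 'q, 'y) moncat_scheme"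
    and M :: "('m, 'n, 'z) moncat_scheme" and K :: "('e \<times> 'p, 'f \<times> 'q, 'm, 'n, 'u) lax_func_scheme" +
  fixes R :: "('m \<times> 'p, 'n \<times> 'q, 'e, 'f, 'w) lax_func_scheme"
    and \<eta> :: "'m \<Rightarrow> 'p \<Rightarrow> 'n"
  assumes R_Obj [simp]: "A \<in> Obj M \<Longrightarrow> B \<in> Obj D \<Longrightarrow> Fun0 R (A, B) \<in> Obj E"
    and unit_in_hom: "A \<in> Obj M \<Longrightarrow> B \<in> Obj D \<Longrightarrow> \<eta> A B \<in> hom M A (Fun0 K (Fun0 R (A, B), B))"
    and unit_unique: "A \<in> Obj M \<Longrightarrow> B \<in> Obj D
      \<Longrightarrow> h \<in> hom E C (Fun0 R (A, B)) \<Longrightarrow> h' \<in> hom E C (Fun0 R (A, B))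
      \<Longrightarrow> Fun1 K (h, \<one>\<^bsub>D\<^esub> B) \<cdot>\<^bsub>M\<^esub> \<eta> A B = Fun1 K (h', \<one>\<^bsub>D\<^esub> B) \<cdot>\<^bsub>M\<^esub> \<eta> A B \<Longrightarrow> h = h'"
    and R_Fun1_in_hom: "f \<in> hom M A' A \<Longrightarrow> g \<in> hom D B B'
      \<Longrightarrow> Fun1 R (f, g) \<in> hom E (Fun0 R (A, B)) (Fun0 R (A', B'))"
    and R_Fun1_unit: "f \<in> hom M A' A \<Longrightarrow> g \<in> hom D B B'
      \<Longrightarrow> Fun1 K (Fun1 R (f, g), \<one>\<^bsub>D\<^esub> B') \<cdot>\<^bsub>M\<^esub> \<eta> A' B'
        = Fun1 K (\<one>\<^bsub>E\<^esub> (Fun0 R (A, B)), g) \<cdot>\<^bsub>M\<^esub> (\<eta> A B \<cdot>\<^bsub>M\<^esub> f)"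
    and R_FMult_in_hom: "A \<in> Obj M \<Longrightarrow> B \<in> Obj D \<Longrightarrow> A' \<in> Obj M \<Longrightarrow> B' \<in> Obj D
      \<Longrightarrow> FMult R (A, B) (A', B')
        \<in> hom E (Fun0 R (A, B) \<odot>\<^bsub>E\<^esub> Fun0 R (A', B')) (Fun0 R (A \<odot>\<^bsub>M\<^esub> A', B \<odot>\<^bsub>D\<^esub> B'))"
    and R_FMult_unit: "A \<in> Obj M \<Longrightarrow> B \<in> Obj D \<Longrightarrow> A' \<in> Obj M \<Longrightarrow> B' \<in> Obj D
      \<Longrightarrow> Fun1 K (FMult R (A, B) (A', B'), \<one>\<^bsub>D\<^esub> (B \<odot>\<^bsub>D\<^esub> B')) \<cdot>\<^bsub>M\<^esub> \<eta> (A \<odot>\<^bsub>M\<^esub> A') (B \<odot>\<^bsub>D\<^esub> B')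
        = FMult K (Fun0 R (A, B), B) (Fun0 R (A', B'), B') \<cdot>\<^bsub>M\<^esub> (\<eta> A B \<otimes>\<^bsub>M\<^esub> \<eta> A' B')"
    and R_FUnit_in_hom: "FUnit R \<in> hom E \<I>\<^bsub>E\<^esub> (Fun0 R (\<I>\<^bsub>M\<^esub>, \<I>\<^bsub>D\<^esub>))"
    and R_FUnit_unit: "Fun1 K (FUnit R, \<one>\<^bsub>D\<^esub> \<I>\<^bsub>D\<^esub>) \<cdot>\<^bsub>M\<^esub> \<eta> \<I>\<^bsub>M\<^esub> \<I>\<^bsub>D\<^esub> = FUnit K"
begin

lemma unit_typing [simp]:
  assumes "A \<in> Obj M" "B \<in> Obj D"
  shows "\<eta> A B \<in> Arr M" "Dom M (\<eta> A B) = A" "Cod M (\<eta> A B) = Fun0 K (Fun0 R (A, B), B)"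
  using unit_in_hom[OF assms] by (simp_all add: in_hom_iff)

lemma R_Fun1_typing [simp]:
  assumes "f \<in> Arr M" "g \<in> Arr D"
  shows "Fun1 R (f, g) \<in> Arr E" "Dom E (Fun1 R (f, g)) = Fun0 R (Cod M f, Dom D g)"
    "Cod E (Fun1 R (f, g)) = Fun0 R (Dom M f, Cod D g)"
  using R_Fun1_in_hom[of f "Dom M f" "Cod M f" g "Dom D g" "Cod D g"] assms
  by (simp_all add: in_hom_iff)

lemma R_FMult_typing [simp]:
  assumes "A \<in> Obj M" "B \<in> Obj D" "A' \<in> Obj M" "B' \<in> Obj D"
  shows "FMult R (A, B) (A', B') \<in> Arr E"
    "Dom E (FMult R (A, B) (A', B')) = Fun0 R (A, B) \<odot>\<^bsub>E\<^esub> Fun0 R (A', B')"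
    "Cod E (FMult R (A, B) (A', B')) = Fun0 R (A \<odot>\<^bsub>M\<^esub> A', B \<odot>\<^bsub>D\<^esub> B')"
  using R_FMult_in_hom[OF assms] by (simp_all add: in_hom_iff)

lemma R_FUnit_typing [simp]:
  "FUnit R \<in> Arr E" "Dom E (FUnit R) = \<I>\<^bsub>E\<^esub>" "Cod E (FUnit R) = Fun0 R (\<I>\<^bsub>M\<^esub>, \<I>\<^bsub>D\<^esub>)"
  using R_FUnit_in_hom by (simp_all add: in_hom_iff)

lemma R_Fun1_nat:
  assumes "f \<in> Arr M" "g \<in> Arr D" "Dom M f = A'" "Cod D g = B'"
  shows "Fun1 K (Fun1 R (f, g), \<one>\<^bsub>D\<^esub> B') \<cdot>\<^bsub>M\<^esub> \<eta> A' B'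
    = Fun1 K (\<one>\<^bsub>E\<^esub> (Fun0 R (Cod M f, Dom D g)), g) \<cdot>\<^bsub>M\<^esub> (\<eta> (Cod M f) (Dom D g) \<cdot>\<^bsub>M\<^esub> f)"
  using assms by (intro R_Fun1_unit) (auto simp: in_hom_iff)

lemma R_eqI:
  assumes "Fun1 K (h, \<one>\<^bsub>D\<^esub> B) \<cdot>\<^bsub>M\<^esub> \<eta> A B = Fun1 K (h', \<one>\<^bsub>D\<^esub> B) \<cdot>\<^bsub>M\<^esub> \<eta> A B"
    "A \<in> Obj M" "B \<in> Obj D" "h \<in> Arr E" "h' \<in> Arr E" "Dom E h = Dom E h'"
    "Cod E h = Fun0 R (A, B)" "Cod E h' = Fun0 R (A, B)"
  shows "h = h'"
  using assms by (intro unit_unique[of A B h "Dom E h'" h']) (auto simp: in_hom_iff)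

section \<open>Laws of \<open>K\<close> rearranged for use in front of a unit\<close>

lemma K_Ident [simp]:
  "C \<in> Obj E \<Longrightarrow> B \<in> Obj D \<Longrightarrow> Fun1 K (\<one>\<^bsub>E\<^esub> C, \<one>\<^bsub>D\<^esub> B) = \<one>\<^bsub>M\<^esub> (Fun0 K (C, B))"
  using K.Fun1_Ident[of "(C, B)"] by simp

lemma K_Comp:
  assumes "h \<in> Arr E" "h' \<in> Arr E" "Dom E h = Cod E h'" "g \<in> Arr D" "g' \<in> Arr D" "Cod D g = Dom D g'"
  shows "Fun1 K (h', g') \<cdot>\<^bsub>M\<^esub> Fun1 K (h, g) = Fun1 K (h \<cdot>\<^bsub>E\<^esub> h', g' \<cdot>\<^bsub>D\<^esub> g)"
  using assms K.Fun1_of_Comp[of "(h, g)" "(h', g')"] by simp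

lemma K_Comp_left:
  assumes "h \<in> Arr E" "h' \<in> Arr E" "Dom E h = Cod E h'" "B \<in> Obj D"
    "t \<in> Arr M" "Cod M t = Fun0 K (Cod E h, B)"
  shows "Fun1 K (h \<cdot>\<^bsub>E\<^esub> h', \<one>\<^bsub>D\<^esub> B) \<cdot>\<^bsub>M\<^esub> t = Fun1 K (h', \<one>\<^bsub>D\<^esub> B) \<cdot>\<^bsub>M\<^esub> (Fun1 K (h, \<one>\<^bsub>D\<^esub> B) \<cdot>\<^bsub>M\<^esub> t)"
  using assms by (simp add: M.Comp_eq_tail[OF K_Comp])

lemma K_Comp_right:
  assumes "g \<in> Arr D" "g' \<in> Arr D" "Cod D g = Dom D g'" "C \<in> Obj E"
    "t \<in> Arr M" "Cod M t = Fun0 K (C, Dom D g)"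
  shows "Fun1 K (\<one>\<^bsub>E\<^esub> C, g' \<cdot>\<^bsub>D\<^esub> g) \<cdot>\<^bsub>M\<^esub> t = Fun1 K (\<one>\<^bsub>E\<^esub> C, g') \<cdot>\<^bsub>M\<^esub> (Fun1 K (\<one>\<^bsub>E\<^esub> C, g) \<cdot>\<^bsub>M\<^esub> t)"
  using assms by (simp add: M.Comp_eq_tail[OF K_Comp])

lemma K_exchange:
  assumes "h \<in> Arr E" "g \<in> Arr D" "Cod D g = B" "Cod E h = C" "t \<in> Arr M" "Cod M t = Fun0 K (C, Dom D g)"
  shows "Fun1 K (h, \<one>\<^bsub>D\<^esub> B) \<cdot>\<^bsub>M\<^esub> (Fun1 K (\<one>\<^bsub>E\<^esub> C, g) \<cdot>\<^bsub>M\<^esub> t)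
    = Fun1 K (\<one>\<^bsub>E\<^esub> (Dom E h), g) \<cdot>\<^bsub>M\<^esub> (Fun1 K (h, \<one>\<^bsub>D\<^esub> (Dom D g)) \<cdot>\<^bsub>M\<^esub> t)"
  using assms by (auto simp: M.Comp_eq_tail[OF K_Comp])

lemma K_FMult_nat:
  assumes "h \<in> Arr E" "h' \<in> Arr E" "g \<in> Arr D" "g' \<in> Arr D"
    "x \<in> Arr M" "x' \<in> Arr M" "Cod M x = Fun0 K (Cod E h, Dom D g)" "Cod M x' = Fun0 K (Cod E h', Dom D g')"
  shows "Fun1 K (h \<otimes>\<^bsub>E\<^esub> h', g \<otimes>\<^bsub>D\<^esub> g') \<cdot>\<^bsub>M\<^esub>
      (FMult K (Cod E h, Dom D g) (Cod E h', Dom D g') \<cdot>\<^bsub>M\<^esub> (x \<otimes>\<^bsub>M\<^esub> x'))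
    = FMult K (Dom E h, Cod D g) (Dom E h', Cod D g') \<cdot>\<^bsub>M\<^esub>
      ((Fun1 K (h, g) \<cdot>\<^bsub>M\<^esub> x) \<otimes>\<^bsub>M\<^esub> (Fun1 K (h', g') \<cdot>\<^bsub>M\<^esub> x'))"
proof -
  have "FMult K (Dom E h, Cod D g) (Dom E h', Cod D g') \<cdot>\<^bsub>M\<^esub>
      ((Fun1 K (h, g) \<cdot>\<^bsub>M\<^esub> x) \<otimes>\<^bsub>M\<^esub> (Fun1 K (h', g') \<cdot>\<^bsub>M\<^esub> x'))
    = (FMult K (Dom E h, Cod D g) (Dom E h', Cod D g') \<cdot>\<^bsub>M\<^esub> (Fun1 K (h, g) \<otimes>\<^bsub>M\<^esub> Fun1 K (h', g')))
      \<cdot>\<^bsub>M\<^esub> (x \<otimes>\<^bsub>M\<^esub> x')"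
    using assms by (simp add: M.Comp_assoc_arr M.Comp_Tens1)
  also have "FMult K (Dom E h, Cod D g) (Dom E h', Cod D g') \<cdot>\<^bsub>M\<^esub> (Fun1 K (h, g) \<otimes>\<^bsub>M\<^esub> Fun1 K (h', g'))
    = Fun1 K (h \<otimes>\<^bsub>E\<^esub> h', g \<otimes>\<^bsub>D\<^esub> g') \<cdot>\<^bsub>M\<^esub> FMult K (Cod E h, Dom D g) (Cod E h', Dom D g')"
    using assms K.FMult_nat[of "(h, g)" "(h', g')"] by simp
  finally show ?thesis using assms by (simp add: M.Comp_assoc_arr)
qed

lemma K_FMult_nat_left:
  assumes "h \<in> Arr E" "h' \<in> Arr E" "B \<in> Obj D" "B' \<in> Obj D" "Cod E h = C" "Cod E h' = C'"
    "x \<in> Arr M" "x' \<in> Arr M" "Cod M x = Fun0 K (C, B)" "Cod M x' = Fun0 K (C', B')"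
  shows "Fun1 K (h \<otimes>\<^bsub>E\<^esub> h', \<one>\<^bsub>D\<^esub> (B \<odot>\<^bsub>D\<^esub> B')) \<cdot>\<^bsub>M\<^esub> (FMult K (C, B) (C', B') \<cdot>\<^bsub>M\<^esub> (x \<otimes>\<^bsub>M\<^esub> x'))
    = FMult K (Dom E h, B) (Dom E h', B') \<cdot>\<^bsub>M\<^esub>
      ((Fun1 K (h, \<one>\<^bsub>D\<^esub> B) \<cdot>\<^bsub>M\<^esub> x) \<otimes>\<^bsub>M\<^esub> (Fun1 K (h', \<one>\<^bsub>D\<^esub> B') \<cdot>\<^bsub>M\<^esub> x'))"
  using assms K_FMult_nat[of h h' "\<one>\<^bsub>D\<^esub> B" "\<one>\<^bsub>D\<^esub> B'" x x'] by simp

text \<open>The law of \<open>K\<close> has an inverse associator of \<open>E\<close> in its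
  contravariant slot. Composing with \<open>Assoc E\<close> moves it across, to the place where the
  law for \<open>R\<close> needs it. The unit and braiding laws below are rearranged for the same
  reason.\<close>

lemma K_FMult_assoc:
  assumes [simp]: "C \<in> Obj E" "B \<in> Obj D" "C' \<in> Obj E" "B' \<in> Obj D" "C'' \<in> Obj E" "B'' \<in> Obj D"
  shows "Fun1 K (\<one>\<^bsub>E\<^esub> ((C \<odot>\<^bsub>E\<^esub> C') \<odot>\<^bsub>E\<^esub> C''), Assoc D B B' B'')
      \<cdot>\<^bsub>M\<^esub> (FMult K (C \<odot>\<^bsub>E\<^esub> C', B \<odot>\<^bsub>D\<^esub> B') (C'', B'') \<cdot>\<^bsub>M\<^esub> (FMult K (C, B) (C', B') \<otimes>\<^bsub>M\<^esub> \<one>\<^bsub>M\<^esub> (Fun0 K (C'', B''))))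
    = Fun1 K (Assoc E C C' C'', \<one>\<^bsub>D\<^esub> (B \<odot>\<^bsub>D\<^esub> (B' \<odot>\<^bsub>D\<^esub> B'')))
      \<cdot>\<^bsub>M\<^esub> (FMult K (C, B) (C' \<odot>\<^bsub>E\<^esub> C'', B' \<odot>\<^bsub>D\<^esub> B'') \<cdot>\<^bsub>M\<^esub> ((\<one>\<^bsub>M\<^esub> (Fun0 K (C, B)) \<otimes>\<^bsub>M\<^esub> FMult K (C', B') (C'', B''))
        \<cdot>\<^bsub>M\<^esub> Assoc M (Fun0 K (C, B)) (Fun0 K (C', B')) (Fun0 K (C'', B''))))"
    (is "_ \<cdot>\<^bsub>M\<^esub> ?l = ?a \<cdot>\<^bsub>M\<^esub> ?r")
proof -
  have "Fun1 K (inv_arr E (Assoc E C C' C''), Assoc D B B' B'') \<cdot>\<^bsub>M\<^esub> ?l = ?r"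
    using K.FMult_assoc[of "(C, B)" "(C', B')" "(C'', B'')"] by simp
  then have "?a \<cdot>\<^bsub>M\<^esub> (Fun1 K (inv_arr E (Assoc E C C' C''), Assoc D B B' B'') \<cdot>\<^bsub>M\<^esub> ?l) = ?a \<cdot>\<^bsub>M\<^esub> ?r"
    by simp
  then show ?thesis
    by (simp add: M.Comp_eq_tail[OF K_Comp])
qed

lemma K_FMult_left_unit:
  assumes [simp]: "C \<in> Obj E" "B \<in> Obj D"
  shows "Fun1 K (\<one>\<^bsub>E\<^esub> (\<I>\<^bsub>E\<^esub> \<odot>\<^bsub>E\<^esub> C), LUnit D B)
      \<cdot>\<^bsub>M\<^esub> (FMult K (\<I>\<^bsub>E\<^esub>, \<I>\<^bsub>D\<^esub>) (C, B) \<cdot>\<^bsub>M\<^esub> (FUnit K \<otimes>\<^bsub>M\<^esub> \<one>\<^bsub>M\<^esub> (Fun0 K (C, B))))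
    = Fun1 K (LUnit E C, \<one>\<^bsub>D\<^esub> B) \<cdot>\<^bsub>M\<^esub> LUnit M (Fun0 K (C, B))"
    (is "_ \<cdot>\<^bsub>M\<^esub> ?l = ?a \<cdot>\<^bsub>M\<^esub> ?r")
proof -
  have "Fun1 K (inv_arr E (LUnit E C), LUnit D B) \<cdot>\<^bsub>M\<^esub> ?l = ?r"
    using K.FMult_left_unit[of "(C, B)"] by simp
  then have "?a \<cdot>\<^bsub>M\<^esub> (Fun1 K (inv_arr E (LUnit E C), LUnit D B) \<cdot>\<^bsub>M\<^esub> ?l) = ?a \<cdot>\<^bsub>M\<^esub> ?r"
    by simp
  then show ?thesis
    by (simp add: M.Comp_eq_tail[OF K_Comp])
qed

lemma K_FMult_right_unit:
  assumes [simp]: "C \<in> Obj E" "B \<in> Obj D"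
  shows "Fun1 K (\<one>\<^bsub>E\<^esub> (C \<odot>\<^bsub>E\<^esub> \<I>\<^bsub>E\<^esub>), RUnit D B)
      \<cdot>\<^bsub>M\<^esub> (FMult K (C, B) (\<I>\<^bsub>E\<^esub>, \<I>\<^bsub>D\<^esub>) \<cdot>\<^bsub>M\<^esub> (\<one>\<^bsub>M\<^esub> (Fun0 K (C, B)) \<otimes>\<^bsub>M\<^esub> FUnit K))
    = Fun1 K (RUnit E C, \<one>\<^bsub>D\<^esub> B) \<cdot>\<^bsub>M\<^esub> RUnit M (Fun0 K (C, B))"
    (is "_ \<cdot>\<^bsub>M\<^esub> ?l = ?a \<cdot>\<^bsub>M\<^esub> ?r")
proof -
  have "Fun1 K (inv_arr E (RUnit E C), RUnit D B) \<cdot>\<^bsub>M\<^esub> ?l = ?r"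
    using K.FMult_right_unit[of "(C, B)"] by simp
  then have "?a \<cdot>\<^bsub>M\<^esub> (Fun1 K (inv_arr E (RUnit E C), RUnit D B) \<cdot>\<^bsub>M\<^esub> ?l) = ?a \<cdot>\<^bsub>M\<^esub> ?r"
    by simp
  then show ?thesis
    by (simp add: M.Comp_eq_tail[OF K_Comp])
qed

lemma K_FMult_braided:
  assumes [simp]: "C \<in> Obj E" "B \<in> Obj D" "C' \<in> Obj E" "B' \<in> Obj D"
  shows "Fun1 K (\<one>\<^bsub>E\<^esub> (C \<odot>\<^bsub>E\<^esub> C'), Braid D B B') \<cdot>\<^bsub>M\<^esub> FMult K (C, B) (C', B')
    = Fun1 K (Braid E C C', \<one>\<^bsub>D\<^esub> (B' \<odot>\<^bsub>D\<^esub> B))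
      \<cdot>\<^bsub>M\<^esub> (FMult K (C', B') (C, B) \<cdot>\<^bsub>M\<^esub> Braid M (Fun0 K (C, B)) (Fun0 K (C', B')))"
    (is "_ \<cdot>\<^bsub>M\<^esub> ?l = ?a \<cdot>\<^bsub>M\<^esub> ?r")
proof -
  have "Fun1 K (Braid E C' C, Braid D B B') \<cdot>\<^bsub>M\<^esub> ?l = ?r"
    using K.FMult_braided[of "(C, B)" "(C', B')"] by simp
  then have "?a \<cdot>\<^bsub>M\<^esub> (Fun1 K (Braid E C' C, Braid D B B') \<cdot>\<^bsub>M\<^esub> ?l) = ?a \<cdot>\<^bsub>M\<^esub> ?r"
    by simp
  then show ?thesis
    by (simp add: M.Comp_eq_tail[OF K_Comp])
qed

section \<open>Laws of the parametrized right adjoint\<close>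

lemma R_Ident:
  assumes [simp]: "A \<in> Obj M" "B \<in> Obj D"
  shows "Fun1 R (\<one>\<^bsub>M\<^esub> A, \<one>\<^bsub>D\<^esub> B) = \<one>\<^bsub>E\<^esub> (Fun0 R (A, B))"
  by (rule R_eqI[of _ B A]) (auto simp: R_Fun1_nat)

lemma R_Comp:
  assumes [simp]: "f \<in> Arr M" "f' \<in> Arr M" "g \<in> Arr D" "g' \<in> Arr D"
    "Cod M f' = Dom M f" "Dom D g' = Cod D g"
  shows "Fun1 R (f \<cdot>\<^bsub>M\<^esub> f', g' \<cdot>\<^bsub>D\<^esub> g) = Fun1 R (f', g') \<cdot>\<^bsub>E\<^esub> Fun1 R (f, g)"
  by (rule R_eqI[of _ "Cod D g'" "Dom M f'"])
    (auto simp: R_Fun1_nat K_Comp_left K_Comp_right K_exchange M.Comp_eq_tail[OF R_Fun1_nat] M.Comp_assoc_arr)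

text \<open>Both sides correspond to \<open>f \<otimes> f'\<close> followed by the two units,
  \<open>FMult K\<close> and the action of \<open>g \<otimes> g'\<close>. Naturality of
  \<open>FMult K\<close> pulls the actions of \<open>g\<close> and \<open>g'\<close> out of the
  tensor.\<close>

lemma R_FMult_nat:
  assumes [simp]: "f \<in> Arr M" "f' \<in> Arr M" "g \<in> Arr D" "g' \<in> Arr D"
  shows "FMult R (Dom M f, Cod D g) (Dom M f', Cod D g') \<cdot>\<^bsub>E\<^esub> (Fun1 R (f, g) \<otimes>\<^bsub>E\<^esub> Fun1 R (f', g'))
    = Fun1 R (f \<otimes>\<^bsub>M\<^esub> f', g \<otimes>\<^bsub>D\<^esub> g') \<cdot>\<^bsub>E\<^esub> FMult R (Cod M f, Dom D g) (Cod M f', Dom D g')"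
    (is "?l = ?r")
proof (rule R_eqI)
  let ?B = "Cod D g \<odot>\<^bsub>D\<^esub> Cod D g'" and ?A = "Dom M f \<odot>\<^bsub>M\<^esub> Dom M f'"
  let ?p = "Fun0 R (Cod M f, Dom D g)" and ?p' = "Fun0 R (Cod M f', Dom D g')"
  let ?e = "\<eta> (Cod M f) (Dom D g)" and ?e' = "\<eta> (Cod M f') (Dom D g')"
  have "Fun1 K (?l, \<one>\<^bsub>D\<^esub> ?B) \<cdot>\<^bsub>M\<^esub> \<eta> ?A ?B = FMult K (?p, Cod D g) (?p', Cod D g')
      \<cdot>\<^bsub>M\<^esub> ((Fun1 K (\<one>\<^bsub>E\<^esub> ?p, g) \<cdot>\<^bsub>M\<^esub> (?e \<cdot>\<^bsub>M\<^esub> f)) \<otimes>\<^bsub>M\<^esub> (Fun1 K (\<one>\<^bsub>E\<^esub> ?p', g') \<cdot>\<^bsub>M\<^esub> (?e' \<cdot>\<^bsub>M\<^esub> f')))"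
    by (simp add: K_Comp_left R_FMult_unit K_FMult_nat_left R_Fun1_nat)
  also have "\<dots> = Fun1 K (\<one>\<^bsub>E\<^esub> (?p \<odot>\<^bsub>E\<^esub> ?p'), g \<otimes>\<^bsub>D\<^esub> g') \<cdot>\<^bsub>M\<^esub>
      (FMult K (?p, Dom D g) (?p', Dom D g') \<cdot>\<^bsub>M\<^esub> ((?e \<otimes>\<^bsub>M\<^esub> ?e') \<cdot>\<^bsub>M\<^esub> (f \<otimes>\<^bsub>M\<^esub> f')))"
    using K_FMult_nat[of "\<one>\<^bsub>E\<^esub> ?p" "\<one>\<^bsub>E\<^esub> ?p'" g g' "?e \<cdot>\<^bsub>M\<^esub> f" "?e' \<cdot>\<^bsub>M\<^esub> f'"] by (simp add: M.Comp_Tens1)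
  also have "\<dots> = Fun1 K (?r, \<one>\<^bsub>D\<^esub> ?B) \<cdot>\<^bsub>M\<^esub> \<eta> ?A ?B"
    by (simp add: K_Comp_left R_Fun1_nat K_exchange M.Comp_eq_tail[OF R_FMult_unit] M.Comp_assoc_arr)
  finally show "Fun1 K (?l, \<one>\<^bsub>D\<^esub> ?B) \<cdot>\<^bsub>M\<^esub> \<eta> ?A ?B = Fun1 K (?r, \<one>\<^bsub>D\<^esub> ?B) \<cdot>\<^bsub>M\<^esub> \<eta> ?A ?B" .
qed auto

lemma R_FMult_assoc:
  assumes [simp]: "A \<in> Obj M" "B \<in> Obj D" "A' \<in> Obj M" "B' \<in> Obj D" "A'' \<in> Obj M" "B'' \<in> Obj D"
  shows "Fun1 R (inv_arr M (Assoc M A A' A''), Assoc D B B' B'')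
      \<cdot>\<^bsub>E\<^esub> (FMult R (A \<odot>\<^bsub>M\<^esub> A', B \<odot>\<^bsub>D\<^esub> B') (A'', B'')
        \<cdot>\<^bsub>E\<^esub> (FMult R (A, B) (A', B') \<otimes>\<^bsub>E\<^esub> \<one>\<^bsub>E\<^esub> (Fun0 R (A'', B''))))
    = FMult R (A, B) (A' \<odot>\<^bsub>M\<^esub> A'', B' \<odot>\<^bsub>D\<^esub> B'')
      \<cdot>\<^bsub>E\<^esub> ((\<one>\<^bsub>E\<^esub> (Fun0 R (A, B)) \<otimes>\<^bsub>E\<^esub> FMult R (A', B') (A'', B''))
        \<cdot>\<^bsub>E\<^esub> Assoc E (Fun0 R (A, B)) (Fun0 R (A', B')) (Fun0 R (A'', B'')))"
    (is "?l = ?r")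
proof (rule R_eqI)
  let ?AA = "A \<odot>\<^bsub>M\<^esub> (A' \<odot>\<^bsub>M\<^esub> A'')" and ?BB = "B \<odot>\<^bsub>D\<^esub> (B' \<odot>\<^bsub>D\<^esub> B'')"
  let ?p = "Fun0 R (A, B)" and ?p' = "Fun0 R (A', B')" and ?p'' = "Fun0 R (A'', B'')"
  let ?e = "\<eta> A B" and ?e' = "\<eta> A' B'" and ?e'' = "\<eta> A'' B''"
  let ?i = "inv_arr M (Assoc M A A' A'')"
  let ?k1 = "FMult K (?p, B) (?p', B')" and ?k2 = "FMult K (?p \<odot>\<^bsub>E\<^esub> ?p', B \<odot>\<^bsub>D\<^esub> B') (?p'', B'')"
  let ?k3 = "FMult K (?p', B') (?p'', B'')" and ?k4 = "FMult K (?p, B) (?p' \<odot>\<^bsub>E\<^esub> ?p'', B' \<odot>\<^bsub>D\<^esub> B'')"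
  let ?a = "Fun1 K (\<one>\<^bsub>E\<^esub> ((?p \<odot>\<^bsub>E\<^esub> ?p') \<odot>\<^bsub>E\<^esub> ?p''), Assoc D B B' B'')"
  let ?b = "Fun1 K (Assoc E ?p ?p' ?p'', \<one>\<^bsub>D\<^esub> ?BB)"
  have "Fun1 K (?l, \<one>\<^bsub>D\<^esub> ?BB) \<cdot>\<^bsub>M\<^esub> \<eta> ?AA ?BB
      = ?a \<cdot>\<^bsub>M\<^esub> (Fun1 K (FMult R (A, B) (A', B') \<otimes>\<^bsub>E\<^esub> \<one>\<^bsub>E\<^esub> ?p'', \<one>\<^bsub>D\<^esub> ((B \<odot>\<^bsub>D\<^esub> B') \<odot>\<^bsub>D\<^esub> B''))
        \<cdot>\<^bsub>M\<^esub> (FMult K (Fun0 R (A \<odot>\<^bsub>M\<^esub> A', B \<odot>\<^bsub>D\<^esub> B'), B \<odot>\<^bsub>D\<^esub> B') (?p'', B'')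
        \<cdot>\<^bsub>M\<^esub> ((\<eta> (A \<odot>\<^bsub>M\<^esub> A') (B \<odot>\<^bsub>D\<^esub> B') \<otimes>\<^bsub>M\<^esub> ?e'') \<cdot>\<^bsub>M\<^esub> ?i)))"
    by (simp add: K_Comp_left R_Fun1_nat K_exchange M.Comp_eq_tail[OF R_FMult_unit] M.Comp_assoc_arr)
  \<comment> \<open>\<open>?i\<close> is detached so that the composite ends in a tensor of two
    arrows, as \<open>K_FMult_nat_left\<close> requires.\<close>
  also have "\<dots> = ?a \<cdot>\<^bsub>M\<^esub> ((Fun1 K (FMult R (A, B) (A', B') \<otimes>\<^bsub>E\<^esub> \<one>\<^bsub>E\<^esub> ?p'', \<one>\<^bsub>D\<^esub> ((B \<odot>\<^bsub>D\<^esub> B') \<odot>\<^bsub>D\<^esub> B''))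
        \<cdot>\<^bsub>M\<^esub> (FMult K (Fun0 R (A \<odot>\<^bsub>M\<^esub> A', B \<odot>\<^bsub>D\<^esub> B'), B \<odot>\<^bsub>D\<^esub> B') (?p'', B'')
        \<cdot>\<^bsub>M\<^esub> (\<eta> (A \<odot>\<^bsub>M\<^esub> A') (B \<odot>\<^bsub>D\<^esub> B') \<otimes>\<^bsub>M\<^esub> ?e''))) \<cdot>\<^bsub>M\<^esub> ?i)"
    by (simp add: M.Comp_assoc_arr)
  \<comment> \<open>Both occurrences of \<open>FMult R\<close> have now been absorbed into units,
    leaving \<open>FMult K\<close>.\<close>
  also have "\<dots> = ?a \<cdot>\<^bsub>M\<^esub> ((?k2 \<cdot>\<^bsub>M\<^esub> ((?k1 \<cdot>\<^bsub>M\<^esub> (?e \<otimes>\<^bsub>M\<^esub> ?e')) \<otimes>\<^bsub>M\<^esub> ?e'')) \<cdot>\<^bsub>M\<^esub> ?i)"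
    by (subst K_FMult_nat_left) (simp_all add: R_FMult_unit)
  also have "\<dots> = (?a \<cdot>\<^bsub>M\<^esub> (?k2 \<cdot>\<^bsub>M\<^esub> (?k1 \<otimes>\<^bsub>M\<^esub> \<one>\<^bsub>M\<^esub> (Fun0 K (?p'', B''))))) \<cdot>\<^bsub>M\<^esub> (((?e \<otimes>\<^bsub>M\<^esub> ?e') \<otimes>\<^bsub>M\<^esub> ?e'') \<cdot>\<^bsub>M\<^esub> ?i)"
    by (simp add: M.Comp_assoc_arr M.Comp_Tens1_tail)
  \<comment> \<open>After associativity of \<open>K\<close>, naturality moves the associator of
    \<open>M\<close> past the units, where it cancels \<open>?i\<close>.\<close>
  also have "\<dots> = ?b \<cdot>\<^bsub>M\<^esub> (?k4 \<cdot>\<^bsub>M\<^esub> ((\<one>\<^bsub>M\<^esub> (Fun0 K (?p, B)) \<otimes>\<^bsub>M\<^esub> ?k3) \<cdot>\<^bsub>M\<^esub> (?e \<otimes>\<^bsub>M\<^esub> (?e' \<otimes>\<^bsub>M\<^esub> ?e''))))"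
    by (subst K_FMult_assoc) (simp_all add: M.Comp_assoc_arr M.Assoc_nat_tail)
  also have "\<dots> = ?b \<cdot>\<^bsub>M\<^esub> (?k4 \<cdot>\<^bsub>M\<^esub> (?e \<otimes>\<^bsub>M\<^esub> (?k3 \<cdot>\<^bsub>M\<^esub> (?e' \<otimes>\<^bsub>M\<^esub> ?e''))))"
    by (simp add: M.Comp_Tens1)
  also have "\<dots> = ?b \<cdot>\<^bsub>M\<^esub> (Fun1 K (\<one>\<^bsub>E\<^esub> ?p \<otimes>\<^bsub>E\<^esub> FMult R (A', B') (A'', B''), \<one>\<^bsub>D\<^esub> ?BB)
      \<cdot>\<^bsub>M\<^esub> (FMult K (?p, B) (Fun0 R (A' \<odot>\<^bsub>M\<^esub> A'', B' \<odot>\<^bsub>D\<^esub> B''), B' \<odot>\<^bsub>D\<^esub> B'')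
      \<cdot>\<^bsub>M\<^esub> (?e \<otimes>\<^bsub>M\<^esub> \<eta> (A' \<odot>\<^bsub>M\<^esub> A'') (B' \<odot>\<^bsub>D\<^esub> B''))))"
    by (subst K_FMult_nat_left) (simp_all add: R_FMult_unit)
  also have "\<dots> = Fun1 K (?r, \<one>\<^bsub>D\<^esub> ?BB) \<cdot>\<^bsub>M\<^esub> \<eta> ?AA ?BB"
    by (simp add: K_Comp_left R_FMult_unit)
  finally show "Fun1 K (?l, \<one>\<^bsub>D\<^esub> ?BB) \<cdot>\<^bsub>M\<^esub> \<eta> ?AA ?BB = Fun1 K (?r, \<one>\<^bsub>D\<^esub> ?BB) \<cdot>\<^bsub>M\<^esub> \<eta> ?AA ?BB" .
qed auto

text \<open>Once \<open>FUnit R\<close> has been traded for \<open>FUnit K\<close>, the unit law of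
  \<open>K\<close> applies, and naturality of the unitor of \<open>M\<close> makes it meet its
  inverse \<open>?i\<close>. The right unit law is parallel.\<close>

lemma R_FMult_left_unit:
  assumes [simp]: "A \<in> Obj M" "B \<in> Obj D"
  shows "Fun1 R (inv_arr M (LUnit M A), LUnit D B)
      \<cdot>\<^bsub>E\<^esub> (FMult R (\<I>\<^bsub>M\<^esub>, \<I>\<^bsub>D\<^esub>) (A, B) \<cdot>\<^bsub>E\<^esub> (FUnit R \<otimes>\<^bsub>E\<^esub> \<one>\<^bsub>E\<^esub> (Fun0 R (A, B))))
    = LUnit E (Fun0 R (A, B))"
    (is "?l = ?r")
proof (rule R_eqI)
  let ?p = "Fun0 R (A, B)" and ?e = "\<eta> A B" and ?i = "inv_arr M (LUnit M A)"
  let ?a = "Fun1 K (\<one>\<^bsub>E\<^esub> (\<I>\<^bsub>E\<^esub> \<odot>\<^bsub>E\<^esub> ?p), LUnit D B)"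
  have "Fun1 K (?l, \<one>\<^bsub>D\<^esub> B) \<cdot>\<^bsub>M\<^esub> ?e
      = ?a \<cdot>\<^bsub>M\<^esub> ((Fun1 K (FUnit R \<otimes>\<^bsub>E\<^esub> \<one>\<^bsub>E\<^esub> ?p, \<one>\<^bsub>D\<^esub> (\<I>\<^bsub>D\<^esub> \<odot>\<^bsub>D\<^esub> B))
        \<cdot>\<^bsub>M\<^esub> (FMult K (Fun0 R (\<I>\<^bsub>M\<^esub>, \<I>\<^bsub>D\<^esub>), \<I>\<^bsub>D\<^esub>) (?p, B) \<cdot>\<^bsub>M\<^esub> (\<eta> \<I>\<^bsub>M\<^esub> \<I>\<^bsub>D\<^esub> \<otimes>\<^bsub>M\<^esub> ?e))) \<cdot>\<^bsub>M\<^esub> ?i)"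
    by (simp add: K_Comp_left R_Fun1_nat K_exchange M.Comp_eq_tail[OF R_FMult_unit] M.Comp_assoc_arr)
  also have "\<dots> = ?a \<cdot>\<^bsub>M\<^esub> ((FMult K (\<I>\<^bsub>E\<^esub>, \<I>\<^bsub>D\<^esub>) (?p, B) \<cdot>\<^bsub>M\<^esub> (FUnit K \<otimes>\<^bsub>M\<^esub> ?e)) \<cdot>\<^bsub>M\<^esub> ?i)"
    by (subst K_FMult_nat_left) (simp_all add: R_FUnit_unit)
  also have "\<dots> = (?a \<cdot>\<^bsub>M\<^esub> (FMult K (\<I>\<^bsub>E\<^esub>, \<I>\<^bsub>D\<^esub>) (?p, B) \<cdot>\<^bsub>M\<^esub> (FUnit K \<otimes>\<^bsub>M\<^esub> \<one>\<^bsub>M\<^esub> (Fun0 K (?p, B)))))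
      \<cdot>\<^bsub>M\<^esub> ((\<one>\<^bsub>M\<^esub> \<I>\<^bsub>M\<^esub> \<otimes>\<^bsub>M\<^esub> ?e) \<cdot>\<^bsub>M\<^esub> ?i)"
    by (simp add: M.Comp_assoc_arr M.Comp_Tens1_tail)
  also have "\<dots> = Fun1 K (?r, \<one>\<^bsub>D\<^esub> B) \<cdot>\<^bsub>M\<^esub> ?e"
    by (subst K_FMult_left_unit) (simp_all add: M.Comp_assoc_arr M.Comp_eq_tail[OF M.LUnit_nat])
  finally show "Fun1 K (?l, \<one>\<^bsub>D\<^esub> B) \<cdot>\<^bsub>M\<^esub> ?e = Fun1 K (?r, \<one>\<^bsub>D\<^esub> B) \<cdot>\<^bsub>M\<^esub> ?e" .
qed auto

lemma R_FMult_right_unit: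
  assumes [simp]: "A \<in> Obj M" "B \<in> Obj D"
  shows "Fun1 R (inv_arr M (RUnit M A), RUnit D B)
      \<cdot>\<^bsub>E\<^esub> (FMult R (A, B) (\<I>\<^bsub>M\<^esub>, \<I>\<^bsub>D\<^esub>) \<cdot>\<^bsub>E\<^esub> (\<one>\<^bsub>E\<^esub> (Fun0 R (A, B)) \<otimes>\<^bsub>E\<^esub> FUnit R))
    = RUnit E (Fun0 R (A, B))"
    (is "?l = ?r")
proof (rule R_eqI)
  let ?p = "Fun0 R (A, B)" and ?e = "\<eta> A B" and ?i = "inv_arr M (RUnit M A)"
  let ?a = "Fun1 K (\<one>\<^bsub>E\<^esub> (?p \<odot>\<^bsub>E\<^esub> \<I>\<^bsub>E\<^esub>), RUnit D B)"
  have "Fun1 K (?l, \<one>\<^bsub>D\<^esub> B) \<cdot>\<^bsub>M\<^esub> ?e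
      = ?a \<cdot>\<^bsub>M\<^esub> ((Fun1 K (\<one>\<^bsub>E\<^esub> ?p \<otimes>\<^bsub>E\<^esub> FUnit R, \<one>\<^bsub>D\<^esub> (B \<odot>\<^bsub>D\<^esub> \<I>\<^bsub>D\<^esub>))
        \<cdot>\<^bsub>M\<^esub> (FMult K (?p, B) (Fun0 R (\<I>\<^bsub>M\<^esub>, \<I>\<^bsub>D\<^esub>), \<I>\<^bsub>D\<^esub>) \<cdot>\<^bsub>M\<^esub> (?e \<otimes>\<^bsub>M\<^esub> \<eta> \<I>\<^bsub>M\<^esub> \<I>\<^bsub>D\<^esub>))) \<cdot>\<^bsub>M\<^esub> ?i)"
    by (simp add: K_Comp_left R_Fun1_nat K_exchange M.Comp_eq_tail[OF R_FMult_unit] M.Comp_assoc_arr)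
  also have "\<dots> = ?a \<cdot>\<^bsub>M\<^esub> ((FMult K (?p, B) (\<I>\<^bsub>E\<^esub>, \<I>\<^bsub>D\<^esub>) \<cdot>\<^bsub>M\<^esub> (?e \<otimes>\<^bsub>M\<^esub> FUnit K)) \<cdot>\<^bsub>M\<^esub> ?i)"
    by (subst K_FMult_nat_left) (simp_all add: R_FUnit_unit)
  also have "\<dots> = (?a \<cdot>\<^bsub>M\<^esub> (FMult K (?p, B) (\<I>\<^bsub>E\<^esub>, \<I>\<^bsub>D\<^esub>) \<cdot>\<^bsub>M\<^esub> (\<one>\<^bsub>M\<^esub> (Fun0 K (?p, B)) \<otimes>\<^bsub>M\<^esub> FUnit K)))
      \<cdot>\<^bsub>M\<^esub> ((?e \<otimes>\<^bsub>M\<^esub> \<one>\<^bsub>M\<^esub> \<I>\<^bsub>M\<^esub>) \<cdot>\<^bsub>M\<^esub> ?i)"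
    by (simp add: M.Comp_assoc_arr M.Comp_Tens1_tail)
  also have "\<dots> = Fun1 K (?r, \<one>\<^bsub>D\<^esub> B) \<cdot>\<^bsub>M\<^esub> ?e"
    by (subst K_FMult_right_unit) (simp_all add: M.Comp_assoc_arr M.Comp_eq_tail[OF M.RUnit_nat])
  finally show "Fun1 K (?l, \<one>\<^bsub>D\<^esub> B) \<cdot>\<^bsub>M\<^esub> ?e = Fun1 K (?r, \<one>\<^bsub>D\<^esub> B) \<cdot>\<^bsub>M\<^esub> ?e" .
qed auto

text \<open>\<open>Braid M A' A\<close> is the braiding of \<open>opp M\<close> at \<open>A\<close>
  and \<open>A'\<close>. Moved past the units, it cancels the braiding of \<open>M\<close> produced
  by the law of \<open>K\<close>.\<close>

lemma R_FMult_braided: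
  assumes [simp]: "A \<in> Obj M" "B \<in> Obj D" "A' \<in> Obj M" "B' \<in> Obj D"
  shows "Fun1 R (Braid M A' A, Braid D B B') \<cdot>\<^bsub>E\<^esub> FMult R (A, B) (A', B')
    = FMult R (A', B') (A, B) \<cdot>\<^bsub>E\<^esub> Braid E (Fun0 R (A, B)) (Fun0 R (A', B'))"
    (is "?l = ?r")
proof (rule R_eqI)
  let ?p = "Fun0 R (A, B)" and ?p' = "Fun0 R (A', B')" and ?e = "\<eta> A B" and ?e' = "\<eta> A' B'"
  let ?BB = "B' \<odot>\<^bsub>D\<^esub> B" and ?AA = "A' \<odot>\<^bsub>M\<^esub> A"
  have "Fun1 K (?l, \<one>\<^bsub>D\<^esub> ?BB) \<cdot>\<^bsub>M\<^esub> \<eta> ?AA ?BB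
      = (Fun1 K (\<one>\<^bsub>E\<^esub> (?p \<odot>\<^bsub>E\<^esub> ?p'), Braid D B B') \<cdot>\<^bsub>M\<^esub> FMult K (?p, B) (?p', B'))
        \<cdot>\<^bsub>M\<^esub> ((?e \<otimes>\<^bsub>M\<^esub> ?e') \<cdot>\<^bsub>M\<^esub> Braid M A' A)"
    by (simp add: K_Comp_left R_Fun1_nat K_exchange M.Comp_eq_tail[OF R_FMult_unit] M.Comp_assoc_arr)
  also have "\<dots> = Fun1 K (Braid E ?p ?p', \<one>\<^bsub>D\<^esub> ?BB) \<cdot>\<^bsub>M\<^esub> (FMult K (?p', B') (?p, B) \<cdot>\<^bsub>M\<^esub> (?e' \<otimes>\<^bsub>M\<^esub> ?e))"
    by (subst K_FMult_braided) (simp_all add: M.Comp_assoc_arr M.Comp_eq_tail[OF M.Braid_nat])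
  also have "\<dots> = Fun1 K (?r, \<one>\<^bsub>D\<^esub> ?BB) \<cdot>\<^bsub>M\<^esub> \<eta> ?AA ?BB"
    by (simp add: K_Comp_left R_FMult_unit)
  finally show "Fun1 K (?l, \<one>\<^bsub>D\<^esub> ?BB) \<cdot>\<^bsub>M\<^esub> \<eta> ?AA ?BB = Fun1 K (?r, \<one>\<^bsub>D\<^esub> ?BB) \<cdot>\<^bsub>M\<^esub> \<eta> ?AA ?BB" .
qed auto

theorem R_braided_lax: "braided_lax_monoidal_functor (prod_cat (opp M) D) E R"
proof -
  interpret op: symmetric_monoidal_category "opp M" by (rule M.symmetric_monoidal_category_opp)
  interpret S: symmetric_monoidal_category "prod_cat (opp M) D"
    by (rule symmetric_monoidal_category_prod_cat) unfold_locales
  show ?thesis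
    by unfold_locales
      (auto simp: in_hom_iff R_Ident R_Comp R_FMult_nat R_FMult_assoc R_FMult_left_unit
        R_FMult_right_unit R_FMult_braided)
qed

end

section \<open>Universal measuring comonoids as a parametrized right adjoint\<close>

theorem corollary5p3:
  fixes \<kappa> :: "'k rel"
    and V :: "('o, 'a) closed_moncat"
    and P :: "('o, 'a) mon_obj \<Rightarrow> ('o, 'a) mon_obj \<Rightarrow> ('o, 'a) mon_obj"
    and \<phi> :: "('o, 'a) mon_obj \<Rightarrow> ('o, 'a) mon_obj \<Rightarrow> ('o, 'a) mon_obj
                \<Rightarrow> ('o, 'a) mon_arr \<Rightarrow> ('o, 'a) mon_arr"
  assumes "inaccessible \<kappa>"
    and "locally_presentable \<kappa> V"
    and "symmetric_monoidal_closed_category V"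
    and "\<And>A B. A \<in> Obj (Mon V) \<Longrightarrow> B \<in> Obj (Mon V)
           \<Longrightarrow> universal_measuring_comonoid V A B (P A B) (\<phi> A B)"
  shows "braided_lax_monoidal_functor (prod_cat (opp (Mon V)) (Mon V)) (Comon V)
           (measuring_functor V P \<phi>)"
proof -
  interpret V: symmetric_monoidal_closed_category V by fact
  interpret M: symmetric_monoidal_category "Mon V" by (rule V.symmetric_monoidal_category_Mon)
  interpret C: symmetric_monoidal_category "Comon V" by (rule V.symmetric_monoidal_category_Comon)
  interpret K: braided_lax_monoidal_functor "prod_cat (opp (Comon V)) (Mon V)" "Mon V" "conv_functor V"
    by (rule V.conv_functor_braided_lax)
  let ?M = "Mon V" and ?E = "Comon V" and ?R = "measuring_functor V P \<phi>"
  define \<eta> where "\<eta> = universal_measuring V P \<phi>"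
  \<comment> \<open>From here on arrows of \<open>Mon V\<close> are opaque: only the categorical
    laws are used, not their encoding as triples.\<close>
  note [simp del] = Mon_simps
  have K_simps: "Fun0 (conv_functor V) (X, B) = conv V X B" "Fun1 (conv_functor V) (h, g) = conv_map V h g"
    "FMult (conv_functor V) (X, B) (X', B') = conv_mult V X B X' B'" "FUnit (conv_functor V) = conv_unit V"
    for X B h g X' B'
    by (simp_all add: conv_functor_def)
  have K1: "conv_map V h g \<in> hom ?M (conv V X B) (conv V X' B')"
    if "h \<in> hom ?E X' X" "g \<in> hom ?M B B'" for h g X X' B B'
    using K.Fun1_in_hom[of "(h, g)" "(X, B)" "(X', B')"] that
    by (simp add: K_simps in_hom_prod_cat_iff)
  have P_Obj: "P A B \<in> Obj ?E"
    and bij: "\<And>X. X \<in> Obj ?E \<Longrightarrow> bij_betw (\<phi> A B X) (hom ?M A (conv V X B)) (hom ?E X (P A B))"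
    and nat: "\<And>X X' h f. X \<in> Obj ?E \<Longrightarrow> X' \<in> Obj ?E \<Longrightarrow> h \<in> hom ?E X' X \<Longrightarrow> f \<in> hom ?M A (conv V X B)
      \<Longrightarrow> \<phi> A B X' (conv_map V h (\<one>\<^bsub>Mon V\<^esub> B) \<cdot>\<^bsub>Mon V\<^esub> f) = \<phi> A B X f \<cdot>\<^bsub>Comon V\<^esub> h"
    if "A \<in> Obj ?M" "B \<in> Obj ?M" for A B
    using assms(4)[OF that] unfolding universal_measuring_comonoid_def by blast+
  \<comment> \<open>Surjectivity of the bijection onto endomorphisms of \<open>P A B\<close> makes
    the \<open>inv_into\<close> in the definition of the universal measuring meaningful.\<close>
  have eta: "\<eta> A B \<in> hom ?M A (conv V (P A B) B)" "\<phi> A B (P A B) (\<eta> A B) = \<one>\<^bsub>Comon V\<^esub> (P A B)"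
    if "A \<in> Obj ?M" "B \<in> Obj ?M" for A B
  proof -
    have "\<one>\<^bsub>Comon V\<^esub> (P A B) \<in> \<phi> A B (P A B) ` hom ?M A (conv V (P A B) B)"
      using bij_betw_imp_surj_on[OF bij[OF that P_Obj[OF that]]] C.Ident_in_hom[OF P_Obj[OF that]]
      by simp
    then show "\<eta> A B \<in> hom ?M A (conv V (P A B) B)" "\<phi> A B (P A B) (\<eta> A B) = \<one>\<^bsub>Comon V\<^esub> (P A B)"
      unfolding \<eta>_def universal_measuring_def by (auto intro: inv_into_into f_inv_into_f)
  qed
  \<comment> \<open>The Yoneda step: naturality along \<open>h\<close>, applied to the arrow that
    corresponds to the identity.\<close>
  have phi_conv_map: "\<phi> A B X (conv_map V h (\<one>\<^bsub>Mon V\<^esub> B) \<cdot>\<^bsub>Mon V\<^esub> \<eta> A B) = h"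
    if "A \<in> Obj ?M" "B \<in> Obj ?M" "h \<in> hom ?E X (P A B)" for A B X h
    using nat[OF that(1,2) P_Obj[OF that(1,2)] _ that(3) eta(1)[OF that(1,2)]] eta(2)[OF that(1,2)] that
    by (auto simp: in_hom_iff)
  \<comment> \<open>Conversely, by \<open>phi_conv_map\<close> the arrow recovered from
    \<open>\<phi> A B X f\<close> has the same image as \<open>f\<close>, and the bijection is
    injective.\<close>
  have phi: "\<phi> A B X f \<in> hom ?E X (P A B)"
      "conv_map V (\<phi> A B X f) (\<one>\<^bsub>Mon V\<^esub> B) \<cdot>\<^bsub>Mon V\<^esub> \<eta> A B = f"
    if AB: "A \<in> Obj ?M" "B \<in> Obj ?M" and X: "X \<in> Obj ?E" and f: "f \<in> hom ?M A (conv V X B)" for A B X f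
  proof -
    show h: "\<phi> A B X f \<in> hom ?E X (P A B)"
      using bij_betw_imp_surj_on[OF bij[OF AB X]] f by blast
    have "conv_map V (\<phi> A B X f) (\<one>\<^bsub>Mon V\<^esub> B) \<cdot>\<^bsub>Mon V\<^esub> \<eta> A B \<in> hom ?M A (conv V X B)"
      by (rule M.Comp_in_hom[OF eta(1)[OF AB] K1[OF h M.Ident_in_hom[OF AB(2)]]])
    then show "conv_map V (\<phi> A B X f) (\<one>\<^bsub>Mon V\<^esub> B) \<cdot>\<^bsub>Mon V\<^esub> \<eta> A B = f"
      using bij_betw_imp_inj_on[OF bij[OF AB X]] phi_conv_map[OF AB h] f by (auto dest: inj_onD)
  qed
  have R0: "Fun0 ?R (A, B) = P A B" for A B
    by (simp add: measuring_functor_def)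
  \<comment> \<open>The bijections are controlled only on their hom-sets, so for each arrow produced
    by \<open>measuring_functor\<close> the argument of \<open>\<phi>\<close> must be shown to lie
    in the right one; this is the purpose of the facts ending in \<open>_arg\<close>.\<close>
  have R1: "Fun1 ?R (f, g) = \<phi> A' B' (P A B) (conv_map V (\<one>\<^bsub>Comon V\<^esub> (P A B)) g \<cdot>\<^bsub>Mon V\<^esub> (\<eta> A B \<cdot>\<^bsub>Mon V\<^esub> f))"
    and R1_arg: "conv_map V (\<one>\<^bsub>Comon V\<^esub> (P A B)) g \<cdot>\<^bsub>Mon V\<^esub> (\<eta> A B \<cdot>\<^bsub>Mon V\<^esub> f) \<in> hom ?M A' (conv V (P A B) B')"
    and R1_Obj: "A \<in> Obj ?M" "A' \<in> Obj ?M" "B \<in> Obj ?M" "B' \<in> Obj ?M"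
    if "f \<in> hom ?M A' A" "g \<in> hom ?M B B'" for f g A A' B B'
  proof -
    show o: "A \<in> Obj ?M" "A' \<in> Obj ?M" "B \<in> Obj ?M" "B' \<in> Obj ?M"
      using that by (auto simp: in_hom_iff)
    show "Fun1 ?R (f, g) = \<phi> A' B' (P A B) (conv_map V (\<one>\<^bsub>Comon V\<^esub> (P A B)) g \<cdot>\<^bsub>Mon V\<^esub> (\<eta> A B \<cdot>\<^bsub>Mon V\<^esub> f))"
      using that by (auto simp: measuring_functor_def in_hom_iff \<eta>_def)
    show "conv_map V (\<one>\<^bsub>Comon V\<^esub> (P A B)) g \<cdot>\<^bsub>Mon V\<^esub> (\<eta> A B \<cdot>\<^bsub>Mon V\<^esub> f) \<in> hom ?M A' (conv V (P A B) B')"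
      using that by (intro M.Comp_in_hom[OF M.Comp_in_hom[OF that(1) eta(1)]] K1 C.Ident_in_hom P_Obj o)
  qed
  have R2: "FMult ?R (A, B) (A', B') = \<phi> (A \<odot>\<^bsub>Mon V\<^esub> A') (B \<odot>\<^bsub>Mon V\<^esub> B') (P A B \<odot>\<^bsub>Comon V\<^esub> P A' B')
      (conv_mult V (P A B) B (P A' B') B' \<cdot>\<^bsub>Mon V\<^esub> (\<eta> A B \<otimes>\<^bsub>Mon V\<^esub> \<eta> A' B'))" for A B A' B'
    by (simp add: measuring_functor_def \<eta>_def)
  have R2_arg: "conv_mult V (P A B) B (P A' B') B' \<cdot>\<^bsub>Mon V\<^esub> (\<eta> A B \<otimes>\<^bsub>Mon V\<^esub> \<eta> A' B')
      \<in> hom ?M (A \<odot>\<^bsub>Mon V\<^esub> A') (conv V (P A B \<odot>\<^bsub>Comon V\<^esub> P A' B') (B \<odot>\<^bsub>Mon V\<^esub> B'))"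
    if "A \<in> Obj ?M" "B \<in> Obj ?M" "A' \<in> Obj ?M" "B' \<in> Obj ?M" for A B A' B'
    using K.FMult_in_hom[of "(P A B, B)" "(P A' B', B')"] that
    by (intro M.Comp_in_hom[OF M.Tens1_in_hom[OF eta(1) eta(1)]]) (auto simp: K_simps P_Obj)
  have R3: "FUnit ?R = \<phi> \<I>\<^bsub>Mon V\<^esub> \<I>\<^bsub>Mon V\<^esub> \<I>\<^bsub>Comon V\<^esub> (conv_unit V)"
    by (simp add: measuring_functor_def)
  have R3_arg: "conv_unit V \<in> hom ?M \<I>\<^bsub>Mon V\<^esub> (conv V \<I>\<^bsub>Comon V\<^esub> \<I>\<^bsub>Mon V\<^esub>)"
    using K.FUnit_in_hom by (simp add: K_simps)
  \<comment> \<open>Uniqueness is \<open>phi_conv_map\<close>; the defining equations of the action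
    and of the structure maps are \<open>phi\<close> at the typed arguments.\<close>
  interpret R: parametrized_right_adjoint "Comon V" "Mon V" "Mon V" "conv_functor V"
    "measuring_functor V P \<phi>" \<eta>
  proof unfold_locales
    fix A B X h h'
    assume "A \<in> Obj ?M" "B \<in> Obj ?M" "h \<in> hom ?E X (Fun0 ?R (A, B))" "h' \<in> hom ?E X (Fun0 ?R (A, B))"
      "Fun1 (conv_functor V) (h, \<one>\<^bsub>Mon V\<^esub> B) \<cdot>\<^bsub>Mon V\<^esub> \<eta> A B
        = Fun1 (conv_functor V) (h', \<one>\<^bsub>Mon V\<^esub> B) \<cdot>\<^bsub>Mon V\<^esub> \<eta> A B"
    then show "h = h'"
      unfolding K_simps R0 using phi_conv_map[of A B h X] phi_conv_map[of A B h' X] by metis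
  next
    fix f g A A' B B'
    assume fg: "f \<in> hom ?M A' A" "g \<in> hom ?M B B'"
    note o = R1_Obj[OF fg]
    show "Fun1 ?R (f, g) \<in> hom ?E (Fun0 ?R (A, B)) (Fun0 ?R (A', B'))"
      "Fun1 (conv_functor V) (Fun1 ?R (f, g), \<one>\<^bsub>Mon V\<^esub> B') \<cdot>\<^bsub>Mon V\<^esub> \<eta> A' B'
        = Fun1 (conv_functor V) (\<one>\<^bsub>Comon V\<^esub> (Fun0 ?R (A, B)), g) \<cdot>\<^bsub>Mon V\<^esub> (\<eta> A B \<cdot>\<^bsub>Mon V\<^esub> f)"
      unfolding R0 R1[OF fg] K_simps
      using phi[OF o(2,4) P_Obj[OF o(1,3)] R1_arg[OF fg]] by blast+
  next
    fix A B A' B'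
    assume o: "A \<in> Obj ?M" "B \<in> Obj ?M" "A' \<in> Obj ?M" "B' \<in> Obj ?M"
    show "FMult ?R (A, B) (A', B') \<in> hom ?E (Fun0 ?R (A, B) \<odot>\<^bsub>Comon V\<^esub> Fun0 ?R (A', B'))
        (Fun0 ?R (A \<odot>\<^bsub>Mon V\<^esub> A', B \<odot>\<^bsub>Mon V\<^esub> B'))"
      "Fun1 (conv_functor V) (FMult ?R (A, B) (A', B'), \<one>\<^bsub>Mon V\<^esub> (B \<odot>\<^bsub>Mon V\<^esub> B'))
          \<cdot>\<^bsub>Mon V\<^esub> \<eta> (A \<odot>\<^bsub>Mon V\<^esub> A') (B \<odot>\<^bsub>Mon V\<^esub> B')
        = FMult (conv_functor V) (Fun0 ?R (A, B), B) (Fun0 ?R (A', B'), B') \<cdot>\<^bsub>Mon V\<^esub> (\<eta> A B \<otimes>\<^bsub>Mon V\<^esub> \<eta> A' B')"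
      unfolding R0 R2 K_simps
      using phi[OF M.Tens0_Obj[OF o(1,3)] M.Tens0_Obj[OF o(2,4)] C.Tens0_Obj[OF P_Obj[OF o(1,2)] P_Obj[OF o(3,4)]]
          R2_arg[OF o]] by blast+
  next
    show "FUnit ?R \<in> hom ?E \<I>\<^bsub>Comon V\<^esub> (Fun0 ?R (\<I>\<^bsub>Mon V\<^esub>, \<I>\<^bsub>Mon V\<^esub>))"
      "Fun1 (conv_functor V) (FUnit ?R, \<one>\<^bsub>Mon V\<^esub> \<I>\<^bsub>Mon V\<^esub>) \<cdot>\<^bsub>Mon V\<^esub> \<eta> \<I>\<^bsub>Mon V\<^esub> \<I>\<^bsub>Mon V\<^esub> = FUnit (conv_functor V)"
      unfolding R0 R3 K_simps
      using phi[OF M.TUnit_Obj M.TUnit_Obj C.TUnit_Obj R3_arg] by blast+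
  qed (simp_all add: R0 P_Obj K_simps eta)
  show ?thesis by (rule R.R_braided_lax)
qed

end
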